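(* For $p\in(0,1)$ and $M>0$ let $v^{\mathrm{ann}}_{p,M}$ be the annealed asymptotic speed of the killed random walk on $\mathbb{Z}$ in the i.i.d. Bernoulli potential taking value $M$ with probability $p$ and $0$ with probability $1-p$. Then: (i) for every $M_0>0$, $\;-\log v^{\mathrm{ann}}_{p,M}\sim \dfrac{2(e^M-1)}{p}$ as $p\to 0$, uniformly in $M\in[M_0,\infty)$; (ii) $\;-\log v^{\mathrm{ann}}_{p,M}\sim \dfrac{2(1-p)e^M}{p}$ as $M\to\infty$, locally uniformly in $p\in(0,1)$.
   Context: Potential: for $p\in(0,1]$, $M>0$, let $V(x,\omega)$, $x\in\mathbb{Z}$, be i.i.d. random variables on a probability space $(\Omega,\mathcal{F},\mathbb{P})$ (expectation $\mathbb{E}$) with $\mathbb{P}(V(x,\cdot)=M)=p=1-\mathbb{P}(V(x,\cdot)=0)$. Killed walk: for fixed $\omega$, $P^\omega$ is the law of the Markov chain $(S_n)_{n\ge0}$ on $\mathbb{Z}\cup\{\dagger\}$ started at $0$ which from $x\in\mathbb{Z}$ moves to $\dagger$ with probability $1-e^{-V(x,\omega)}$ and to each of $x\pm1$ with probability $\frac12e^{-V(x,\omega)}$; $\dagger$ is absorbing. Set $\tau_x=\inf\{n>0: S_n=x\}\in\mathbb{N}\cup\{\infty\}$. Annealed measure: for $y\in\mathbb{N}$, $Q_y$ is the measure on the product space of $\Omega$ and nearest-neighbor paths starting from $0$ given by $Q_y(B)=\dfrac{\mathbb{E}(P^\omega(B\cap\{\tau_y<\infty\}))}{\mathbb{E}(P^\omega(\tau_y<\infty))}$,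 with expectation $E_{Q_y}$. Annealed speed: $v^{\mathrm{ann}}_{p,M}$ is defined by $\dfrac{1}{v^{\mathrm{ann}}_{p,M}}=\lim_{y\to\infty}\dfrac{E_{Q_y}(\tau_y)}{y}$; it is known that this limit exists and is finite. Notation: $f\sim g$ means $f/g\to1$; "uniformly" means that the convergence of the ratio to $1$ is uniform in the indicated parameter, and "locally uniformly in $p\in(0,1)$" means uniformly on compact subsets of $(0,1)$. *)

theory Defs
  imports "HOL-Probability.Probability"
begin

abbreviation paths :: "(nat \<Rightarrow> 'a) measure" where
  "paths \<equiv> \<Pi>\<^sub>M n\<in>UNIV. count_space UNIV"

definition chain_kernel :: "('a \<Rightarrow> 'a pmf) \<Rightarrow> 'a \<Rightarrow> nat \<Rightarrow> (nat \<Rightarrow> 'a) \<Rightarrow> 'a measure" where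
  "chain_kernel K a n s =
     (if n = 0 then measure_pmf (return_pmf a) else measure_pmf (K (s (n - 1))))"

text \<open>The path measure given by the Ionescu-Tulcea theorem; see \<open>emeasure_markov_chain\<close> below
  for the probabilities of cylinder sets.\<close>
definition markov_chain :: "('a \<Rightarrow> 'a pmf) \<Rightarrow> 'a \<Rightarrow> (nat \<Rightarrow> 'a) measure" where
  "markov_chain K a =
     projective_family.lim UNIV (Ionescu_Tulcea.CI (chain_kernel K a) (\<lambda>_. count_space UNIV))
       (\<lambda>_. count_space UNIV)"

lemma Ionescu_Tulcea_chain_kernel:
  fixes K :: "'a::countable \<Rightarrow> 'a pmf"
  shows "Ionescu_Tulcea (chain_kernel K a) (\<lambda>_. count_space UNIV)"
proof (rule Ionescu_Tulcea.intro)
  fix i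
  show "chain_kernel K a i \<in> PiM {0..<i} (\<lambda>_. count_space UNIV) \<rightarrow>\<^sub>M subprob_algebra (count_space UNIV)"
  proof (cases "i = 0")
    case True
    then show ?thesis
      by (simp add: chain_kernel_def[abs_def] measure_pmf_in_subprob_algebra)
  next
    case False
    have [measurable]: "(\<lambda>x. measure_pmf (K x)) \<in> count_space UNIV \<rightarrow>\<^sub>M subprob_algebra (count_space UNIV)"
      by (auto simp: measure_pmf_in_subprob_algebra)
    have [measurable]: "(\<lambda>s. s (i - 1)) \<in> PiM {0..<i} (\<lambda>_. count_space UNIV) \<rightarrow>\<^sub>M (count_space UNIV :: 'a measure)"
      using False by (intro measurable_component_singleton) auto
    show ?thesis
      using False by (simp add: chain_kernel_def[abs_def])
  qed
next
  fix i x
  show "prob_space (chain_kernel K a i x)"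
    by (simp add: chain_kernel_def measure_pmf.prob_space_axioms)
qed

lemma
  fixes K :: "'a::countable \<Rightarrow> 'a pmf"
  shows prob_space_markov_chain: "prob_space (markov_chain K a)"
    and sets_markov_chain: "sets (markov_chain K a) = sets paths"
    and emeasure_markov_chain:
      "emeasure (markov_chain K a) {s. \<forall>i\<le>n. s i = b i} =
         (if b 0 = a then \<Prod>i<n. ennreal (pmf (K (b i)) (b (Suc i))) else 0)"
proof -
  let ?M = "\<lambda>_::nat. count_space UNIV :: 'a measure"
  interpret Ionescu_Tulcea "chain_kernel K a" ?M
    by (rule Ionescu_Tulcea_chain_kernel)
  have eq: "markov_chain K a = PF.lim"
    by (simp add: markov_chain_def)
  show sets: "sets (markov_chain K a) = sets paths"
    by (simp add: eq)
  have sing: "{restrict b J} \<in> sets (PiM J ?M)" if "finite J" for J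
  proof -
    have "{restrict b J} = PiE J (\<lambda>i. {b i})"
      by (auto simp: PiE_iff extensional_def fun_eq_iff restrict_def)
    then show ?thesis
      using sets_PiM_I_finite[OF that, of "\<lambda>i. {b i}" ?M] by simp
  qed
  have ck: "chain_kernel K a 0 s = measure_pmf (return_pmf a)"
    "chain_kernel K a (Suc m) s = measure_pmf (K (s m))" for s m
    by (simp_all add: chain_kernel_def)
  have C: "emeasure (C 0 (Suc n) (\<lambda>_. undefined)) {restrict b {0..<Suc n}} =
      (if b 0 = a then \<Prod>i<n. ennreal (pmf (K (b i)) (b (Suc i))) else 0)" for n
  proof (induction n)
    case 0
    have [simp]: "(\<lambda>_. undefined) \<in> space (PiM {} ?M)"
      by (simp add: space_PiM)
    have *: "C 0 (Suc 0) (\<lambda>_. undefined) = eP 0 (\<lambda>_. undefined)"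
      by (simp add: bind_return[OF measurable_eP[of 0, simplified]])
    have "(\<lambda>x. (\<lambda>_. undefined)(0 := x)) -` {restrict b {0..<Suc 0}} = {b 0}"
      by (auto simp: restrict_def fun_eq_iff split: if_splits)
    then have "emeasure (eP 0 (\<lambda>_. undefined)) {restrict b {0..<Suc 0}} =
        emeasure (measure_pmf (return_pmf a)) {b 0}"
      using emeasure_eP[of "\<lambda>_. undefined" 0 "{restrict b {0..<Suc 0}}"] sing[of "{0..<Suc 0}"]
      by (simp add: ck)
    moreover have "emeasure (measure_pmf (return_pmf a)) {b 0} = (if b 0 = a then 1 else 0)"
      by (simp add: emeasure_pmf_single)
    ultimately show ?case
      by (simp only: * lessThan_0 prod.empty)
  next
    case (Suc n)
    let ?b = "\<lambda>n. restrict b {0..<n}"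
    let ?C = "C 0 (Suc n) (\<lambda>_. undefined)"
    have u [simp]: "(\<lambda>_. undefined) \<in> space (PiM {0..<0} ?M)"
      by (simp add: space_PiM)
    have sp: "space ?C = space (PiM {0..<Suc n} ?M)" and st: "sets ?C = sets (PiM {0..<Suc n} ?M)"
      using space_C[OF u, of "Suc n"] sets_C[OF u, of "Suc n"] by (simp_all del: C.simps)
    have ne: "space ?C \<noteq> {}"
      using prob_space.not_empty[OF prob_space_C[OF u]] .
    have meas: "eP (Suc n) \<in> ?C \<rightarrow>\<^sub>M subprob_algebra (PiM {0..<Suc (Suc n)} ?M)"
      using measurable_eP[of "Suc n"] by (simp add: measurable_cong_sets[OF st refl] del: C.simps)
    have eP: "emeasure (eP (Suc n) x) {?b (Suc (Suc n))} =
        ennreal (pmf (K (b n)) (b (Suc n))) * indicator {?b (Suc n)} x" if x: "x \<in> space ?C" for x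
    proof -
      have x': "x \<in> extensional {0..<Suc n}"
        using x by (simp add: sp space_PiM PiE_def del: C.simps)
      have "(\<lambda>y. x(Suc n := y)) -` {?b (Suc (Suc n))} = (if x = ?b (Suc n) then {b (Suc n)} else {})"
      proof -
        have "x(Suc n := y) = ?b (Suc (Suc n)) \<longleftrightarrow> x = ?b (Suc n) \<and> y = b (Suc n)" for y
        proof -
          have *: "x i = undefined" if "\<not> i < Suc n" for i
            using x' that by (auto simp: extensional_def)
          show ?thesis
            unfolding fun_eq_iff restrict_def fun_upd_def
            using * by (auto simp: less_Suc_eq) 
        qed
        then show ?thesis
          by (simp add: vimage_def)
      qed
      moreover have "x \<in> space (PiM {0..<Suc n} ?M)"
        using x by (simp add: sp del: C.simps)
      ultimately show ?thesis
        using emeasure_eP[of x "Suc n" "{?b (Suc (Suc n))}"] sing[of "{0..<Suc (Suc n)}"]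
        by (simp add: ck emeasure_pmf_single)
    qed
    have "emeasure (C 0 (Suc (Suc n)) (\<lambda>_. undefined)) {?b (Suc (Suc n))} =
        (\<integral>\<^sup>+x. emeasure (eP (Suc n) x) {?b (Suc (Suc n))} \<partial>?C)"
      using emeasure_bind[OF ne meas sing[of "{0..<Suc (Suc n)}"]] by simp
    also have "\<dots> = (\<integral>\<^sup>+x. ennreal (pmf (K (b n)) (b (Suc n))) * indicator {?b (Suc n)} x \<partial>?C)"
      by (intro nn_integral_cong eP)
    also have "\<dots> = ennreal (pmf (K (b n)) (b (Suc n))) * emeasure ?C {?b (Suc n)}"
      by (rule nn_integral_cmult_indicator) (simp only: st sing finite_atLeastLessThan)
    also note Suc.IH
    finally show ?case
      by (simp only: prod.lessThan_Suc mult.commute[of "ennreal (pmf (K (b n)) (b (Suc n)))"]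
          mult_zero_left if_distribR if_distrib[of "\<lambda>x. x * _"])
  qed
  show "prob_space (markov_chain K a)"
  proof
    have e: "{\<lambda>_. undefined} \<in> sets (PiM {} ?M)"
      using sets.top[of "PiM {} ?M"] by (simp add: space_PiM)
    have "PF.emb UNIV {} {\<lambda>_. undefined} = space (markov_chain K a)"
      using sets_eq_imp_space_eq[OF sets] by (auto simp: prod_emb_def space_PiM)
    moreover have "emeasure PF.lim (PF.emb UNIV {} {\<lambda>_. undefined}) = 1"
      using lim[OF _ e] prob_space.emeasure_space_1[OF PF.prob_space_P[of "{}"]]
      by (simp add: CI_def space_PiM)
    ultimately show "emeasure (markov_chain K a) (space (markov_chain K a)) = 1"
      by (simp add: eq)
  qed
  show "emeasure (markov_chain K a) {s. \<forall>i\<le>n. s i = b i} =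
         (if b 0 = a then \<Prod>i<n. ennreal (pmf (K (b i)) (b (Suc i))) else 0)"
  proof -
    have "restrict s J = restrict b J \<longleftrightarrow> (\<forall>i\<in>J. s i = b i)" for s and J :: "nat set"
      by (metis restrict_apply' restrict_ext)
    then have "{s. \<forall>i\<le>n. s i = b i} = PF.emb UNIV {0..<Suc n} {restrict b {0..<Suc n}}"
      by (auto simp: prod_emb_def space_PiM less_Suc_eq_le)
    then have "emeasure (markov_chain K a) {s. \<forall>i\<le>n. s i = b i} =
        emeasure (CI {0..<Suc n}) {restrict b {0..<Suc n}}"
      unfolding eq using lim[OF _ sing, of "{0..<Suc n}"] by simp
    also have "\<dots> = emeasure (C 0 (Suc n) (\<lambda>_. undefined))
        (PF.emb {0..<Suc n} {0..<Suc n} {restrict b {0..<Suc n}})"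
      by (rule emeasure_CI) (auto intro: sing)
    also have "PF.emb {0..<Suc n} {0..<Suc n} {restrict b {0..<Suc n}} = {restrict b {0..<Suc n}}"
      by (rule prod_emb_id) (auto simp: PiE_iff)
    also note C
    finally show ?thesis .
  qed
qed

locale bernoulli_potential = prob_space \<Omega> for \<Omega> :: "'w measure" +
  fixes V :: "int \<Rightarrow> 'w \<Rightarrow> real" and p M :: real
  assumes p_pos: "0 < p" and p_le_1: "p \<le> 1" and M_pos: "0 < M"
    and indep: "indep_vars (\<lambda>_. borel) V UNIV"
    and prob_M: "\<And>x. prob {\<omega> \<in> space \<Omega>. V x \<omega> = M} = p"
    and prob_0: "\<And>x. prob {\<omega> \<in> space \<Omega>. V x \<omega> = 0} = 1 - p"

text \<open>The state \<open>None\<close> is the cemetery \<open>\<dagger>\<close>; the argument \<open>v\<close> is a fixed realization of the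
  potential, assumed to be nonnegative.\<close>
definition killed_step :: "(int \<Rightarrow> real) \<Rightarrow> int option \<Rightarrow> int option pmf" where
  "killed_step v z = (case z of
     None \<Rightarrow> return_pmf None
   | Some x \<Rightarrow> bind_pmf (bernoulli_pmf (exp (- v x))) (\<lambda>alive.
       if alive then pmf_of_set {Some (x + 1), Some (x - 1)} else return_pmf None))"

lemma pmf_killed_step:
  assumes "0 \<le> v x"
  shows "pmf (killed_step v (Some x)) None = 1 - exp (- v x)"
    and "pmf (killed_step v (Some x)) (Some (x + 1)) = exp (- v x) / 2"
    and "pmf (killed_step v (Some x)) (Some (x - 1)) = exp (- v x) / 2"
  using assms by (simp_all add: killed_step_def pmf_bind pmf_of_set indicator_def)

definition quenched :: "(int \<Rightarrow> real) \<Rightarrow> (nat \<Rightarrow> int option) measure" where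
  "quenched v = markov_chain (killed_step v) (Some 0)"

text \<open>The infimum of the empty set in \<open>enat\<close> is \<open>\<infinity>\<close>; time 0 is excluded.\<close>
definition hitting_time :: "int \<Rightarrow> (nat \<Rightarrow> int option) \<Rightarrow> enat" where
  "hitting_time x s = (INF n\<in>{n. 0 < n \<and> s n = Some x}. enat n)"

text \<open>The measure \<open>Q\<^sub>y\<close>, on \<open>\<Omega>\<close> times all sequences of states (the quenched law is carried by
  nearest-neighbour paths from 0, possibly killed).\<close>
definition annealed ::
    "'w measure \<Rightarrow> (int \<Rightarrow> 'w \<Rightarrow> real) \<Rightarrow> nat \<Rightarrow> ('w \<times> (nat \<Rightarrow> int option)) measure" where
  "annealed \<Omega> V y = measure_of (space (\<Omega> \<Otimes>\<^sub>M paths)) (sets (\<Omega> \<Otimes>\<^sub>M paths))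
     (\<lambda>B. (\<integral>\<^sup>+\<omega>. emeasure (quenched (\<lambda>x. V x \<omega>))
                  {s. (\<omega>, s) \<in> B \<and> hitting_time (int y) s < \<infinity>} \<partial>\<Omega>)
          / (\<integral>\<^sup>+\<omega>. emeasure (quenched (\<lambda>x. V x \<omega>)) {s. hitting_time (int y) s < \<infinity>} \<partial>\<Omega>))"

definition annealed_mean_hitting_time :: "'w measure \<Rightarrow> (int \<Rightarrow> 'w \<Rightarrow> real) \<Rightarrow> nat \<Rightarrow> ennreal" where
  "annealed_mean_hitting_time \<Omega> V y =
     (\<integral>\<^sup>+ z. ennreal_of_enat (hitting_time (int y) (snd z)) \<partial>annealed \<Omega> V y)"

text \<open>The limit is taken in \<open>ennreal\<close>, so that infinite means are not mistaken for 0.\<close>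
definition annealed_speed :: "'w measure \<Rightarrow> (int \<Rightarrow> 'w \<Rightarrow> real) \<Rightarrow> real" where
  "annealed_speed \<Omega> V =
     1 / enn2real (lim (\<lambda>y. annealed_mean_hitting_time \<Omega> V y / of_nat y))"

end

theory Submission
  imports Defs "HOL-Real_Asymp.Real_Asymp"
begin

text \<open>
  In one dimension the probability of ever going from \<open>k\<close> to \<open>k + 1\<close> and the conditional mean time
  this takes satisfy a first-order recursion in \<open>k\<close>, so hitting \<open>y\<close> has a product weight \<open>W\<close> and a
  mean time that is a sum over sites. The quenched weight is log-supermodular in the environment;
  hence, by the FKG inequality, tilting the environment by the weight of a larger window increases
  the mean delay at a site. The delay is therefore monotone in both margins of the window, its
  Cesaro averages converge, and \<open>1 / v\<close> is its supremum.

  A gap of length \<open>L\<close> between traps costs about \<open>\<kappa> / L\<close> with \<open>\<kappa> = 1 / (2 (e\<^sup>M - 1))\<close>. Summing over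
  the position of the last trap gives a renewal inequality, and the partition function grows like
  \<open>((1 - p) e\<^sup>\<Delta>)\<^sup>n\<close>, where \<open>\<Sum> e\<^sup>-\<^sup>\<Delta>\<^sup>L / L = D := (1 - p) / (p \<kappa>)\<close>, that is \<open>\<Delta> \<approx> e\<^sup>-\<^sup>D\<close>. Long gaps of
  length of order \<open>e\<^sup>D\<close> dominate the time, so \<open>log (1 / v) \<sim> D = 2 (1 - p) (e\<^sup>M - 1) / p\<close>. This single
  asymptotic statement, valid as \<open>D \<rightarrow> \<infinity>\<close> with \<open>M\<close> bounded away from 0, contains both regimes.
\<close>

subsection \<open>The killed walk on a half-line\<close>

text \<open>The tilted law of the environment is not a product measure, so local computations are
  replaced by exponential rates of a partition function \<open>Z t n\<close> with an extra fugacity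
  \<open>t\<close> per trap. A trap damps the delay recursion by a factor of at most
  \<open>t = e / (2 - e)\<close>, so the mean delay is bounded by tilted Laplace transforms of trap
  counts in blocks. By FKG these are supermultiplicative in the block length and hence obey the
  exponential rate without any constant. \<open>Z t n\<close> grows at most like q (1 + exp (-D /
  t)) per site, up to o(1) in the exponent, and \<open>Z 1 n\<close> at least like q (1 + exp (-D)).
  Since 1 / t > 1 the former correction is negligible, and a geometric series of ratio 1 - exp (-D)
  yields exp D. This requires \<open>t\<close> bounded below 1 and \<open>\<kappa>\<close> bounded
  above, which is what M bounded away from 0 provides. Conversely, a fugacity slightly above 1 and
  Jensen's inequality bound the trap density by about exp (-D); free runs are then long, and the
  delay at a site is at least two thirds of the free run behind it.\<close>

text \<open>
  \<open>u k\<close> is the probability of a step from \<open>k\<close> in a given direction; walks are killed when they leave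
  \<open>{0..}\<close>. Then \<open>rho u (Suc k)\<close> is the probability of ever reaching \<open>k + 1\<close> from \<open>k\<close>, and \<open>mu u (Suc k)\<close>
  the mean duration given that this happens. The index is shifted so that \<open>rho u 0 = 0\<close> encodes the
  killing at the left end.
\<close>

primrec rho :: "(nat \<Rightarrow> real) \<Rightarrow> nat \<Rightarrow> real" where
  "rho u 0 = 0"
| "rho u (Suc k) = u k / (1 - u k * rho u k)"

text \<open>Given that \<open>k + 1\<close> is reached, the number of excursions to the left of
  \<open>k\<close> is geometric with ratio \<open>u k * rho u k\<close>, and each costs one step
  left plus a return from \<open>k - 1\<close> of mean duration \<open>mu u k\<close>.\<close>

primrec mu :: "(nat \<Rightarrow> real) \<Rightarrow> nat \<Rightarrow> real" where
  "mu u 0 = 0"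
| "mu u (Suc k) = (1 + u k * rho u k * mu u k) / (1 - u k * rho u k)"

definition admissible :: "(nat \<Rightarrow> real) \<Rightarrow> bool" where
  "admissible u \<longleftrightarrow> (\<forall>k. 0 \<le> u k \<and> u k \<le> 1 / 2)"

lemma admissibleD: "admissible u \<Longrightarrow> 0 \<le> u k" "admissible u \<Longrightarrow> u k \<le> 1 / 2"
  by (auto simp: admissible_def)

lemma mult_le_half: "0 \<le> a \<Longrightarrow> a \<le> 1/2 \<Longrightarrow> 0 \<le> r \<Longrightarrow> r \<le> 1 \<Longrightarrow> a * r \<le> (1/2::real)"
  using mult_mono[of a "1/2" r 1] by simp

lemma rho_bounds:
  assumes "admissible u"
  shows "0 \<le> rho u k \<and> rho u k \<le> 1"
proof (induction k)
  case (Suc k)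
  have "u k * rho u k \<le> 1 / 2"
    using mult_le_half[OF admissibleD[OF assms]] Suc by auto
  then show ?case
    using admissibleD[OF assms, of k] by (auto simp: divide_simps)
qed simp

lemmas rho_nonneg = rho_bounds[THEN conjunct1]
  and rho_le_1 = rho_bounds[THEN conjunct2]

lemma rho_mult_le: "admissible u \<Longrightarrow> u k * rho u k \<le> 1 / 2"
  by (intro mult_le_half admissibleD rho_nonneg rho_le_1)

lemma rho_mult_nonneg: "admissible u \<Longrightarrow> 0 \<le> u k * rho u k"
  by (intro mult_nonneg_nonneg admissibleD rho_nonneg)

lemma rho_pos: "admissible u \<Longrightarrow> 0 < u k \<Longrightarrow> 0 < rho u (Suc k)"
  using rho_mult_le[of u k] by simp

lemma mu_nonneg: "admissible u \<Longrightarrow> 0 \<le> mu u k"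
proof (induction k)
  case (Suc k)
  then show ?case
    using rho_mult_le[of u k] rho_mult_nonneg[of u k] by simp
qed simp

lemma rho_mono:
  assumes "admissible u" "admissible v" "\<And>k. u k \<le> v k"
  shows "rho u k \<le> rho v k"
proof (induction k)
  case (Suc k)
  have "u k * rho u k \<le> v k * rho v k"
    by (intro mult_mono assms admissibleD rho_nonneg Suc)
  then show ?case
    using rho_mult_le[OF assms(2), of k] by (auto intro!: frac_le assms admissibleD)
qed simp

lemma mu_mono:
  assumes "admissible u" "admissible v" "\<And>k. u k \<le> v k"
  shows "mu u k \<le> mu v k"
proof (induction k)
  case (Suc k)
  have "u k * rho u k \<le> v k * rho v k"
    by (intro mult_mono assms admissibleD rho_nonneg rho_mono)
  then show ?case
    using rho_mult_le[OF assms(2), of k] rho_mult_nonneg[OF assms(2), of k] mu_nonneg[OF assms(2)]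
      mu_nonneg[OF assms(1), of k] rho_mult_nonneg[OF assms(1), of k] Suc
    by (auto intro!: frac_le add_mono mult_mono)
qed simp

lemma rho_cong: "(\<And>i. i < k \<Longrightarrow> u i = v i) \<Longrightarrow> rho u k = rho v k"
  by (induction k) auto

lemma mu_cong: "(\<And>i. i < k \<Longrightarrow> u i = v i) \<Longrightarrow> mu u k = mu v k"
proof (induction k)
  case (Suc k)
  then show ?case using rho_cong[of k u v] by auto
qed simp

text \<open>The induction step for \<open>rho_supermodular\<close>. Here \<open>s\<close> and
  \<open>t\<close> are the larger and the smaller step probability at the site, \<open>c\<close> and
  \<open>d\<close> the values of \<open>rho\<close> in the environments owning them,
  \<open>a\<close> and \<open>b\<close> those of the maximum and the minimum. The numerators agree,
  so only denominators are compared; \<open>key\<close> is that comparison, and it follows from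
  \<open>c * d \<le> a * b\<close> after multiplication by \<open>c\<close>.\<close>

lemma supermodular_step:
  fixes a b c d s t :: real
  assumes "0 \<le> b" "b \<le> c" "b \<le> d" "c \<le> a" "d \<le> a" "c * d \<le> a * b"
    and "0 \<le> t" "t \<le> s" "s * a \<le> 1/2" "s * c \<le> 1/2" "t * b \<le> 1/2" "t * d \<le> 1/2"
  shows "s / (1 - s * c) * (t / (1 - t * d)) \<le> s / (1 - s * a) * (t / (1 - t * b))"
proof -
  have key: "t * (d - b) * (1 - s * c) \<le> s * (a - c) * (1 - t * b)"
  proof (cases "c = 0")
    case True
    then show ?thesis using assms by (auto intro!: mult_mono)
  next
    case False
    then have c: "0 < c" using assms by simp
    have "c * (d - b) \<le> (a - c) * b" using assms(6) by (simp add: algebra_simps)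
    then have "t * (1 - s * c) * (c * (d - b)) \<le> t * (1 - s * c) * ((a - c) * b)"
      using assms by (intro mult_left_mono) auto
    also have "\<dots> = (a - c) * ((t * b) * (1 - s * c))" by simp
    also have "\<dots> \<le> (a - c) * ((s * c) * (1 - t * b))"
    proof (intro mult_left_mono)
      have "t * b \<le> s * c" using assms by (intro mult_mono) auto
      then show "t * b * (1 - s * c) \<le> s * c * (1 - t * b)" by (simp add: algebra_simps)
    qed (use assms in auto)
    finally have "c * (t * (d - b) * (1 - s * c)) \<le> c * (s * (a - c) * (1 - t * b))"
      by (simp add: algebra_simps)
    then show ?thesis using c by simp
  qed
  have "(1 - s * a) * (1 - t * b) \<le> (1 - s * c) * (1 - t * d)"
    using key by (simp add: algebra_simps)
  moreover have "0 < (1 - s * a) * (1 - t * b)" using assms by simp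
  ultimately have "(s * t) / ((1 - s * c) * (1 - t * d)) \<le> (s * t) / ((1 - s * a) * (1 - t * b))"
    using assms by (intro frac_le) auto
  then show ?thesis by simp
qed

lemma admissible_sup: "admissible u \<Longrightarrow> admissible v \<Longrightarrow> admissible (\<lambda>k. max (u k) (v k))"
  and admissible_inf: "admissible u \<Longrightarrow> admissible v \<Longrightarrow> admissible (\<lambda>k. min (u k) (v k))"
  by (auto simp: admissible_def max_def min_def)

text \<open>At each site one environment attains the maximum and the other the minimum, so
  \<open>supermodular_step\<close> applies up to a swap. Admissible environments are allowed to take
  arbitrary values because the inequality is also applied to environments set to 0 below some
  level.\<close>

lemma rho_supermodular:
  assumes u: "admissible u" and v: "admissible v"
  shows "rho u k * rho v k \<le> rho (\<lambda>k. max (u k) (v k)) k * rho (\<lambda>k. min (u k) (v k)) k"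
    (is "_ \<le> rho ?s k * rho ?i k")
proof (induction k)
  case (Suc k)
  note s = admissible_sup[OF u v] and i = admissible_inf[OF u v]
  have le: "rho ?i k \<le> rho u k" "rho ?i k \<le> rho v k" "rho u k \<le> rho ?s k" "rho v k \<le> rho ?s k"
    by (intro rho_mono u v s i; simp)+
  note half = mult_le_half[OF admissibleD[OF u] rho_bounds[THEN conjunct1] rho_bounds[THEN conjunct2]]
    mult_le_half[OF admissibleD[OF v] rho_bounds[THEN conjunct1] rho_bounds[THEN conjunct2]]
  show ?case
  proof (cases "v k \<le> u k")
    case True
    then have mm: "max (u k) (v k) = u k" "min (u k) (v k) = v k" by auto
    show ?thesis
      unfolding rho.simps mm
      by (rule supermodular_step) (use le Suc half u v s i rho_nonneg[OF i] admissibleD[OF v] True in auto)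
  next
    case False
    then have mm: "max (u k) (v k) = v k" "min (u k) (v k) = u k" by auto
    show ?thesis
      unfolding rho.simps mm mult.commute[of "u k / (1 - u k * rho u k)"]
      by (rule supermodular_step)
        (use le Suc half u v s i rho_nonneg[OF i] admissibleD[OF u] False in \<open>auto simp: mult.commute\<close>)
  qed
qed simp

subsection \<open>The FKG inequality\<close>

text \<open>The case of a one-point ground set. Only the mixed terms need an argument: with
  \<open>P = c1 * d0\<close> and both \<open>x = a0 * b1\<close> and \<open>y = a1 * b0\<close> at
  most \<open>P\<close>, the inequality (P - x) (P - y) \<ge> 0 gives P (x + y) \<le> P P + x y, and
  x y is at most \<open>P * (c0 * d1)\<close> by the two diagonal hypotheses.\<close>

lemma four_functions_step:
  fixes a0 a1 b0 b1 c0 c1 d0 d1 :: real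
  assumes nn: "0 \<le> a0" "0 \<le> a1" "0 \<le> b0" "0 \<le> b1" "0 \<le> c0" "0 \<le> c1" "0 \<le> d0" "0 \<le> d1"
    and le: "a0 * b0 \<le> c0 * d0" "a0 * b1 \<le> c1 * d0" "a1 * b0 \<le> c1 * d0" "a1 * b1 \<le> c1 * d1"
  shows "(a0 + a1) * (b0 + b1) \<le> (c0 + c1) * (d0 + d1)"
proof -
  have "a0 * b1 + a1 * b0 \<le> c1 * d0 + c0 * d1"
  proof (cases "c1 * d0 = 0")
    case True
    then have "a0 * b1 \<le> 0" "a1 * b0 \<le> 0" using le(2,3) by linarith+
    moreover have "0 \<le> c0 * d1" using nn by simp
    ultimately show ?thesis using True by linarith
  next
    case False
    then have P: "0 < c1 * d0" using nn by (simp add: less_le)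
    have "0 \<le> (c1 * d0 - a0 * b1) * (c1 * d0 - a1 * b0)" using le by simp
    then have "(c1 * d0) * (a0 * b1 + a1 * b0) \<le> (c1 * d0) * (c1 * d0) + (a0 * b0) * (a1 * b1)"
      by (simp add: algebra_simps)
    also have "\<dots> \<le> (c1 * d0) * (c1 * d0) + (c0 * d0) * (c1 * d1)"
      using mult_mono[OF le(1) le(4)] nn by simp
    also have "\<dots> = (c1 * d0) * (c1 * d0 + c0 * d1)" by (simp add: algebra_simps)
    finally show ?thesis using P by (simp only: mult_le_cancel_left_pos)
  qed
  then show ?thesis using le by (simp add: algebra_simps)
qed

lemma sum_Pow_insert:
  fixes F :: "'a set \<Rightarrow> 'b::comm_monoid_add"
  assumes "finite S" "x \<notin> S"
  shows "(\<Sum>A\<in>Pow (insert x S). F A) = (\<Sum>A\<in>Pow S. F A + F (insert x A))"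
proof -
  have "(\<Sum>A\<in>Pow (insert x S). F A) = (\<Sum>A\<in>Pow S. F A) + (\<Sum>A\<in>insert x ` Pow S. F A)"
    unfolding Pow_insert using assms by (intro sum.union_disjoint) auto
  also have "(\<Sum>A\<in>insert x ` Pow S. F A) = (\<Sum>A\<in>Pow S. F (insert x A))"
  proof (subst sum.reindex)
    show "inj_on (insert x) (Pow S)"
      using assms(2) by (intro inj_onI) (metis Diff_insert_absorb PowD subsetD)
  qed simp
  finally show ?thesis by (simp add: sum.distrib)
qed

text \<open>The Ahlswede-Daykin four functions theorem. Summing out one element of the ground set
  preserves the hypothesis by \<open>four_functions_step\<close>.\<close>

lemma four_functions:
  fixes f g h k :: "'a set \<Rightarrow> real"
  assumes "finite S"
    and "\<And>A. A \<subseteq> S \<Longrightarrow> 0 \<le> f A" "\<And>A. A \<subseteq> S \<Longrightarrow> 0 \<le> g A"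
    and "\<And>A. A \<subseteq> S \<Longrightarrow> 0 \<le> h A" "\<And>A. A \<subseteq> S \<Longrightarrow> 0 \<le> k A"
    and "\<And>A B. A \<subseteq> S \<Longrightarrow> B \<subseteq> S \<Longrightarrow> f A * g B \<le> h (A \<union> B) * k (A \<inter> B)"
  shows "(\<Sum>A\<in>Pow S. f A) * (\<Sum>A\<in>Pow S. g A) \<le> (\<Sum>A\<in>Pow S. h A) * (\<Sum>A\<in>Pow S. k A)"
  using assms
proof (induction S arbitrary: f g h k rule: finite_induct)
  case empty
  show ?case using empty(5)[of "{}" "{}"] by simp
next
  case (insert x S)
  have sub: "A \<subseteq> insert x S" "Set.insert x A \<subseteq> insert x S" if "A \<subseteq> S" for A
    using that by auto
  have nn: "0 \<le> f A \<and> 0 \<le> f (Set.insert x A) \<and> 0 \<le> g A \<and> 0 \<le> g (Set.insert x A) \<and>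
      0 \<le> h A \<and> 0 \<le> h (Set.insert x A) \<and> 0 \<le> k A \<and> 0 \<le> k (Set.insert x A)" if "A \<subseteq> S" for A
    by (intro conjI insert.prems(1-4)[OF sub(1)[OF that]] insert.prems(1-4)[OF sub(2)[OF that]])
  show ?case
    unfolding sum_Pow_insert[OF insert.hyps]
  proof (rule insert.IH)
    fix A B assume AB: "A \<subseteq> S" "B \<subseteq> S"
    then have [simp]: "A \<inter> insert x B = A \<inter> B" "insert x A \<inter> B = A \<inter> B"
      "x \<notin> A" "x \<notin> B" "x \<notin> A \<inter> B"
      using insert.hyps by auto
    show "(f A + f (insert x A)) * (g B + g (insert x B))
        \<le> (h (A \<union> B) + h (insert x (A \<union> B))) * (k (A \<inter> B) + k (insert x (A \<inter> B)))"
    proof (rule four_functions_step)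
      show "f A * g B \<le> h (A \<union> B) * k (A \<inter> B)" using insert.prems(5)[OF sub(1)[OF AB(1)] sub(1)[OF AB(2)]] .
      show "f A * g (insert x B) \<le> h (insert x (A \<union> B)) * k (A \<inter> B)"
        using insert.prems(5)[OF sub(1)[OF AB(1)] sub(2)[OF AB(2)]] by simp
      show "f (insert x A) * g B \<le> h (insert x (A \<union> B)) * k (A \<inter> B)"
        using insert.prems(5)[OF sub(2)[OF AB(1)] sub(1)[OF AB(2)]] by simp
      show "f (insert x A) * g (insert x B) \<le> h (insert x (A \<union> B)) * k (insert x (A \<inter> B))"
        using insert.prems(5)[OF sub(2)[OF AB(1)] sub(2)[OF AB(2)]] by (simp add: Int_insert_left)
    qed (use nn[of A] nn[of B] nn[of "A \<union> B"] nn[of "A \<inter> B"] AB in auto)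
  qed (use nn in \<open>blast intro: add_nonneg_nonneg\<close>)+
qed

definition log_supermodular_on :: "'a set \<Rightarrow> ('a set \<Rightarrow> real) \<Rightarrow> bool" where
  "log_supermodular_on S w \<longleftrightarrow> (\<forall>A\<subseteq>S. 0 \<le> w A) \<and>
     (\<forall>A\<subseteq>S. \<forall>B\<subseteq>S. w A * w B \<le> w (A \<union> B) * w (A \<inter> B))"

text \<open>Nonnegativity is built in because the four functions theorem is applied to weights
  multiplied by such functions, and because it makes the class closed under products.\<close>

definition nonneg_mono_on :: "'a set \<Rightarrow> ('a set \<Rightarrow> real) \<Rightarrow> bool" where
  "nonneg_mono_on S f \<longleftrightarrow> (\<forall>A\<subseteq>S. 0 \<le> f A) \<and> (\<forall>B\<subseteq>S. \<forall>A\<subseteq>B. f A \<le> f B)"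

lemma log_supermodular_onD:
  "log_supermodular_on S w \<Longrightarrow> A \<subseteq> S \<Longrightarrow> 0 \<le> w A"
  "log_supermodular_on S w \<Longrightarrow> A \<subseteq> S \<Longrightarrow> B \<subseteq> S \<Longrightarrow> w A * w B \<le> w (A \<union> B) * w (A \<inter> B)"
  unfolding log_supermodular_on_def by blast+

lemma nonneg_mono_onD:
  "nonneg_mono_on S f \<Longrightarrow> A \<subseteq> S \<Longrightarrow> 0 \<le> f A"
  "nonneg_mono_on S f \<Longrightarrow> A \<subseteq> B \<Longrightarrow> B \<subseteq> S \<Longrightarrow> f A \<le> f B"
  unfolding nonneg_mono_on_def by blast+

lemma FKG:
  assumes "finite S" and w: "log_supermodular_on S w"
    and f: "nonneg_mono_on S f" and g: "nonneg_mono_on S g"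
  shows "(\<Sum>A\<in>Pow S. w A * f A) * (\<Sum>A\<in>Pow S. w A * g A)
    \<le> (\<Sum>A\<in>Pow S. w A * (f A * g A)) * (\<Sum>A\<in>Pow S. w A)"
proof (rule four_functions[OF assms(1)])
  fix A B assume AB: "A \<subseteq> S" "B \<subseteq> S"
  then have U: "A \<union> B \<subseteq> S" and I: "A \<inter> B \<subseteq> S" by auto
  note nn = log_supermodular_onD(1)[OF w] nonneg_mono_onD(1)[OF f] nonneg_mono_onD(1)[OF g]
  have "w A * f A * (w B * g B) = (w A * w B) * (f A * g B)" by simp
  also have "\<dots> \<le> (w (A \<union> B) * w (A \<inter> B)) * (f (A \<union> B) * g (A \<union> B))"
    by (intro mult_mono mult_nonneg_nonneg log_supermodular_onD(2)[OF w AB] nn U I AB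
        nonneg_mono_onD(2)[OF f Un_upper1 U] nonneg_mono_onD(2)[OF g Un_upper2 U])
  finally show "w A * f A * (w B * g B) \<le> w (A \<union> B) * (f (A \<union> B) * g (A \<union> B)) * w (A \<inter> B)"
    by (simp add: mult_ac)
qed (intro mult_nonneg_nonneg log_supermodular_onD(1)[OF w] nonneg_mono_onD(1)[OF f] nonneg_mono_onD(1)[OF g]; assumption)+

text \<open>Setting the step probabilities to 0 below \<open>s\<close> moves the killing barrier to
  \<open>s\<close>. Comparing two left ends thereby becomes comparing two environments on one
  half-line.\<close>

lemma rho_truncate: "rho (\<lambda>k. if k < s then 0 else u k) (s + k) = rho (\<lambda>i. u (s + i)) k"
proof (induction k)
  case 0
  show ?case by (cases s) auto
qed simp

text \<open>The exceptional value 1 comes from the recursion with step probability 0; it is harmless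
  because the next step multiplies it by \<open>rho = 0\<close>.\<close>

lemma mu_truncate: "mu (\<lambda>k. if k < s then 0 else u k) (s + k) = (if k = 0 \<and> 0 < s then 1 else mu (\<lambda>i. u (s + i)) k)"
proof (induction k)
  case 0
  show ?case by (cases s) auto
next
  case (Suc k)
  then show ?case
    using rho_truncate[of s u k] by auto
qed

lemma log_supermodular_on_mult:
  assumes "log_supermodular_on S v" "log_supermodular_on S w"
  shows "log_supermodular_on S (\<lambda>B. v B * w B)"
  unfolding log_supermodular_on_def
proof (intro conjI allI impI)
  fix A B assume AB: "A \<subseteq> S" "B \<subseteq> S"
  then have UI: "A \<union> B \<subseteq> S" "A \<inter> B \<subseteq> S" by auto
  note nn = log_supermodular_onD(1)[OF assms(1)] log_supermodular_onD(1)[OF assms(2)]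
  show "0 \<le> v A * w A" using nn AB by simp
  have "v A * v B * (w A * w B) \<le> v (A \<union> B) * v (A \<inter> B) * (w (A \<union> B) * w (A \<inter> B))"
    by (intro mult_mono mult_nonneg_nonneg nn AB UI log_supermodular_onD(2)[OF assms(1)]
        log_supermodular_onD(2)[OF assms(2)])
  then show "v A * w A * (v B * w B) \<le> v (A \<union> B) * w (A \<union> B) * (v (A \<inter> B) * w (A \<inter> B))"
    by (simp add: mult_ac)
qed

lemma log_supermodular_on_prod:
  assumes "finite I" "\<And>i. i \<in> I \<Longrightarrow> log_supermodular_on S (w i)"
  shows "log_supermodular_on S (\<lambda>B. \<Prod>i\<in>I. w i B)"
  using assms
proof (induction I rule: finite_induct)
  case empty
  then show ?case by (simp add: log_supermodular_on_def)
qed (simp add: log_supermodular_on_mult)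

lemma nonneg_mono_on_mult:
  "nonneg_mono_on S f \<Longrightarrow> nonneg_mono_on S g \<Longrightarrow> nonneg_mono_on S (\<lambda>B. f B * g B)"
  unfolding nonneg_mono_on_def by (intro conjI allI impI mult_mono mult_nonneg_nonneg) auto

lemma nonneg_mono_on_prod:
  assumes "finite I" "\<And>i. i \<in> I \<Longrightarrow> nonneg_mono_on S (w i)"
  shows "nonneg_mono_on S (\<lambda>B. \<Prod>i\<in>I. w i B)"
  using assms
proof (induction I rule: finite_induct)
  case empty
  then show ?case by (simp add: nonneg_mono_on_def)
qed (simp add: nonneg_mono_on_mult)

subsection \<open>The tilted environment\<close>

text \<open>Sites are numbered from the left end of the explored region, left of which the walk is
  killed; the environment is encoded by the set \<open>B\<close> of sites without a trap. The parameters are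
  \<open>q = 1 - p\<close> and \<open>e = exp (- M)\<close>.\<close>

locale trap_model =
  fixes q e :: real
  assumes q_pos: "0 < q" and q_less_1: "q < 1" and e_pos: "0 < e" and e_less_1: "e < 1"
begin

definition env :: "nat set \<Rightarrow> nat \<Rightarrow> real" where
  "env B k = (if k \<in> B then 1 / 2 else e / 2)"

definition wt :: "nat \<Rightarrow> nat set \<Rightarrow> real" where
  "wt n B = (\<Prod>k<n. if k \<in> B then q else 1 - q)"

definition expect :: "nat \<Rightarrow> (nat set \<Rightarrow> real) \<Rightarrow> real" where
  "expect n F = (\<Sum>B\<in>Pow {..<n}. wt n B * F B)"

definition W :: "nat \<Rightarrow> nat \<Rightarrow> nat set \<Rightarrow> real" where
  "W a b B = (\<Prod>k\<in>{a..<b}. rho (env B) (Suc k))"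

text \<open>The law of the environment under the annealed measure: the walk starts at
  \<open>a\<close>, is killed left of 0 and is conditioned to reach \<open>n\<close>.\<close>

definition tilted :: "nat \<Rightarrow> nat \<Rightarrow> (nat set \<Rightarrow> real) \<Rightarrow> real" where
  "tilted a n F = expect n (\<lambda>B. W a n B * F B) / expect n (W a n)"

lemma admissible_env [simp]: "admissible (env B)"
  using e_pos e_less_1 by (auto simp: admissible_def env_def)

lemma env_pos: "0 < env B k"
  using e_pos by (simp add: env_def)

lemma env_mono: "A \<subseteq> B \<Longrightarrow> env A k \<le> env B k"
  using e_less_1 by (auto simp: env_def)

lemma env_max: "max (env A k) (env B k) = env (A \<union> B) k"
  and env_min: "min (env A k) (env B k) = env (A \<inter> B) k"
  using e_less_1 by (auto simp: env_def)

lemma rho_env_pos: "0 < rho (env B) (Suc k)"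
  by (intro rho_pos admissible_env env_pos)

lemma W_pos: "0 < W a b B"
  by (auto simp: W_def intro!: prod_pos rho_env_pos simp del: rho.simps)

lemma W_le_1: "W a b B \<le> 1"
  unfolding W_def by (intro prod_le_1 conjI rho_nonneg rho_le_1 admissible_env)

lemma W_split: "a \<le> b \<Longrightarrow> b \<le> c \<Longrightarrow> W a c B = W a b B * W b c B"
  unfolding W_def by (rule prod.atLeastLessThan_concat[symmetric])

lemma W_Suc: "a \<le> b \<Longrightarrow> W a (Suc b) B = W a b B * rho (env B) (Suc b)"
  by (simp add: W_def del: rho.simps)

lemma wt_pos: "0 < wt n B"
  using q_pos q_less_1 by (auto simp: wt_def intro!: prod_pos)

lemma expect_0 [simp]: "expect 0 F = F {}"
  by (simp add: expect_def wt_def)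

lemma wt_insert: "B \<subseteq> {..<n} \<Longrightarrow> wt (Suc n) (insert n B) = q * wt n B"
  and wt_Suc: "B \<subseteq> {..<n} \<Longrightarrow> wt (Suc n) B = (1 - q) * wt n B"
proof -
  assume B: "B \<subseteq> {..<n}"
  have "(\<Prod>k<n. if k \<in> insert n B then q else 1 - q) = wt n B"
    unfolding wt_def by (rule prod.cong) auto
  then show "wt (Suc n) (insert n B) = q * wt n B"
    by (simp add: wt_def)
  show "wt (Suc n) B = (1 - q) * wt n B"
    using B by (auto simp: wt_def)
qed

lemma expect_Suc: "expect (Suc n) F = q * expect n (\<lambda>B. F (insert n B)) + (1 - q) * expect n F"
proof -
  have "expect (Suc n) F = (\<Sum>B\<in>Pow {..<n}. wt (Suc n) B * F B + wt (Suc n) (insert n B) * F (insert n B))"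
    unfolding expect_def lessThan_Suc by (rule sum_Pow_insert) auto
  also have "\<dots> = (\<Sum>B\<in>Pow {..<n}. (1 - q) * (wt n B * F B) + q * (wt n B * F (insert n B)))"
    by (intro sum.cong refl) (simp add: wt_insert wt_Suc)
  finally show ?thesis
    by (simp add: expect_def sum.distrib sum_distrib_left)
qed

lemma expect_cong: "(\<And>B. B \<subseteq> {..<n} \<Longrightarrow> F B = G B) \<Longrightarrow> expect n F = expect n G"
  unfolding expect_def by (intro sum.cong) auto

lemma expect_mono: "(\<And>B. B \<subseteq> {..<n} \<Longrightarrow> F B \<le> G B) \<Longrightarrow> expect n F \<le> expect n G"
  unfolding expect_def by (intro sum_mono mult_left_mono less_imp_le[OF wt_pos]) auto

lemma expect_add: "expect n (\<lambda>B. F B + G B) = expect n F + expect n G"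
  by (simp add: expect_def distrib_left sum.distrib)

lemma expect_cmult: "expect n (\<lambda>B. c * F B) = c * expect n F"
  by (simp add: expect_def sum_distrib_left mult_ac)

lemma expect_sum: "expect n (\<lambda>B. \<Sum>i\<in>I. F i B) = (\<Sum>i\<in>I. expect n (F i))"
  unfolding expect_def by (subst sum.swap) (simp add: sum_distrib_left)

lemma expect_const [simp]: "expect n (\<lambda>_. c) = c"
  by (induction n) (auto simp: expect_Suc algebra_simps)

lemma expect_nonneg: "(\<And>B. B \<subseteq> {..<n} \<Longrightarrow> 0 \<le> F B) \<Longrightarrow> 0 \<le> expect n F"
  using expect_mono[of n "\<lambda>_. 0" F] by simp

lemma expect_pos: "(\<And>B. B \<subseteq> {..<n} \<Longrightarrow> 0 < F B) \<Longrightarrow> 0 < expect n F"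
  unfolding expect_def by (intro sum_pos mult_pos_pos wt_pos) auto

lemma expect_W_pos: "0 < expect n (W a b)"
  by (intro expect_pos W_pos)

lemma expect_shift: "expect (s + n) (\<lambda>B. F {k. s + k \<in> B}) = expect n F"
proof (induction n arbitrary: F)
  case 0
  have "expect s (\<lambda>B. F {k. s + k \<in> B}) = expect s (\<lambda>B. F {})"
  proof (rule expect_cong)
    fix B assume "B \<subseteq> {..<s}"
    then have "{k. s + k \<in> B} = {}" by auto
    then show "F {k. s + k \<in> B} = F {}" by simp
  qed
  then show ?case by simp
next
  case (Suc n)
  have "{k. s + k \<in> insert (s + n) B} = insert n {k. s + k \<in> B}" for B by auto
  then show ?case
    using Suc[of F] Suc[of "\<lambda>B. F (insert n B)"] by (simp add: expect_Suc)
qed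

section \<open>Positive association of the tilted environment\<close>

lemma log_supermodular_on_wt: "log_supermodular_on S (wt n)"
  unfolding wt_def
  by (rule log_supermodular_on_prod) (use q_pos q_less_1 in \<open>auto simp: log_supermodular_on_def\<close>)

lemma log_supermodular_on_rho: "log_supermodular_on S (\<lambda>B. rho (env B) k)"
  unfolding log_supermodular_on_def
proof (intro conjI allI impI rho_nonneg admissible_env)
  fix A B
  show "rho (env A) k * rho (env B) k \<le> rho (env (A \<union> B)) k * rho (env (A \<inter> B)) k"
    using rho_supermodular[of "env A" "env B" k] by (simp add: env_max env_min)
qed

lemma log_supermodular_on_W: "log_supermodular_on S (W a b)"
  unfolding W_def by (intro log_supermodular_on_prod log_supermodular_on_rho) simp

lemma nonneg_mono_on_rho: "nonneg_mono_on S (\<lambda>B. rho (env B) k)"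
  and nonneg_mono_on_mu: "nonneg_mono_on S (\<lambda>B. mu (env B) k)"
  unfolding nonneg_mono_on_def by (auto intro!: rho_nonneg rho_mono mu_nonneg mu_mono env_mono)

lemma nonneg_mono_on_W: "nonneg_mono_on S (W a b)"
  unfolding W_def by (intro nonneg_mono_on_prod nonneg_mono_on_rho) simp

lemma expect_FKG:
  assumes w: "log_supermodular_on {..<n} w"
    and f: "nonneg_mono_on {..<n} f" and g: "nonneg_mono_on {..<n} g"
  shows "expect n (\<lambda>B. w B * f B) * expect n (\<lambda>B. w B * g B) \<le> expect n (\<lambda>B. w B * (f B * g B)) * expect n w"
  using FKG[OF _ log_supermodular_on_mult[OF log_supermodular_on_wt[of _ n] w] f g]
  by (simp add: expect_def mult.assoc)

text \<open>An additional increasing weight raises the mean of an increasing function.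
  Log-supermodularity is asked of the base weight \<open>w\<close> only; the added factor
  \<open>g\<close> merely has to be monotone.\<close>

lemma tilted_le:
  assumes w: "log_supermodular_on {..<n} w" and w': "\<And>B. B \<subseteq> {..<n} \<Longrightarrow> w' B = w B * g B"
    and f: "nonneg_mono_on {..<n} f" and g: "nonneg_mono_on {..<n} g"
    and pos: "0 < expect n w" "0 < expect n w'"
  shows "expect n (\<lambda>B. w B * f B) / expect n w \<le> expect n (\<lambda>B. w' B * f B) / expect n w'"
proof -
  have "expect n w' = expect n (\<lambda>B. w B * g B)"
    by (intro expect_cong w')
  moreover have "expect n (\<lambda>B. w' B * f B) = expect n (\<lambda>B. w B * (f B * g B))"
    by (intro expect_cong) (simp add: w')
  ultimately show ?thesis
    using expect_FKG[OF w f g] pos by (simp add: divide_simps mult_ac)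
qed

lemma tilted_mono: "(\<And>B. B \<subseteq> {..<n} \<Longrightarrow> F B \<le> G B) \<Longrightarrow> tilted a n F \<le> tilted a n G"
  unfolding tilted_def
  by (intro divide_right_mono expect_mono mult_left_mono less_imp_le[OF W_pos] less_imp_le[OF expect_W_pos])

lemma tilted_FKG:
  assumes "nonneg_mono_on {..<n} f" "nonneg_mono_on {..<n} g"
  shows "tilted a n f * tilted a n g \<le> tilted a n (\<lambda>B. f B * g B)"
  using expect_FKG[OF log_supermodular_on_W assms, of a n] expect_W_pos[of n a n]
  by (simp add: tilted_def field_simps)

text \<open>Starting further to the left multiplies the weight by \<open>W 0 s\<close>, which is
  increasing in the environment.\<close>

lemma tilted_left:
  assumes "s \<le> n" "nonneg_mono_on {..<n} f"
  shows "tilted s n f \<le> tilted 0 n f"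
  unfolding tilted_def
  by (rule tilted_le[where g = "W 0 s"])
    (use assms in \<open>auto intro: expect_pos mult_pos_pos W_pos log_supermodular_on_W nonneg_mono_on_W simp: W_split[of 0 s n]\<close>)

text \<open>Moving the target one site to the right multiplies the weight by one more passage
  probability, again increasing. The old expectation is rewritten over the larger window, which
  \<open>loc\<close> permits.\<close>

lemma tilted_right:
  assumes f: "nonneg_mono_on {..<Suc n} f" and loc: "\<And>B. f (insert n B) = f B"
  shows "tilted 0 n f \<le> tilted 0 (Suc n) f"
proof -
  have loc': "W 0 n (insert n B) = W 0 n B" for B
    unfolding W_def by (intro prod.cong refl rho_cong) (auto simp: env_def)
  have ins: "expect (Suc n) F = expect n F" if "\<And>B. F (insert n B) = F B" for F
    by (simp add: expect_Suc that algebra_simps)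
  have "tilted 0 n f = expect (Suc n) (\<lambda>B. W 0 n B * f B) / expect (Suc n) (W 0 n)"
    unfolding tilted_def by (simp add: ins loc loc')
  also have "\<dots> \<le> tilted 0 (Suc n) f"
    unfolding tilted_def
    by (rule tilted_le[where g = "\<lambda>B. rho (env B) (Suc n)"])
      (use f in \<open>auto intro: expect_pos mult_pos_pos W_pos rho_env_pos log_supermodular_on_W nonneg_mono_on_rho simp: W_Suc simp del: rho.simps\<close>)
  finally show ?thesis .
qed

lemma env_shift: "(\<lambda>i. env B (s + i)) = env {k. s + k \<in> B}"
  by (auto simp: env_def)

text \<open>
  Moving the left end from \<open>s\<close> to 0 multiplies the weight by an increasing function of the
  environment: this is supermodularity applied to \<open>env A\<close> and to \<open>env B\<close> set to 0 below \<open>s\<close>.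
\<close>

lemma rho_shift_quotient_mono:
  assumes "A \<subseteq> B"
  shows "rho (env A) (s + k) * rho (env {i. s + i \<in> B}) k
    \<le> rho (env B) (s + k) * rho (env {i. s + i \<in> A}) k"
proof -
  define tr where "tr B = (\<lambda>k. if k < s then 0 else env B k)" for B
  have tr: "rho (tr B) (s + k) = rho (env {i. s + i \<in> B}) k" for B
    unfolding tr_def rho_truncate env_shift ..
  have adm: "admissible (tr B)" for B
    using admissible_env[of B] by (auto simp: admissible_def tr_def)
  have "rho (env A) (s + k) * rho (tr B) (s + k)
      \<le> rho (\<lambda>k. max (env A k) (tr B k)) (s + k) * rho (\<lambda>k. min (env A k) (tr B k)) (s + k)"
    by (intro rho_supermodular adm admissible_env)
  also have "\<dots> \<le> rho (env B) (s + k) * rho (tr A) (s + k)"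
  proof (intro mult_mono rho_mono rho_nonneg admissible_sup admissible_inf adm admissible_env)
    fix k
    show "max (env A k) (tr B k) \<le> env B k" "min (env A k) (tr B k) \<le> tr A k"
      using env_mono[OF assms, of k] env_pos[of A k] env_pos[of B k] by (auto simp: tr_def)
  qed
  finally show ?thesis unfolding tr .
qed

lemma W_shift: "W 0 n {i. s + i \<in> B} = (\<Prod>k<n. rho (env {i. s + i \<in> B}) (Suc k))"
  by (simp add: W_def lessThan_atLeast0 del: rho.simps)

text \<open>Here \<open>s\<close> sites are added to the left of the start, which lets the walk make
  excursions into them. The new weight is the old one, read in the shifted environment, times the
  quotients \<open>Q\<close>, and these are increasing by
  \<open>rho_shift_quotient_mono\<close>.\<close>

lemma tilted_shift:
  assumes F: "nonneg_mono_on {..<s + n} F"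
    and le: "\<And>B. B \<subseteq> {..<s + n} \<Longrightarrow> f {k. s + k \<in> B} \<le> F B"
  shows "tilted 0 n f \<le> tilted s (s + n) F"
proof -
  define sh where "sh B = {i. s + i \<in> B}" for B
  define Q where "Q B k = rho (env B) (s + Suc k) / rho (env (sh B)) (Suc k)" for B k
  have Q: "nonneg_mono_on S (\<lambda>B. Q B k)" for S k
    unfolding nonneg_mono_on_def
  proof (intro conjI allI impI)
    fix B :: "nat set"
    show "0 \<le> Q B k"
      unfolding Q_def by (intro divide_nonneg_nonneg rho_nonneg admissible_env)
    fix A assume "A \<subseteq> B"
    then show "Q A k \<le> Q B k"
      using rho_shift_quotient_mono[of A B s "Suc k"] rho_env_pos[of "sh A" k] rho_env_pos[of "sh B" k]
      unfolding Q_def sh_def by (simp add: divide_simps mult_ac del: rho.simps)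
  qed
  have Q_pos: "0 < Q B k" for B k
    using rho_env_pos[of B "s + k"] rho_env_pos[of "sh B" k] by (simp add: Q_def del: rho.simps)
  have W: "W s (s + n) B = W 0 n (sh B) * (\<Prod>k<n. Q B k)" for B
  proof -
    have "W s (s + n) B = (\<Prod>k<n. rho (env B) (s + Suc k))"
      unfolding W_def
      by (rule prod.reindex_bij_witness[of _ "\<lambda>k. s + k" "\<lambda>k. k - s"]) (auto simp del: rho.simps)
    also have "\<dots> = (\<Prod>k<n. rho (env (sh B)) (Suc k) * Q B k)"
      using rho_env_pos[of "sh B"] by (intro prod.cong refl) (simp add: Q_def less_imp_neq[THEN not_sym] del: rho.simps)
    finally show ?thesis
      unfolding sh_def W_shift by (simp add: prod.distrib del: rho.simps)
  qed
  have lsm: "log_supermodular_on {..<s + n} (\<lambda>B. W 0 n (sh B))"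
    unfolding log_supermodular_on_def
  proof (intro conjI allI impI less_imp_le[OF W_pos])
    fix A B
    have "sh (A \<union> B) = sh A \<union> sh B" "sh (A \<inter> B) = sh A \<inter> sh B" by (auto simp: sh_def)
    then show "W 0 n (sh A) * W 0 n (sh B) \<le> W 0 n (sh (A \<union> B)) * W 0 n (sh (A \<inter> B))"
      using log_supermodular_onD(2)[OF log_supermodular_on_W, of "sh A" UNIV "sh B" 0 n] by simp
  qed
  have "tilted 0 n f = expect (s + n) (\<lambda>B. W 0 n (sh B) * f (sh B)) / expect (s + n) (\<lambda>B. W 0 n (sh B))"
    unfolding tilted_def sh_def expect_shift[of s n "\<lambda>B. W 0 n B * f B"] expect_shift[of s n "W 0 n"] ..
  also have "\<dots> \<le> expect (s + n) (\<lambda>B. W 0 n (sh B) * F B) / expect (s + n) (\<lambda>B. W 0 n (sh B))"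
    using le by (intro divide_right_mono expect_mono mult_left_mono expect_nonneg less_imp_le[OF W_pos])
      (auto simp: sh_def)
  also have "\<dots> \<le> tilted s (s + n) F"
    unfolding tilted_def
    by (rule tilted_le[where g = "\<lambda>B. \<Prod>k<n. Q B k"])
      (auto intro!: lsm expect_pos W_pos F nonneg_mono_on_prod Q mult_pos_pos prod_pos Q_pos simp: W)
  finally show ?thesis .
qed

end

lemma le_of_power_le:
  fixes x y C :: real
  assumes "0 \<le> y" and le: "\<And>m. m0 \<le> m \<Longrightarrow> x ^ m \<le> C * y ^ m"
  shows "x \<le> y"
proof (rule ccontr)
  assume "\<not> x \<le> y"
  then have xy: "y < x" by simp
  then have x: "0 < x" using assms(1) by simp
  have "(\<lambda>m. C * (y / x) ^ m) \<longlonglongrightarrow> C * 0"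
    using xy x assms(1) by (intro tendsto_mult tendsto_const LIMSEQ_realpow_zero) (auto simp: divide_simps)
  then have "eventually (\<lambda>m. C * (y / x) ^ m < 1) sequentially"
    by (intro order_tendstoD) auto
  then have "eventually (\<lambda>m. C * (y / x) ^ m < 1 \<and> m0 \<le> m) sequentially"
    by (intro eventually_conj eventually_ge_at_top)
  then obtain m where m: "C * (y / x) ^ m < 1" "m0 \<le> m"
    unfolding eventually_sequentially by blast
  have "C * y ^ m < x ^ m"
    using m(1) x by (simp add: power_divide divide_simps)
  then show False using le[OF m(2)] by simp
qed

context trap_model
begin

text \<open>The ratio \<open>Z t n / Z 1 n\<close> is the generating function of the number of traps
  under the tilted law. A fugacity below 1 serves to bound the delay from above, one above 1 to
  bound the number of traps.\<close>

definition Z :: "real \<Rightarrow> nat \<Rightarrow> real" where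
  "Z t n = expect n (\<lambda>B. t ^ card ({..<n} - B) * W 0 n B)"

lemma Z_1: "Z 1 n = expect n (W 0 n)"
  by (simp add: Z_def)

lemma Z_pos: "0 < t \<Longrightarrow> 0 < Z t n"
  unfolding Z_def by (intro expect_pos mult_pos_pos W_pos) auto

lemma tilted_sum: "tilted a n (\<lambda>B. \<Sum>i\<in>I. F i B) = (\<Sum>i\<in>I. tilted a n (F i))"
  unfolding tilted_def sum_distrib_left expect_sum sum_divide_distrib ..

lemma tilted_add: "tilted a n (\<lambda>B. F B + G B) = tilted a n F + tilted a n G"
  by (simp add: tilted_def distrib_left expect_add add_divide_distrib)

lemma tilted_cmult: "tilted a n (\<lambda>B. c * F B) = c * tilted a n F"
  using expect_cmult[of n c "\<lambda>B. W a n B * F B"] by (simp add: tilted_def mult_ac)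

lemma tilted_const [simp]: "tilted a n (\<lambda>_. c) = c"
  using expect_cmult[of n c "W a n"] expect_W_pos[of n a n] by (simp add: tilted_def mult.commute)

text \<open>The tilted mean delay at a site with \<open>i\<close> sites of the window to its left and \<open>j\<close> from it onwards.\<close>

definition speed_inv :: "nat \<Rightarrow> nat \<Rightarrow> real" where
  "speed_inv i j = tilted 0 (i + j) (\<lambda>B. mu (env B) (Suc i))"

lemma mu_env_cong: "(\<And>i. i < k \<Longrightarrow> i \<in> A \<longleftrightarrow> i \<in> B) \<Longrightarrow> mu (env A) k = mu (env B) k"
  by (rule mu_cong) (simp add: env_def)

lemma mu_shift_le: "mu (env {k. s + k \<in> B}) (Suc k) \<le> mu (env B) (Suc (s + k))"
proof -
  have "mu (env {k. s + k \<in> B}) (Suc k) = mu (\<lambda>k. if k < s then 0 else env B k) (s + Suc k)"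
    unfolding mu_truncate env_shift by simp
  also have "\<dots> \<le> mu (env B) (s + Suc k)"
    using admissible_env[of B] by (intro mu_mono) (auto simp: admissible_def env_pos less_imp_le)
  finally show ?thesis by simp
qed

text \<open>The left margin grows in two stages: new sites are added while the walk still starts at
  \<open>s\<close>, and the start is moved to 0 by \<open>tilted_le_speed_inv\<close>. The
  intermediate quantity is the one that occurs in the annealed mean, where the walk starts well
  inside the window.\<close>

lemma speed_inv_le_tilted: "speed_inv i j \<le> tilted s (s + (i + j)) (\<lambda>B. mu (env B) (Suc (s + i)))"
  unfolding speed_inv_def by (intro tilted_shift nonneg_mono_on_mu mu_shift_le)

lemma tilted_le_speed_inv:
  "tilted s (s + (i + j)) (\<lambda>B. mu (env B) (Suc (s + i))) \<le> speed_inv (s + i) j"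
  unfolding speed_inv_def add.assoc by (intro tilted_left nonneg_mono_on_mu) simp

lemma speed_inv_mono_left: "speed_inv i j \<le> speed_inv (s + i) j"
  using speed_inv_le_tilted tilted_le_speed_inv by (rule order_trans)

text \<open>Since \<open>0 < j\<close>, site \<open>i\<close> lies inside the window already, so the
  delay there does not depend on the appended site and only the weight changes.\<close>

lemma speed_inv_mono_right:
  assumes "0 < j" "j \<le> j'"
  shows "speed_inv i j \<le> speed_inv i j'"
  using assms(2)
proof (induction j' rule: dec_induct)
  case (step j')
  have "speed_inv i j' \<le> speed_inv i (Suc j')"
    unfolding speed_inv_def add_Suc_right
    using assms(1) step by (intro tilted_right nonneg_mono_on_mu mu_env_cong) auto
  then show ?case using step by simp
qed simp

lemma speed_inv_mono: "0 < j \<Longrightarrow> i \<le> i' \<Longrightarrow> j \<le> j' \<Longrightarrow> speed_inv i j \<le> speed_inv i' j'"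
  using speed_inv_mono_left[of i j "i' - i"] speed_inv_mono_right[of j j' i'] by simp

section \<open>Trap counts in blocks of the tilted environment\<close>

definition few_traps :: "real \<Rightarrow> nat \<Rightarrow> nat \<Rightarrow> nat \<Rightarrow> real" where
  "few_traps t i d j = tilted 0 (i + d + j) (\<lambda>B. t ^ card ({i..<i + d} - B))"

lemma nonneg_mono_on_traps:
  assumes "0 \<le> t" "t \<le> 1" "finite I"
  shows "nonneg_mono_on S (\<lambda>B. t ^ card (I - B))"
  unfolding nonneg_mono_on_def
  using assms by (auto intro!: power_decreasing card_mono)

lemma few_traps_nonneg: "0 \<le> t \<Longrightarrow> 0 \<le> few_traps t i d j"
  unfolding few_traps_def tilted_def
  by (intro divide_nonneg_nonneg expect_nonneg mult_nonneg_nonneg less_imp_le[OF W_pos] less_imp_le[OF expect_W_pos])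
    auto

context
  fixes t :: real
  assumes t: "0 < t" "t \<le> 1"
begin

lemma few_traps_mono_left: "few_traps t i d j \<le> few_traps t (s + i) d j"
proof -
  have "few_traps t i d j \<le> tilted s (s + (i + d + j)) (\<lambda>B. t ^ card ({s + i..<s + i + d} - B))"
    unfolding few_traps_def
  proof (rule tilted_shift)
    fix B :: "nat set"
    have "card ((\<lambda>k. s + k) ` ({i..<i + d} - {k. s + k \<in> B})) = card ({i..<i + d} - {k. s + k \<in> B})"
      by (rule card_image) simp
    moreover have "(\<lambda>k. s + k) ` ({i..<i + d} - {k. s + k \<in> B}) = {s + i..<s + i + d} - B"
    proof -
      have "x \<in> (\<lambda>k. s + k) ` ({i..<i + d} - {k. s + k \<in> B})" if "x \<in> {s + i..<s + i + d} - B" for x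
        using that by (intro image_eqI[of _ _ "x - s"]) auto
      then show ?thesis by auto
    qed
    ultimately show "t ^ card ({i..<i + d} - {k. s + k \<in> B}) \<le> t ^ card ({s + i..<s + i + d} - B)"
      by simp
  qed (use t in \<open>auto intro: nonneg_mono_on_traps\<close>)
  also have "\<dots> \<le> few_traps t (s + i) d j"
    unfolding few_traps_def
    using t tilted_left[of s "s + (i + d + j)" "\<lambda>B. t ^ card ({s + i..<s + i + d} - B)"]
    by (simp add: nonneg_mono_on_traps add.assoc)
  finally show ?thesis .
qed

lemma few_traps_mono_right: "few_traps t i d j \<le> few_traps t i d (j' + j)"
proof (induction j')
  case (Suc j')
  have "few_traps t i d (j' + j) \<le> few_traps t i d (Suc (j' + j))"
    unfolding few_traps_def add_Suc_right
  proof (rule tilted_right)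
    fix B :: "nat set"
    have "{i..<i + d} - insert (i + d + (j' + j)) B = {i..<i + d} - B" by auto
    then show "t ^ card ({i..<i + d} - insert (i + d + (j' + j)) B) = t ^ card ({i..<i + d} - B)"
      by simp
  qed (use t in \<open>auto intro: nonneg_mono_on_traps\<close>)
  then show ?case using Suc by simp
qed simp

text \<open>A block of length \<open>Suc m * d\<close> splits into adjacent blocks of lengths
  \<open>m * d\<close> and \<open>d\<close>. Their trap counts are positively associated, and each
  factor is at least its value with the smaller margins \<open>i\<close> and
  \<open>j\<close>.\<close>

lemma few_traps_power_le: "few_traps t i d j ^ m \<le> few_traps t i (m * d) j"
proof (induction m)
  case 0
  then show ?case by (simp add: few_traps_def)
next
  case (Suc m)
  have "few_traps t i d j ^ Suc m \<le> few_traps t (m * d + i) d j * few_traps t i (m * d) (d + j)"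
    using Suc few_traps_mono_left[of i d j "m * d"] few_traps_mono_right[of i "m * d" j d] t
    by (auto intro!: mult_mono few_traps_nonneg zero_le_power intro: order_trans)
  also have "\<dots> = tilted 0 (i + (d + m * d) + j) (\<lambda>B. t ^ card ({m * d + i..<m * d + i + d} - B))
      * tilted 0 (i + (d + m * d) + j) (\<lambda>B. t ^ card ({i..<i + m * d} - B))"
    unfolding few_traps_def by (simp add: add_ac)
  also have "\<dots> \<le> tilted 0 (i + (d + m * d) + j)
      (\<lambda>B. t ^ card ({m * d + i..<m * d + i + d} - B) * t ^ card ({i..<i + m * d} - B))"
    using t by (intro tilted_FKG nonneg_mono_on_traps) auto
  also have "\<dots> = few_traps t i (Suc m * d) j"
  proof -
    have "card ({i..<i + Suc m * d} - B) = card ({m * d + i..<m * d + i + d} - B) + card ({i..<i + m * d} - B)"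
      for B
    proof -
      have "{i..<i + Suc m * d} - B = ({m * d + i..<m * d + i + d} - B) \<union> ({i..<i + m * d} - B)"
        by auto
      then show ?thesis by (simp add: card_Un_disjoint disjoint_iff)
    qed
    then show ?thesis unfolding few_traps_def by (simp add: power_add)
  qed
  finally show ?case .
qed

text \<open>Counting the traps of the whole window instead of the block loses at most a factor
  \<open>1 / t\<close> for each of the \<open>i + j\<close> sites in the margins.\<close>

lemma few_traps_le_Z: "few_traps t i d j \<le> (1 / t) ^ (i + j) * (Z t (i + d + j) / Z 1 (i + d + j))"
proof -
  define n where "n = i + d + j"
  have "few_traps t i d j \<le> tilted 0 n (\<lambda>B. (1 / t) ^ (i + j) * t ^ card ({..<n} - B))"
    unfolding few_traps_def n_def[symmetric]
  proof (rule tilted_mono)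
    fix B
    have "{..<n} - B \<subseteq> ({i..<i + d} - B) \<union> ({..<i} \<union> {i + d..<n})"
      by (auto simp: n_def)
    then have "card ({..<n} - B) \<le> card (({i..<i + d} - B) \<union> ({..<i} \<union> {i + d..<n}))"
      by (intro card_mono) auto
    also have "\<dots> \<le> card ({i..<i + d} - B) + card ({..<i} \<union> {i + d..<n})" by (rule card_Un_le)
    also have "card ({..<i} \<union> {i + d..<n}) \<le> i + j"
      using card_Un_le[of "{..<i}" "{i + d..<n}"] by (simp add: n_def)
    finally have "t ^ (card ({i..<i + d} - B) + (i + j)) \<le> t ^ card ({..<n} - B)"
      using t by (intro power_decreasing) auto
    then show "t ^ card ({i..<i + d} - B) \<le> (1 / t) ^ (i + j) * t ^ card ({..<n} - B)"
      using t by (simp add: power_add power_divide field_simps)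
  qed
  also have "\<dots> = (1 / t) ^ (i + j) * (Z t n / Z 1 n)"
    unfolding tilted_cmult by (simp add: tilted_def Z_def mult.commute)
  finally show ?thesis unfolding n_def .
qed

text \<open>The power trick absorbs all constants: only exponential growth rates matter.\<close>

lemma few_traps_le_power:
  assumes upper: "\<And>n. Z t n \<le> A * \<sigma> ^ n" and lower: "\<And>n. K \<le> n \<Longrightarrow> a * \<tau> ^ n \<le> Z 1 n"
    and pos: "0 < a" "0 < \<tau>" "0 < \<sigma>"
  shows "few_traps t i d j \<le> (\<sigma> / \<tau>) ^ d"
proof (cases "d = 0")
  case True
  then show ?thesis by (simp add: few_traps_def)
next
  case False
  show ?thesis
  proof (rule le_of_power_le)
    fix m assume m: "K \<le> m"
    have d: "1 \<le> d" using False by simp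
    have "K \<le> m * d" using m mult_le_mono[OF m d] by simp
    then have n: "K \<le> i + m * d + j" by simp
    have "few_traps t i d j ^ m \<le> (1 / t) ^ (i + j) * (Z t (i + m * d + j) / Z 1 (i + m * d + j))"
      using few_traps_power_le few_traps_le_Z by (rule order_trans)
    also have "\<dots> \<le> (1 / t) ^ (i + j) * ((A * \<sigma> ^ (i + m * d + j)) / (a * \<tau> ^ (i + m * d + j)))"
      using t pos Z_pos[OF t(1), of "i + m * d + j"]
      by (intro mult_left_mono frac_le upper lower n) (auto intro: order_trans[OF less_imp_le[OF Z_pos] upper])
    also have "\<dots> = (1 / t) ^ (i + j) * (A / a) * (\<sigma> / \<tau>) ^ (i + j) * ((\<sigma> / \<tau>) ^ d) ^ m"
      by (simp add: power_add power_divide power_mult[symmetric] mult_ac)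
    finally show "few_traps t i d j ^ m \<le> ((1 / t) ^ (i + j) * (A / a) * (\<sigma> / \<tau>) ^ (i + j)) * ((\<sigma> / \<tau>) ^ d) ^ m" .
  qed (use pos in simp)
qed

end

text \<open>With \<open>Q = env B k * rho (env B) k\<close> the recursion is affine with slope
  \<open>Q / (1 - Q)\<close>. This slope is at most 1 at a free site and at most
  \<open>e / (2 - e)\<close> at a trap, where \<open>Q \<le> e / 2\<close>; this is the origin of
  the fugacity \<open>e / (2 - e)\<close>. Unrolling gives the sum, and the factor 2 bounds
  \<open>1 / (1 - Q)\<close>.\<close>

lemma mu_env_le:
  "mu (env B) (Suc k) \<le> 2 * (\<Sum>l\<le>k. (e / (2 - e)) ^ card ({Suc l..<Suc k} - B))"
proof (induction k)
  case 0
  then show ?case by simp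
next
  case (Suc k)
  let ?t = "e / (2 - e)"
  define c where "c = (if Suc k \<in> B then 1 else ?t)"
  define Q where "Q = env B (Suc k) * rho (env B) (Suc k)"
  have Q: "0 \<le> Q" "Q \<le> 1 / 2"
    unfolding Q_def by (intro rho_mult_nonneg rho_mult_le admissible_env)+
  have c: "Q / (1 - Q) \<le> c"
  proof (cases "Suc k \<in> B")
    case True
    then show ?thesis using Q by (simp add: c_def divide_simps)
  next
    case False
    have "Q \<le> e / 2"
      using False e_pos rho_le_1[OF admissible_env, of B "Suc k"] rho_nonneg[OF admissible_env, of B "Suc k"]
      by (simp add: Q_def env_def mult_left_le del: rho.simps)
    then have "Q / (1 - Q) \<le> (e / 2) / (1 - e / 2)"
      using Q e_less_1 e_pos by (intro frac_le) auto
    also have "\<dots> = ?t" using e_less_1 by (simp add: field_simps)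
    finally show ?thesis using False by (simp add: c_def)
  qed
  have card: "card ({Suc l..<Suc (Suc k)} - B) = (if Suc k \<in> B then 0 else 1) + card ({Suc l..<Suc k} - B)"
    if "l \<le> k" for l
  proof -
    have "{Suc l..<Suc (Suc k)} = insert (Suc k) {Suc l..<Suc k}" using that by auto
    then show ?thesis by (simp add: insert_Diff_if)
  qed
  have sum: "(\<Sum>l\<le>Suc k. ?t ^ card ({Suc l..<Suc (Suc k)} - B))
      = 1 + c * (\<Sum>l\<le>k. ?t ^ card ({Suc l..<Suc k} - B))"
    by (simp add: card c_def sum_distrib_left)
  have "mu (env B) (Suc (Suc k)) = 1 / (1 - Q) + Q / (1 - Q) * mu (env B) (Suc k)"
    unfolding mu.simps(2)[of _ "Suc k"] Q_def[symmetric] by (simp add: add_divide_distrib del: rho.simps mu.simps)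
  also have "\<dots> \<le> 2 + c * (2 * (\<Sum>l\<le>k. ?t ^ card ({Suc l..<Suc k} - B)))"
  proof (intro add_mono mult_mono c Suc.IH mu_nonneg admissible_env)
    show "1 / (1 - Q) \<le> 2" using Q by (simp add: divide_simps)
    show "0 \<le> c" using e_pos e_less_1 by (simp add: c_def)
  qed
  also have "\<dots> = 2 * (\<Sum>l\<le>Suc k. ?t ^ card ({Suc l..<Suc (Suc k)} - B))"
    unfolding sum by (simp add: algebra_simps)
  finally show ?case .
qed

lemma speed_inv_le:
  assumes upper: "\<And>n. Z (e / (2 - e)) n \<le> A * \<sigma> ^ n" and lower: "\<And>n. K \<le> n \<Longrightarrow> a * \<tau> ^ n \<le> Z 1 n"
    and pos: "0 < a" "0 < \<sigma>" "\<sigma> < \<tau>" and j: "0 < j"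
  shows "speed_inv i j \<le> 2 / (1 - \<sigma> / \<tau>)"
proof -
  let ?t = "e / (2 - e)" and ?x = "\<sigma> / \<tau>"
  have t: "0 < ?t" "?t \<le> 1" using e_pos e_less_1 by auto
  have x: "0 \<le> ?x" "?x < 1" using pos by auto
  have "speed_inv i j \<le> tilted 0 (i + j) (\<lambda>B. 2 * (\<Sum>l\<le>i. ?t ^ card ({Suc l..<Suc i} - B)))"
    unfolding speed_inv_def by (intro tilted_mono mu_env_le)
  also have "\<dots> = 2 * (\<Sum>l\<le>i. tilted 0 (i + j) (\<lambda>B. ?t ^ card ({Suc l..<Suc i} - B)))"
    unfolding tilted_cmult tilted_sum ..
  \<comment> \<open>The block runs from \<open>Suc l\<close> to \<open>i\<close> inclusive: left
    margin \<open>Suc l\<close>, length \<open>i - l\<close>, right margin \<open>j - 1\<close>, in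
    total \<open>i + j\<close> sites.\<close>
  also have "\<dots> = 2 * (\<Sum>l\<le>i. few_traps ?t (Suc l) (i - l) (j - 1))"
    using j by (auto intro!: sum.cong simp: few_traps_def)
  also have "\<dots> \<le> 2 * (\<Sum>l\<le>i. ?x ^ (i - l))"
    using pos by (intro mult_left_mono sum_mono few_traps_le_power[OF t upper lower]) auto
  also have "(\<Sum>l\<le>i. ?x ^ (i - l)) = (\<Sum>l<Suc i. ?x ^ l)"
    unfolding lessThan_Suc_atMost by (rule sum.reindex_bij_witness[of _ "\<lambda>l. i - l" "\<lambda>l. i - l"]) auto
  also have "\<dots> \<le> (\<Sum>l. ?x ^ l)"
    using x by (intro sum_le_suminf summable_geometric) auto
  also have "\<dots> = 1 / (1 - ?x)" using x by (intro suminf_geometric) auto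
  finally show ?thesis by simp
qed

end

subsection \<open>Renewal bounds for the partition function\<close>

text \<open>Along sites without traps \<open>1 / (1 - rho)\<close> increases by 1 at each step.\<close>

lemma rho_free_run:
  assumes "\<And>k. x < k \<Longrightarrow> k < x + L \<Longrightarrow> u k = 1 / 2" "1 \<le> L" and b: "0 < b" "rho u (Suc x) = b / (b + 1)"
  shows "(\<Prod>k\<in>{x..<x + L}. rho u (Suc k)) = b / (b + real L) \<and> rho u (x + L) = (b + real L - 1) / (b + real L)"
  using assms(2,1)
proof (induction L rule: dec_induct)
  case base
  then show ?case using b by (simp add: add.commute del: rho.simps)
next
  case (step L)
  have "u (x + L) = 1 / 2"
    using step by simp
  then have "rho u (Suc (x + L)) = (1 / 2) / (1 - 1 / 2 * rho u (x + L))"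
    by (simp only: rho.simps)
  also have "rho u (x + L) = (b + real L - 1) / (b + real L)"
    using step by simp
  also have "(1 / 2) / (1 - 1 / 2 * ((b + real L - 1) / (b + real L))) = (b + real L) / (b + real (Suc L))"
    using b by (simp add: divide_simps) (simp add: algebra_simps)
  finally have *: "rho u (Suc (x + L)) = (b + real L) / (b + real (Suc L))" .
  have "(\<Prod>k\<in>{x..<x + L}. rho u (Suc k)) = b / (b + real L)"
    using step by simp
  moreover have "b + real (Suc L) - 1 = b + real L" by simp
  ultimately show ?case using b by (simp add: * del: rho.simps of_nat_Suc)
qed

lemma sum_power_div_le_ln:
  fixes z :: real
  assumes "0 < z" "z < 1"
  shows "(\<Sum>x<n. z ^ (n - x) / real (n - x)) \<le> - ln (1 - z)"
proof -
  have s: "(\<lambda>k. z ^ Suc k / real (Suc k)) sums (- ln (1 - z))"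
  proof -
    have "(\<lambda>k. (-1) ^ k * (1 / real (k + 1)) * (1 - z - 1) ^ Suc k) = (\<lambda>k. - (z ^ Suc k / real (Suc k)))"
    proof
      fix k
      have "(-1) ^ k * (- z) ^ Suc k = - (((-1) * (-z)) ^ k * z)"
        unfolding power_Suc power_mult_distrib by simp
      then show "(-1) ^ k * (1 / real (k + 1)) * (1 - z - 1) ^ Suc k = - (z ^ Suc k / real (Suc k))"
        by (simp add: field_simps)
    qed
    moreover have "(\<Sum>k. (-1) ^ k * (1 / real (k + 1)) * (1 - z - 1) ^ Suc k) = ln (1 - z)"
      using ln_series[of "1 - z"] assms by simp
    ultimately have sum: "(\<Sum>k. - (z ^ Suc k / real (Suc k))) = ln (1 - z)" by simp
    have "summable (\<lambda>k. z ^ Suc k)"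
      using assms by (subst summable_Suc_iff) (simp add: summable_geometric)
    then have "summable (\<lambda>k. z ^ Suc k / real (Suc k))"
    proof (rule summable_comparison_test'[of _ 0])
      fix k
      have "z ^ Suc k * 1 \<le> z ^ Suc k * real (Suc k)"
        using assms by (intro mult_left_mono) auto
      then show "norm (z ^ Suc k / real (Suc k)) \<le> z ^ Suc k"
        using assms by (simp add: divide_le_eq)
    qed
    then show ?thesis
      using sum by (simp add: suminf_minus sums_iff)
  qed
  have "(\<Sum>x<n. z ^ (n - x) / real (n - x)) = (\<Sum>k<n. z ^ Suc k / real (Suc k))"
    by (rule sum.reindex_bij_witness[of _ "\<lambda>k. n - Suc k" "\<lambda>k. n - Suc k"]) (auto simp: Suc_diff_Suc)
  also have "\<dots> \<le> - ln (1 - z)"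
    unfolding sums_unique[OF s] using assms sums_summable[OF s] by (intro sum_le_suminf) auto
  finally show ?thesis .
qed

context trap_model
begin

lemma expect_last_trap:
  "expect n F = q ^ n * F {..<n} + (\<Sum>x<n. (1 - q) * q ^ (n - Suc x) * expect x (\<lambda>B. F (B \<union> {x<..<n})))"
proof (induction n arbitrary: F)
  case (Suc n)
  have "insert n (B \<union> {x<..<n}) = B \<union> {x<..<Suc n}" if "x < n" for x B
    using that by auto
  then have "q * expect n (\<lambda>B. F (insert n B)) = q ^ Suc n * F {..<Suc n}
      + (\<Sum>x<n. (1 - q) * q ^ (Suc n - Suc x) * expect x (\<lambda>B. F (B \<union> {x<..<Suc n})))"
    unfolding Suc.IH[of "\<lambda>B. F (insert n B)"]
    by (simp add: distrib_left sum_distrib_left lessThan_Suc Suc_diff_Suc[symmetric] mult_ac)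
  moreover have "{n<..<Suc n} = {}" by auto
  ultimately show ?case
    unfolding expect_Suc by simp
qed simp

text \<open>
  \<open>escape r\<close> is the odds ratio \<open>rho / (1 - rho)\<close> at a trap whose left neighbour has \<open>rho = r\<close>; the
  next gap, of length \<open>L\<close>, is then crossed with probability \<open>escape r / (escape r + L)\<close>.
\<close>

definition escape :: "real \<Rightarrow> real" where
  "escape r = e / (2 - e - e * r)"

definition \<kappa> :: real where
  "\<kappa> = e / (2 - 2 * e)"

lemma \<kappa>_pos: "0 < \<kappa>"
  using e_pos e_less_1 by (simp add: \<kappa>_def)

lemma escape_denominator_pos:
  assumes "r \<le> 1"
  shows "0 < 2 - e - e * r"
proof -
  have "e * r \<le> e * 1"
    using assms e_pos by (intro mult_left_mono) auto
  then show ?thesis using e_less_1 by linarith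
qed

lemma escape_mono: "r \<le> s \<Longrightarrow> s \<le> 1 \<Longrightarrow> escape r \<le> escape s"
  unfolding escape_def using e_pos by (intro frac_le escape_denominator_pos) auto

lemma escape_le: "r \<le> 1 \<Longrightarrow> escape r \<le> \<kappa>"
  using escape_mono[of r 1] by (simp add: escape_def \<kappa>_def)

lemma escape_pos: "r \<le> 1 \<Longrightarrow> 0 < escape r"
  unfolding escape_def using e_pos by (intro divide_pos_pos escape_denominator_pos)

lemma rho_trap:
  assumes "k \<notin> B"
  shows "rho (env B) (Suc k) = escape (rho (env B) k) / (escape (rho (env B) k) + 1)"
proof -
  define r where "r = rho (env B) k"
  have r: "0 < 2 - e - e * r"
    unfolding r_def by (intro escape_denominator_pos rho_le_1 admissible_env)
  then have "e / 2 / (1 - e / 2 * r) = e / (2 - e * r)"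
    using e_pos by (simp add: field_simps)
  also have "\<dots> = escape r / (escape r + 1)"
  proof -
    have "escape r + 1 = (2 - e * r) / (2 - e - e * r)"
      using r by (simp add: escape_def field_simps)
    then show ?thesis using r by (simp add: escape_def)
  qed
  finally show ?thesis using assms by (simp add: env_def r_def)
qed

lemma W_gap:
  assumes "x < n" "B \<subseteq> {..<x}"
  shows "W 0 n (B \<union> {x<..<n}) = W 0 x B * (escape (rho (env B) x) / (escape (rho (env B) x) + real (n - x)))"
proof -
  let ?B = "B \<union> {x<..<n}"
  have eq: "rho (env ?B) k = rho (env B) k" if "k \<le> x" for k
    using that by (intro rho_cong) (auto simp: env_def)
  have "W 0 x ?B = W 0 x B"
    unfolding W_def by (intro prod.cong refl eq) auto
  moreover have "W x n ?B = escape (rho (env B) x) / (escape (rho (env B) x) + real (n - x))"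
  proof -
    have "rho (env ?B) (Suc x) = escape (rho (env B) x) / (escape (rho (env B) x) + 1)"
      using assms by (subst rho_trap) (auto simp: eq)
    then show ?thesis
      using rho_free_run[of x "n - x" "env ?B" "escape (rho (env B) x)"] assms
        escape_pos[OF rho_le_1[OF admissible_env, of B x]]
      by (simp add: W_def env_def del: rho.simps)
  qed
  ultimately show ?thesis
    using W_split[of 0 x n ?B] assms by simp
qed

lemma W_no_trap: "W 0 n {..<n} = 1 / (real n + 1)"
proof (cases n)
  case (Suc m)
  have "rho (env {..<n}) (Suc 0) = 1 / 2"
    using Suc by (simp add: env_def)
  then have "(\<Prod>k\<in>{0..<0 + n}. rho (env {..<n}) (Suc k)) = 1 / (1 + real n)"
    using Suc by (intro rho_free_run[THEN conjunct1]) (auto simp: env_def)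
  then show ?thesis
    by (simp add: W_def add.commute del: rho.simps)
qed (simp add: W_def)

text \<open>Only the trap-free environment is kept. The polynomial loss disappears in
  \<open>speed_inv_ge\<close>, where the logarithm is divided by the length.\<close>

lemma Z_1_ge: "q ^ n / (real n + 1) \<le> Z 1 n"
proof -
  have "0 \<le> (\<Sum>x<n. (1 - q) * q ^ (n - Suc x) * expect x (\<lambda>B. W 0 n (B \<union> {x<..<n})))"
    using q_pos q_less_1 by (intro sum_nonneg mult_nonneg_nonneg expect_nonneg less_imp_le[OF W_pos]) auto
  then show ?thesis
    unfolding Z_1 expect_last_trap[of n] W_no_trap by simp
qed

text \<open>Bounding the factor \<open>b / (b + L)\<close> of the last gap by
  \<open>\<kappa> / L\<close> decouples it from the environment to the left of the last trap, which
  closes the recursion; that trap itself contributes \<open>t\<close>.\<close>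

lemma Z_le_renewal:
  assumes "0 < t"
  shows "Z t n \<le> q ^ n + (\<Sum>x<n. (1 - q) * q ^ (n - Suc x) * (t * \<kappa> / real (n - x) * Z t x))"
proof -
  have "expect x (\<lambda>B. t ^ card ({..<n} - (B \<union> {x<..<n})) * W 0 n (B \<union> {x<..<n}))
      \<le> t * \<kappa> / real (n - x) * Z t x" if x: "x < n" for x
    unfolding Z_def expect_cmult[symmetric]
  proof (rule expect_mono)
    fix B assume B: "B \<subseteq> {..<x}"
    have "{..<n} - (B \<union> {x<..<n}) = insert x ({..<x} - B)" using B x by auto
    then have card: "card ({..<n} - (B \<union> {x<..<n})) = Suc (card ({..<x} - B))" by simp
    define b where "b = escape (rho (env B) x)"
    have b: "0 < b" "b \<le> \<kappa>"
      unfolding b_def by (intro escape_pos escape_le rho_le_1 admissible_env)+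
    have "b / (b + real (n - x)) \<le> \<kappa> / real (n - x)"
      using b x by (intro frac_le) auto
    then have "t ^ Suc (card ({..<x} - B)) * (W 0 x B * (b / (b + real (n - x))))
        \<le> t ^ Suc (card ({..<x} - B)) * (W 0 x B * (\<kappa> / real (n - x)))"
      using assms by (intro mult_left_mono less_imp_le[OF W_pos]) auto
    then show "t ^ card ({..<n} - (B \<union> {x<..<n})) * W 0 n (B \<union> {x<..<n})
        \<le> t * \<kappa> / real (n - x) * (t ^ card ({..<x} - B) * W 0 x B)"
      unfolding card W_gap[OF x B] b_def by (simp add: mult_ac)
  qed
  moreover have "q ^ n * (t ^ card ({..<n} - {..<n}) * W 0 n {..<n}) \<le> q ^ n"
    using q_pos W_le_1[of 0 n "{..<n}"] by (simp add: mult_left_le)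
  ultimately show ?thesis
    unfolding Z_def[of t n] expect_last_trap[of n] using q_pos q_less_1
    by (intro add_mono sum_mono mult_left_mono) auto
qed

definition D :: real where
  "D = q / ((1 - q) * \<kappa>)"

lemma D_pos: "0 < D"
  using q_pos q_less_1 \<kappa>_pos by (simp add: D_def)

text \<open>The value of \<open>z\<close> is chosen such that
  \<open>- ln (1 - z) = (1 - \<delta>) * D / t\<close>. In the induction the renewal sum then
  reproduces the fraction \<open>1 - \<delta>\<close> of the bound, and the trap-free term
  \<open>q ^ n\<close> fits into the remaining fraction \<open>\<delta>\<close> thanks to the
  prefactor \<open>1 / \<delta>\<close>.\<close>

lemma Z_upper:
  assumes t: "0 < t" and \<delta>: "0 < \<delta>" "\<delta> < 1"
  defines "z \<equiv> 1 - exp (- ((1 - \<delta>) * D / t))"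
  shows "Z t n \<le> 1 / \<delta> * (q / z) ^ n"
proof (induction n rule: less_induct)
  case (less n)
  have z: "0 < z" "z < 1"
    unfolding z_def using t \<delta> D_pos by auto
  have "- ln (1 - z) = (1 - \<delta>) * D / t"
    by (simp add: z_def)
  then have ln: "(\<Sum>x<n. z ^ (n - x) / real (n - x)) \<le> (1 - \<delta>) * D / t"
    using sum_power_div_le_ln[OF z] by simp
  have "Z t n \<le> q ^ n + (\<Sum>x<n. (1 - q) * q ^ (n - Suc x) * (t * \<kappa> / real (n - x) * Z t x))"
    by (rule Z_le_renewal[OF t])
  also have "\<dots> \<le> q ^ n + (\<Sum>x<n. (1 - q) * q ^ (n - Suc x) * (t * \<kappa> / real (n - x) * (1 / \<delta> * (q / z) ^ x)))"
    using q_pos q_less_1 t \<kappa>_pos less.IH by (intro add_left_mono sum_mono mult_left_mono) auto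
  also have "\<dots> = q ^ n + (\<Sum>x<n. 1 / \<delta> * (q / z) ^ n * (t / D) * (z ^ (n - x) / real (n - x)))"
  proof -
    have algebra: "(1 - q) * a * (t * \<kappa> / L * (1 / \<delta> * (b / d)))
        = 1 / \<delta> * ((a * b * q) / (c * d)) * (t / D) * (c / L)" if "c \<noteq> 0" for a b c d L :: real
      using that q_pos q_less_1 \<kappa>_pos by (simp add: D_def mult_ac)
    have "(1 - q) * q ^ (n - Suc x) * (t * \<kappa> / real (n - x) * (1 / \<delta> * (q / z) ^ x))
        = 1 / \<delta> * (q / z) ^ n * (t / D) * (z ^ (n - x) / real (n - x))" if "x < n" for x
    proof -
      have "q ^ n = q ^ Suc ((n - Suc x) + x)" "z ^ n = z ^ ((n - x) + x)"
        using that by simp_all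
      then have "q ^ n = q ^ (n - Suc x) * q ^ x * q" "z ^ n = z ^ (n - x) * z ^ x"
        by (simp_all only: power_add power_Suc mult_ac)
      then show ?thesis
        unfolding power_divide by (simp only:) (rule algebra, use z in simp)
    qed
    then show ?thesis by simp
  qed
  also have "\<dots> = q ^ n + 1 / \<delta> * (q / z) ^ n * (t / D) * (\<Sum>x<n. z ^ (n - x) / real (n - x))"
    by (simp add: sum_distrib_left)
  also have "\<dots> \<le> q ^ n + 1 / \<delta> * (q / z) ^ n * (t / D) * ((1 - \<delta>) * D / t)"
    using \<delta> q_pos z t D_pos by (intro add_left_mono mult_left_mono ln) auto
  also have "\<dots> = q ^ n + 1 / \<delta> * (q / z) ^ n * (1 - \<delta>)"
    using t D_pos by simp
  also have "\<dots> \<le> (q / z) ^ n + 1 / \<delta> * (q / z) ^ n * (1 - \<delta>)"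
    using z q_pos by (intro add_right_mono power_mono) (auto simp: divide_simps)
  also have "\<dots> = 1 / \<delta> * (q / z) ^ n"
  proof -
    have "X + 1 / \<delta> * X * (1 - \<delta>) = 1 / \<delta> * X" for X
      using \<delta> by (simp add: field_simps)
    then show ?thesis .
  qed
  finally show ?case .
qed

section \<open>Free runs, short-run counting and the delay\<close>

primrec run :: "nat set \<Rightarrow> nat \<Rightarrow> nat" where
  "run B 0 = 0"
| "run B (Suc k) = (if k \<in> B then Suc (run B k) else 0)"

text \<open>The worst case is killing immediately to the left of the run, where the gambler's ruin
  formula gives equality.\<close>

lemma rho_ge_run: "real (run B k) / (real (run B k) + 1) \<le> rho (env B) k"
proof (induction k)
  case (Suc k)
  show ?case
  proof (cases "k \<in> B")
    case True
    then have env_k: "env B k = 1 / 2" by (simp add: env_def)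
    define r where "r = real (run B k)"
    have r: "0 \<le> r" by (simp add: r_def)
    have "(r + 1) / (r + 1 + 1) = (1 / 2) / (1 - 1 / 2 * (r / (r + 1)))"
      using r by (simp add: divide_simps) (simp add: algebra_simps)
    also have "\<dots> \<le> (1 / 2) / (1 - 1 / 2 * rho (env B) k)"
      using Suc rho_le_1[OF admissible_env, of B k]
      by (intro frac_le diff_left_mono mult_left_mono) (auto simp: r_def)
    finally show ?thesis using True by (simp add: env_k r_def add.commute)
  next
    case False
    then show ?thesis using rho_nonneg[OF admissible_env, of B "Suc k"] by simp
  qed
qed simp

lemma run_ge: "K \<le> x \<Longrightarrow> {x - K..<x} \<subseteq> B \<Longrightarrow> K \<le> run B x"
proof (induction K arbitrary: x)
  case (Suc K)
  then obtain y where y: "x = Suc y" by (cases x) auto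
  have "y \<in> B" using Suc.prems y by auto
  moreover have "K \<le> run B y" using Suc.prems y by (intro Suc.IH) auto
  ultimately show ?case using y by simp
qed simp

text \<open>The recursion is increasing in \<open>rho\<close> and \<open>mu\<close>, so the bounds
  for the preceding run can be inserted. A linear bound with slope \<open>c\<close> then survives
  the step if c (r + 1) (r + 2) \<le> 2 (r + 1) + c r r; the terms linear in r force 3 c \<le> 2,
  whence the constant.\<close>

lemma mu_ge_run: "2 / 3 * real (run B k) \<le> mu (env B) k"
proof (induction k)
  case (Suc k)
  show ?case
  proof (cases "k \<in> B")
    case True
    then have env_k: "env B k = 1 / 2" by (simp add: env_def)
    define r where "r = real (run B k)"
    have r: "0 \<le> r" by (simp add: r_def)
    define m where "m = mu (env B) k"
    have m: "2 / 3 * r \<le> m" using Suc by (simp add: m_def r_def)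
    have rho: "r / (r + 1) \<le> rho (env B) k" using rho_ge_run[of B k] by (simp add: r_def)
    have "2 / 3 * (r + 1) * (r + 2) \<le> 2 * (r + 1) + r * (2 / 3 * r)"
      by (simp add: algebra_simps)
    then have "2 / 3 * (r + 1) \<le> (1 + 1 / 2 * (r / (r + 1)) * (2 / 3 * r)) / (1 - 1 / 2 * (r / (r + 1)))"
      using r by (simp add: divide_simps) (simp add: algebra_simps)
    also have "\<dots> \<le> (1 + 1 / 2 * rho (env B) k * m) / (1 - 1 / 2 * rho (env B) k)"
      using r m rho rho_le_1[OF admissible_env, of B k] rho_nonneg[OF admissible_env, of B k]
      by (intro frac_le add_mono mult_mono diff_left_mono) auto
    finally show ?thesis using True by (simp add: env_k r_def m_def)
  next
    case False
    then show ?thesis using mu_nonneg[OF admissible_env, of B "Suc k"] by simp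
  qed
qed simp

text \<open>Each trap makes at most \<open>K\<close> sites short, namely itself and the
  \<open>K - 1\<close> sites after it, and the left end accounts for the rest. The
  \<open>min\<close> term is the induction potential: it counts the short-run sites since the last
  trap, and a new trap resets it to 0.\<close>

lemma card_short_runs:
  assumes "0 < K"
  shows "card {k\<in>{..<n}. run B (Suc k) < K} \<le> K * card ({..<n} - B) + min (run B n) (K - 1)"
proof -
  define S where "S n = {k\<in>{..<n}. run B (Suc k) < K}" for n
  have S: "finite (S n)" "n \<notin> S n" "S (Suc n) = (if run B (Suc n) < K then insert n (S n) else S n)" for n
    by (auto simp: S_def less_Suc_eq simp del: run.simps)
  have D: "{..<Suc n} - B = (if n \<in> B then {..<n} - B else insert n ({..<n} - B))" for n
    by (auto simp: less_Suc_eq)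
  have "card (S n) \<le> K * card ({..<n} - B) + min (run B n) (K - 1)"
  proof (induction n)
    case (Suc n)
    show ?case
    proof (cases "n \<in> B")
      case True
      then show ?thesis
        using Suc S(1,2)[of n] by (simp add: D S(3) min_def split: if_splits)
    next
      case False
      have "card (S (Suc n)) = Suc (card (S n))"
        using False assms S(1,2)[of n] by (simp add: S(3))
      moreover have "card ({..<Suc n} - B) = Suc (card ({..<n} - B))"
        using False by (simp add: D)
      ultimately show ?thesis
        using Suc assms False min.cobounded2[of "run B n" "K - 1"] by simp
    qed
  qed (simp add: S_def)
  then show ?thesis unfolding S_def .
qed

text \<open>The length \<open>K\<close> is left free; it is chosen later as a small multiple of the
  inverse trap density, so that short runs occupy at most about half of the window.\<close>

lemma sum_mu_ge:
  assumes "0 < K"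
  shows "2 / 3 * real K * (real n - real K * (real (card ({..<n} - B)) + 1)) \<le> (\<Sum>k<n. mu (env B) (Suc k))"
proof -
  define bad where "bad = {k\<in>{..<n}. run B (Suc k) < K}"
  have "card bad \<le> K * card ({..<n} - B) + K"
    using card_short_runs[OF assms, of n B] unfolding bad_def by linarith
  then have bad: "real (card bad) \<le> real K * (real (card ({..<n} - B)) + 1)"
    unfolding of_nat_le_iff[symmetric, where 'a = real] by (simp add: algebra_simps)
  have sub: "bad \<subseteq> {..<n}" by (auto simp: bad_def)
  have "card ({..<n} - bad) = n - card bad" "card bad \<le> n"
    using card_Diff_subset[OF finite_subset[OF sub] sub] card_mono[OF _ sub] by auto
  then have "2 / 3 * real K * (real n - real (card bad)) = (\<Sum>k\<in>{..<n} - bad. 2 / 3 * real K)"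
    by (simp add: of_nat_diff)
  also have "\<dots> \<le> (\<Sum>k\<in>{..<n} - bad. mu (env B) (Suc k))"
  proof (rule sum_mono)
    fix k assume "k \<in> {..<n} - bad"
    then have "2 / 3 * real K \<le> 2 / 3 * real (run B (Suc k))" by (auto simp: bad_def simp del: run.simps)
    then show "2 / 3 * real K \<le> mu (env B) (Suc k)" using mu_ge_run[of B "Suc k"] by (rule order_trans)
  qed
  also have "\<dots> \<le> (\<Sum>k<n. mu (env B) (Suc k))"
    by (intro sum_mono2 mu_nonneg admissible_env) auto
  finally have "2 / 3 * real K * (real n - real (card bad)) \<le> (\<Sum>k<n. mu (env B) (Suc k))" .
  moreover have "2 / 3 * real K * (real n - real K * (real (card ({..<n} - B)) + 1))
      \<le> 2 / 3 * real K * (real n - real (card bad))"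
    using bad by (intro mult_left_mono diff_left_mono) auto
  ultimately show ?thesis by (rule order_trans[rotated])
qed

text \<open>
  For a lower bound, only gaps longer than \<open>K\<close> are kept: then \<open>rho\<close> is at least \<open>K / (K + 1)\<close> to the
  left of each trap, and \<open>escape\<close> is close to its maximum \<open>\<kappa>\<close>.
\<close>

definition Y :: "nat \<Rightarrow> nat \<Rightarrow> real" where
  "Y K n = expect n (\<lambda>B. if {n - K..<n} \<subseteq> B then W 0 n B else 0)"

lemma Y_le_Z: "Y K n \<le> Z 1 n"
  unfolding Y_def Z_1 by (intro expect_mono) (auto intro: less_imp_le[OF W_pos])

lemma Y_pos: "0 < Y K n"
proof -
  let ?F = "\<lambda>B. if {n - K..<n} \<subseteq> B then W 0 n B else 0"
  have F: "0 \<le> ?F B" for B by (auto intro: less_imp_le[OF W_pos])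
  have "0 < q ^ n * ?F {..<n}"
    using q_pos W_pos[of 0 n "{..<n}"] by auto
  also have "\<dots> \<le> Y K n"
    unfolding Y_def expect_last_trap[of n]
    using q_pos q_less_1 by (intro order_trans[OF _ add_left_mono[OF sum_nonneg]] mult_nonneg_nonneg expect_nonneg F) auto
  finally show ?thesis .
qed

definition \<kappa>\<^sub>K :: "nat \<Rightarrow> real" where
  "\<kappa>\<^sub>K K = escape (real K / (real K + 1))"

lemma \<kappa>\<^sub>K_pos: "0 < \<kappa>\<^sub>K K"
  unfolding \<kappa>\<^sub>K_def by (intro escape_pos) auto

lemma \<kappa>\<^sub>K_le: "\<kappa>\<^sub>K K \<le> \<kappa>"
  unfolding \<kappa>\<^sub>K_def by (intro escape_le) auto

text \<open>A last gap longer than \<open>K\<close> makes the condition defining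
  \<open>Y K n\<close> automatic, and the condition in \<open>Y K x\<close> makes the odds at the
  trap \<open>x\<close> at least \<open>\<kappa>\<^sub>K K\<close>. The requirement
  \<open>K \<le> x\<close> ensures that the \<open>K\<close> sites before \<open>x\<close> really
  exist.\<close>

lemma Y_ge_renewal:
  assumes "S \<subseteq> {K..<n - K}"
  shows "(\<Sum>x\<in>S. (1 - q) * q ^ (n - Suc x) * (\<kappa>\<^sub>K K / (\<kappa>\<^sub>K K + real (n - x)) * Y K x)) \<le> Y K n"
proof -
  let ?F = "\<lambda>B. if {n - K..<n} \<subseteq> B then W 0 n B else 0"
  have F: "0 \<le> ?F B" for B by (auto intro: less_imp_le[OF W_pos])
  have fin: "finite S" using assms finite_subset by blast
  have "(\<Sum>x\<in>S. (1 - q) * q ^ (n - Suc x) * (\<kappa>\<^sub>K K / (\<kappa>\<^sub>K K + real (n - x)) * Y K x))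
      \<le> (\<Sum>x\<in>S. (1 - q) * q ^ (n - Suc x) * expect x (\<lambda>B. ?F (B \<union> {x<..<n})))"
  proof (intro sum_mono mult_left_mono)
    fix x assume "x \<in> S"
    then have "x \<in> {K..<n - K}" using assms by blast
    then have x: "K \<le> x" "x < n - K" "x < n" by auto
    show "\<kappa>\<^sub>K K / (\<kappa>\<^sub>K K + real (n - x)) * Y K x \<le> expect x (\<lambda>B. ?F (B \<union> {x<..<n}))"
      unfolding Y_def expect_cmult[symmetric]
    proof (rule expect_mono)
      fix B assume B: "B \<subseteq> {..<x}"
      have "\<kappa>\<^sub>K K / (\<kappa>\<^sub>K K + real (n - x)) * W 0 x B \<le> W 0 n (B \<union> {x<..<n})" if "{x - K..<x} \<subseteq> B"
      proof -
        define b where "b = escape (rho (env B) x)"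
        have "real K / (real K + 1) \<le> real (run B x) / (real (run B x) + 1)"
          using run_ge[OF x(1) that] by (simp add: divide_simps) (simp add: algebra_simps)
        also have "\<dots> \<le> rho (env B) x" by (rule rho_ge_run)
        finally have "\<kappa>\<^sub>K K \<le> b"
          unfolding \<kappa>\<^sub>K_def b_def by (intro escape_mono rho_le_1 admissible_env)
        moreover have "k / (k + d) \<le> b / (b + d)" if "0 < k" "k \<le> b" "0 < d" for k d :: real
          using that mult_right_mono[of k b d] by (simp add: frac_le_eq divide_le_0_iff algebra_simps)
        ultimately have "\<kappa>\<^sub>K K / (\<kappa>\<^sub>K K + real (n - x)) \<le> b / (b + real (n - x))"
          using \<kappa>\<^sub>K_pos[of K] x by simp
        then show ?thesis
          unfolding W_gap[OF x(3) B] b_def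
          by (subst mult.commute) (intro mult_left_mono less_imp_le[OF W_pos])
      qed
      moreover have "{n - K..<n} \<subseteq> B \<union> {x<..<n}" using x by auto
      ultimately show "\<kappa>\<^sub>K K / (\<kappa>\<^sub>K K + real (n - x)) * (if {x - K..<x} \<subseteq> B then W 0 x B else 0)
          \<le> ?F (B \<union> {x<..<n})"
        by (auto intro: less_imp_le[OF W_pos])
    qed
  qed (use q_pos q_less_1 in auto)
  also have "\<dots> \<le> (\<Sum>x<n. (1 - q) * q ^ (n - Suc x) * expect x (\<lambda>B. ?F (B \<union> {x<..<n})))"
    using q_pos q_less_1
    by (intro sum_mono2 mult_nonneg_nonneg expect_nonneg F order_trans[OF assms]) auto
  also have "\<dots> \<le> Y K n"
    unfolding Y_def expect_last_trap[of n] using q_pos F[of "{..<n}"] by simp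
  finally show ?thesis .
qed

text \<open>If the renewal kernel restricted to gap lengths in \<open>{Suc K..R}\<close> has mass at
  least 1 after discounting by \<open>l\<close>, then \<open>Y K n\<close> dominates a multiple of
  \<open>(q * l) ^ n\<close>. A finite range of gaps keeps the argument a plain induction.\<close>

lemma Z_lower:
  assumes "0 < l"
    and ge: "1 \<le> (\<Sum>L\<in>{Suc K..R}. (1 - q) / q * (\<kappa>\<^sub>K K / (\<kappa>\<^sub>K K + real L)) / l ^ L)"
  obtains a where "0 < a" "\<And>n. K \<le> n \<Longrightarrow> a * (q * l) ^ n \<le> Z 1 n"
proof -
  \<comment> \<open>The minimum over \<open>{K..R + K}\<close> settles the base cases. Beyond that
    range every \<open>n - L\<close> with \<open>L \<le> R\<close> stays above
    \<open>K\<close>.\<close>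
  define a where "a = Min ((\<lambda>n. Y K n / (q * l) ^ n) ` {K..R + K})"
  have ql: "0 < q * l" using assms q_pos by simp
  have "0 < a"
    unfolding a_def using Y_pos ql by (subst Min_gr_iff) auto
  have "a * (q * l) ^ n \<le> Y K n" if "K \<le> n" for n
    using that
  proof (induction n rule: less_induct)
    case (less n)
    show ?case
    proof (cases "n \<le> R + K")
      case True
      then have "a \<le> Y K n / (q * l) ^ n"
        unfolding a_def using less by (intro Min_le) auto
      then show ?thesis using ql by (simp add: pos_le_divide_eq)
    next
      case False
      have n: "L \<le> n" if "L \<in> {Suc K..R}" for L using False that by auto
      have "a * (q * l) ^ n \<le> a * (q * l) ^ n * (\<Sum>L\<in>{Suc K..R}. (1 - q) / q * (\<kappa>\<^sub>K K / (\<kappa>\<^sub>K K + real L)) / l ^ L)"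
        using mult_left_mono[OF ge, of "a * (q * l) ^ n"] \<open>0 < a\<close> ql by (simp del: times_divide_eq_right)
      also have "\<dots> = (\<Sum>L\<in>{Suc K..R}. (1 - q) * q ^ (L - 1) * (\<kappa>\<^sub>K K / (\<kappa>\<^sub>K K + real L) * (a * (q * l) ^ (n - L))))"
        unfolding sum_distrib_left
      proof (intro sum.cong refl)
        have algebra: "a * (b * q * c * d) * ((1 - q) / q * f / c) = (1 - q) * b * (f * (a * d))"
          if "c \<noteq> 0" for c a b d f :: real
          using that q_pos by simp
        fix L assume L: "L \<in> {Suc K..R}"
        have "(q * l) ^ n = (q * l) ^ (Suc (L - 1) + (n - L))" using L n[OF L] by simp
        also have "\<dots> = q ^ (L - 1) * q * l ^ L * (q * l) ^ (n - L)"
          using L unfolding power_add power_mult_distrib by (simp add: power_eq_if)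
        finally have qln: "(q * l) ^ n = q ^ (L - 1) * q * l ^ L * (q * l) ^ (n - L)" .
        show "a * (q * l) ^ n * ((1 - q) / q * (\<kappa>\<^sub>K K / (\<kappa>\<^sub>K K + real L)) / l ^ L)
            = (1 - q) * q ^ (L - 1) * (\<kappa>\<^sub>K K / (\<kappa>\<^sub>K K + real L) * (a * (q * l) ^ (n - L)))"
          unfolding qln using assms(1) by (intro algebra) simp
      qed
      also have "\<dots> \<le> (\<Sum>L\<in>{Suc K..R}. (1 - q) * q ^ (L - 1) * (\<kappa>\<^sub>K K / (\<kappa>\<^sub>K K + real L) * Y K (n - L)))"
        using q_pos q_less_1 \<kappa>\<^sub>K_pos[of K] False
        by (intro sum_mono mult_left_mono less.IH) auto
      also have "\<dots> = (\<Sum>x\<in>(\<lambda>L. n - L) ` {Suc K..R}. (1 - q) * q ^ (n - Suc x) * (\<kappa>\<^sub>K K / (\<kappa>\<^sub>K K + real (n - x)) * Y K x))"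
      proof (subst sum.reindex)
        show "inj_on (\<lambda>L. n - L) {Suc K..R}"
          using n by (intro inj_onI) (metis diff_diff_cancel)
        show "(\<Sum>L\<in>{Suc K..R}. (1 - q) * q ^ (L - 1) * (\<kappa>\<^sub>K K / (\<kappa>\<^sub>K K + real L) * Y K (n - L)))
          = sum ((\<lambda>x. (1 - q) * q ^ (n - Suc x) * (\<kappa>\<^sub>K K / (\<kappa>\<^sub>K K + real (n - x)) * Y K x)) \<circ> (\<lambda>L. n - L)) {Suc K..R}"
        proof (intro sum.cong refl)
          fix L assume L: "L \<in> {Suc K..R}"
          have "n - Suc (n - L) = L - 1" "n - (n - L) = L" using n[OF L] L by auto
          then show "(1 - q) * q ^ (L - 1) * (\<kappa>\<^sub>K K / (\<kappa>\<^sub>K K + real L) * Y K (n - L))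
            = ((\<lambda>x. (1 - q) * q ^ (n - Suc x) * (\<kappa>\<^sub>K K / (\<kappa>\<^sub>K K + real (n - x)) * Y K x)) \<circ> (\<lambda>L. n - L)) L"
            by simp
        qed
      qed
      also have "\<dots> \<le> Y K n"
        using False by (intro Y_ge_renewal) auto
      finally show ?thesis .
    qed
  qed
  then show ?thesis
    using that[OF \<open>0 < a\<close>] Y_le_Z order_trans by blast
qed

text \<open>Jensen's inequality turns the growth rate of \<open>Z\<close> at fugacity
  \<open>exp s\<close> into a bound on the mean number of traps, for each
  \<open>s > 0\<close>.\<close>

lemma tilted_card_le:
  assumes "0 < s"
  shows "tilted 0 n (\<lambda>B. real (card ({..<n} - B))) \<le> ln (Z (exp s) n / Z 1 n) / s"
proof -
  define c where "c = Z (exp s) n / Z 1 n"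
  have c: "0 < c" unfolding c_def by (intro divide_pos_pos Z_pos) auto
  have "tilted 0 n (\<lambda>B. s * real (card ({..<n} - B)))
      \<le> tilted 0 n (\<lambda>B. (ln c - 1) + 1 / c * exp s ^ card ({..<n} - B))"
  proof (rule tilted_mono)
    fix B
    define N where "N = card ({..<n} - B)"
    \<comment> \<open>Jensen's inequality, in the form \<open>ln x \<le> ln c + x / c - 1\<close> with \<open>c\<close> the mean of \<open>x\<close>\<close>
    have "ln (exp s ^ N / c) \<le> exp s ^ N / c - 1"
      using c by (intro ln_le_minus_one) simp
    then show "s * real (card ({..<n} - B)) \<le> (ln c - 1) + 1 / c * exp s ^ card ({..<n} - B)"
      using c unfolding N_def[symmetric] by (simp add: ln_div ln_realpow mult.commute)
  qed
  also have "\<dots> = ln c - 1 + 1 / c * tilted 0 n (\<lambda>B. exp s ^ card ({..<n} - B))"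
    unfolding tilted_add tilted_cmult tilted_const ..
  also have "tilted 0 n (\<lambda>B. exp s ^ card ({..<n} - B)) = c"
    by (simp add: tilted_def c_def Z_def mult.commute)
  finally have "s * tilted 0 n (\<lambda>B. real (card ({..<n} - B))) \<le> ln c"
    using c by (simp add: tilted_cmult)
  then show ?thesis using assms by (simp add: c_def pos_le_divide_eq mult.commute)
qed

text \<open>The total mean delay of a window of length \<open>y\<close> started at its left end is a
  sum of values of \<open>speed_inv\<close>, hence at most \<open>real y * L\<close>. Its trap
  density is asymptotically at most \<open>ln (1 / z) / s\<close>, by comparing
  \<open>Z_upper\<close> at fugacity \<open>exp s\<close> with \<open>Z_1_ge\<close>; inserting this
  into \<open>sum_mu_ge\<close> and letting \<open>y\<close> tend to infinity removes the boundary
  terms.\<close>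

lemma speed_inv_ge:
  assumes s: "0 < s" and \<delta>: "0 < \<delta>" "\<delta> < 1" and K: "0 < K"
    and le: "\<And>i j. 0 < j \<Longrightarrow> speed_inv i j \<le> L"
  defines "z \<equiv> 1 - exp (- ((1 - \<delta>) * D / exp s))"
  shows "2 / 3 * real K * (1 - real K * (ln (1 / z) / s)) \<le> L"
proof -
  have z: "0 < z" "z < 1"
    unfolding z_def using \<delta> D_pos by auto
  have "2 / 3 * real K * (1 - real K * (((ln (1 / \<delta>) + ln (real y + 1)) / real y + ln (1 / z)) / s + 1 / real y)) \<le> L"
    if y: "0 < y" for y :: nat
  proof -
    have "Z (exp s) y / Z 1 y \<le> (1 / \<delta> * (q / z) ^ y) / (q ^ y / (real y + 1))"
      using \<delta> q_pos z Z_upper[of "exp s" \<delta> y] unfolding z_def[symmetric]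
      by (intro frac_le Z_1_ge) auto
    also have "\<dots> = 1 / \<delta> * (real y + 1) * (1 / z) ^ y"
      using q_pos by (simp add: power_divide)
    finally have "ln (Z (exp s) y / Z 1 y) \<le> ln (1 / \<delta> * (real y + 1) * (1 / z) ^ y)"
      using Z_pos[of "exp s" y] Z_pos[of 1 y] by (intro ln_mono) auto
    also have "\<dots> = ln (1 / \<delta>) + ln (real y + 1) + real y * ln (1 / z)"
    proof -
      have *: "ln (a * b * c ^ y) = ln a + ln b + real y * ln c" if "0 < a" "0 < b" "0 < c" for a b c :: real
        using that by (simp add: ln_mult ln_realpow)
      show ?thesis by (rule *) (use \<delta> z in auto)
    qed
    finally have lnZ: "ln (Z (exp s) y / Z 1 y) \<le> ln (1 / \<delta>) + ln (real y + 1) + real y * ln (1 / z)" .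
    note N = order_trans[OF tilted_card_le[OF s] divide_right_mono[OF lnZ less_imp_le[OF s]]]
    have "real y * (2 / 3 * real K * (1 - real K * (((ln (1 / \<delta>) + ln (real y + 1)) / real y + ln (1 / z)) / s + 1 / real y)))
        = 2 / 3 * real K * (real y - real K * ((ln (1 / \<delta>) + ln (real y + 1) + real y * ln (1 / z)) / s + 1))"
      using y s by (simp add: field_simps)
    also have "\<dots> \<le> 2 / 3 * real K * (real y - real K * (tilted 0 y (\<lambda>B. real (card ({..<y} - B))) + 1))"
      using N by (intro mult_left_mono diff_left_mono add_right_mono) auto
    also have "\<dots> = tilted 0 y (\<lambda>B. 2 / 3 * real K * (real y - real K * (real (card ({..<y} - B)) + 1)))"
    proof -
      have "(\<lambda>B. 2 / 3 * real K * (real y - real K * (real (card ({..<y} - B)) + 1)))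
          = (\<lambda>B. 2 / 3 * real K * (real y - real K) + (- 2 / 3 * real K * real K) * real (card ({..<y} - B)))"
        by (auto simp: algebra_simps)
      then show ?thesis
        by (simp only: tilted_add tilted_cmult tilted_const) (simp add: algebra_simps)
    qed
    also have "\<dots> \<le> tilted 0 y (\<lambda>B. \<Sum>k<y. mu (env B) (Suc k))"
      by (intro tilted_mono sum_mu_ge K)
    also have "\<dots> = (\<Sum>k<y. speed_inv k (y - k))"
      unfolding tilted_sum by (intro sum.cong) (auto simp: speed_inv_def)
    also have "\<dots> \<le> (\<Sum>k<y. L)"
      by (intro sum_mono le) auto
    also have "\<dots> = real y * L" by simp
    finally show ?thesis using y by simp
  qed
  moreover have "(\<lambda>y. 2 / 3 * real K * (1 - real K * (((ln (1 / \<delta>) + ln (real y + 1)) / real y + ln (1 / z)) / s + 1 / real y)))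
      \<longlonglongrightarrow> 2 / 3 * real K * (1 - real K * ((0 + ln (1 / z)) / s + 0))"
  proof -
    have a1: "(\<lambda>y. (ln (1 / \<delta>) + ln (real y + 1)) / real y) \<longlonglongrightarrow> 0" by real_asymp
    have a2: "(\<lambda>y. 1 / real y) \<longlonglongrightarrow> 0" by real_asymp
    show ?thesis by (intro a1 a2 tendsto_intros) (use s in auto)
  qed
  ultimately show ?thesis
    by (intro tendsto_upperbound[where F = sequentially and f = "\<lambda>y. 2 / 3 * real K * (1 - real K * (((ln (1 / \<delta>) + ln (real y + 1)) / real y + ln (1 / z)) / s + 1 / real y))"])
      (auto intro: eventually_sequentiallyI[of 1])
qed

end

subsection \<open>Asymptotics of the mean delay\<close>

lemma ln_quotient_le_sum_inverse:
  fixes c :: real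
  assumes "0 \<le> c" "K \<le> R"
  shows "ln ((real R + 1 + c) / (real K + 1 + c)) \<le> (\<Sum>L\<in>{Suc K..R}. 1 / (c + real L))"
  using assms(2)
proof (induction R rule: dec_induct)
  case base
  then show ?case using assms by simp
next
  case (step R)
  have "ln ((real (Suc R) + 1 + c) / (real K + 1 + c))
      = ln ((real R + 1 + c) / (real K + 1 + c)) + ln ((real (Suc R) + 1 + c) / (real R + 1 + c))"
    using assms(1) by (subst ln_mult_pos[symmetric]) auto
  also have "(real (Suc R) + 1 + c) / (real R + 1 + c) = 1 + 1 / (c + real (Suc R))"
    using assms(1) by (simp add: field_simps)
  also have "ln (1 + 1 / (c + real (Suc R))) \<le> 1 / (c + real (Suc R))"
    using assms(1) by (intro ln_add_one_self_le_self) auto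
  finally show ?case using step assms by simp
qed

context trap_model
begin

text \<open>An exact identity: the relative loss from cutting runs at \<open>K\<close> is
  \<open>\<kappa> / (real K + 1)\<close>, so one \<open>K\<close> serves all models with bounded
  \<open>\<kappa>\<close>.\<close>

lemma \<kappa>_le_\<kappa>\<^sub>K: "\<kappa> = \<kappa>\<^sub>K K * (1 + \<kappa> / (real K + 1))"
proof -
  define k where "k = real K + 1"
  have k: "1 \<le> k" "real K / (real K + 1) = 1 - 1 / k" by (auto simp: k_def field_simps)
  have den: "0 < 2 - e - e * (1 - 1 / k)"
    using k by (intro escape_denominator_pos) auto
  have "1 + \<kappa> / k = (2 - e - e * (1 - 1 / k)) / (2 - 2 * e)"
    using k e_less_1 by (simp add: \<kappa>_def field_simps)
  then show ?thesis
    using den k e_less_1 unfolding \<kappa>\<^sub>K_def escape_def k_def[symmetric] k(2) by (simp add: \<kappa>_def)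
qed

text \<open>The two factors \<open>1 + \<eta>\<close> multiplying \<open>D\<close> pay for replacing
  \<open>\<kappa>\<close> by \<open>\<kappa>\<^sub>K K\<close> and for the discount
  \<open>l ^ L\<close> with \<open>L \<le> R\<close>. The hypothesis \<open>small\<close> makes the
  growth correction at fugacity \<open>e / (2 - e)\<close> at most a quarter of the one at fugacity
  1.\<close>

lemma speed_inv_upper:
  fixes \<eta> \<kappa>\<^sub>0 \<theta>\<^sub>0 \<delta> :: real and K R :: nat
  assumes \<eta>: "0 < \<eta>" "\<eta> \<le> 1" and \<kappa>\<^sub>0: "\<kappa> \<le> \<kappa>\<^sub>0" "\<kappa>\<^sub>0 \<le> \<eta> * (real K + 1)"
    and \<theta>\<^sub>0: "e / (2 - e) \<le> \<theta>\<^sub>0" and \<delta>: "0 < \<delta>" "\<delta> < 1"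
    and R: "1 \<le> R" "K \<le> R" "(1 + \<eta>)\<^sup>2 * D \<le> ln ((real R + 1) / (real K + 1 + \<kappa>\<^sub>0))"
    and small: "exp (- ((1 - \<delta>) * D / \<theta>\<^sub>0)) \<le> ln (1 + \<eta>) / (4 * real R)"
    and j: "0 < j"
  shows "speed_inv i j \<le> 6 * real R / ln (1 + \<eta>)"
proof -
  define c where "c = ln (1 + \<eta>)"
  \<comment> \<open>The largest convenient rate with \<open>l ^ R \<le> 1 + \<eta>\<close>.\<close>
  define l where "l = 1 + c / real R"
  have c: "0 < c" "c \<le> 1"
    using \<eta> ln_add_one_self_le_self[of \<eta>] by (auto simp: c_def)
  have l: "0 < l" "1 \<le> l" using c by (auto simp: l_def add_pos_nonneg)
  have "l ^ R \<le> exp (c / real R) ^ R"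
    unfolding l_def using c by (intro power_mono exp_ge_add_one_self) auto
  also have "\<dots> = 1 + \<eta>"
    using R(1) \<eta> by (simp add: exp_of_nat_mult[symmetric] c_def)
  finally have lR: "l ^ R \<le> 1 + \<eta>" .
  have \<kappa>: "\<kappa> \<le> \<kappa>\<^sub>K K * (1 + \<eta>)"
  proof -
    have "\<kappa> / (real K + 1) \<le> \<eta>" using \<kappa>\<^sub>0 by (simp add: divide_le_eq)
    then show ?thesis
      using \<kappa>\<^sub>K_pos[of K] by (subst \<kappa>_le_\<kappa>\<^sub>K[of K]) (auto intro!: mult_left_mono)
  qed
  have "1 \<le> (\<Sum>L\<in>{Suc K..R}. (1 - q) / q * (\<kappa>\<^sub>K K / (\<kappa>\<^sub>K K + real L)) / l ^ L)"
  proof -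
    have "(1 + \<eta>)\<^sup>2 * D \<le> ln ((real R + 1 + \<kappa>\<^sub>0) / (real K + 1 + \<kappa>\<^sub>0))"
      using \<kappa>\<^sub>0 \<kappa>_pos by (intro order_trans[OF R(3)] ln_mono divide_right_mono) auto
    also have "\<dots> \<le> (\<Sum>L\<in>{Suc K..R}. 1 / (\<kappa>\<^sub>0 + real L))"
      using \<kappa>\<^sub>0 \<kappa>_pos R by (intro ln_quotient_le_sum_inverse) auto
    finally have sum: "(1 + \<eta>)\<^sup>2 * D \<le> (\<Sum>L\<in>{Suc K..R}. 1 / (\<kappa>\<^sub>0 + real L))" .
    have "1 = (1 - q) / q * (\<kappa> / (1 + \<eta>)\<^sup>2) * ((1 + \<eta>)\<^sup>2 * D)"
      using q_pos q_less_1 \<kappa>_pos \<eta> by (simp add: D_def)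
    also have "\<dots> \<le> (1 - q) / q * (\<kappa> / (1 + \<eta>)\<^sup>2) * (\<Sum>L\<in>{Suc K..R}. 1 / (\<kappa>\<^sub>0 + real L))"
      using q_pos q_less_1 \<kappa>_pos by (intro mult_left_mono sum) auto
    also have "\<dots> = (\<Sum>L\<in>{Suc K..R}. (1 - q) / q * ((\<kappa> / (1 + \<eta>)) * (1 / (\<kappa>\<^sub>0 + real L)) * (1 / (1 + \<eta>))))"
      unfolding sum_distrib_left by (intro sum.cong refl) (simp add: power2_eq_square)
    also have "\<dots> \<le> (\<Sum>L\<in>{Suc K..R}. (1 - q) / q * (\<kappa>\<^sub>K K * (1 / (\<kappa>\<^sub>K K + real L)) * (1 / l ^ L)))"
      (is "_ \<le> ?S")
    proof (intro sum_mono mult_left_mono mult_mono)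
      fix L assume L: "L \<in> {Suc K..R}"
      show "\<kappa> / (1 + \<eta>) \<le> \<kappa>\<^sub>K K" using \<kappa> \<eta> by (simp add: divide_le_eq)
      show "1 / (\<kappa>\<^sub>0 + real L) \<le> 1 / (\<kappa>\<^sub>K K + real L)"
        using \<kappa>\<^sub>K_pos[of K] \<kappa>\<^sub>K_le[of K] \<kappa>\<^sub>0 by (intro divide_left_mono) (auto intro: mult_pos_pos)
      have "l ^ L \<le> l ^ R" using L l by (intro power_increasing) auto
      then show "1 / (1 + \<eta>) \<le> 1 / l ^ L"
        using lR l \<eta> by (intro divide_left_mono) (auto intro: mult_pos_pos)
    qed (use \<kappa>\<^sub>K_pos[of K] \<kappa>\<^sub>0 \<kappa>_pos q_pos q_less_1 \<eta> in auto)
    also have "?S = (\<Sum>L\<in>{Suc K..R}. (1 - q) / q * (\<kappa>\<^sub>K K / (\<kappa>\<^sub>K K + real L)) / l ^ L)"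
      by (intro sum.cong refl) (simp add: mult.assoc)
    finally show ?thesis .
  qed
  from Z_lower[OF l(1) this] obtain a where a: "0 < a" "\<And>n. K \<le> n \<Longrightarrow> a * (q * l) ^ n \<le> Z 1 n"
    by blast
  define t where "t = e / (2 - e)"
  have t: "0 < t" "t \<le> \<theta>\<^sub>0" using e_pos e_less_1 \<theta>\<^sub>0 by (auto simp: t_def)
  define x where "x = exp (- ((1 - \<delta>) * D / t))"
  define y where "y = c / real R"
  have y: "0 < y" "y \<le> 1" "l = 1 + y"
    using c R(1) by (auto simp: y_def l_def divide_le_eq)
  have x: "0 < x" "x \<le> y / 4"
  proof -
    have "(1 - \<delta>) * D / \<theta>\<^sub>0 \<le> (1 - \<delta>) * D / t"
      using t \<delta> D_pos by (intro divide_left_mono) auto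
    then have "x \<le> exp (- ((1 - \<delta>) * D / \<theta>\<^sub>0))" by (simp add: x_def)
    also note small
    finally show "x \<le> y / 4" by (simp add: y_def c_def)
  qed (simp add: x_def)
  \<comment> \<open>The inverse ratio of the two growth rates. Both \<open>x\<close> and
    \<open>x * y\<close> are at most \<open>y / 4\<close>, so at least half of the gain
    \<open>y\<close> remains.\<close>
  define w where "w = (1 - x) * l"
  have "x * y \<le> x" using x y by (simp add: mult_left_le)
  moreover have "w = 1 + y - x - x * y" by (simp add: w_def y(3) algebra_simps)
  ultimately have w: "1 + y / 2 \<le> w" using x y by linarith
  have "q < q * w" using w y q_pos by simp
  then have \<sigma>: "q / (1 - x) < q * l"
    using x y by (simp add: w_def divide_less_eq mult_ac)
  have "speed_inv i j \<le> 2 / (1 - (q / (1 - x)) / (q * l))"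
  proof (rule speed_inv_le)
    show "Z (e / (2 - e)) n \<le> 1 / \<delta> * (q / (1 - x)) ^ n" for n
      unfolding x_def t_def[symmetric] by (rule Z_upper[OF t(1) \<delta>])
  qed (use a \<sigma> j q_pos x y in auto)
  also have "(q / (1 - x)) / (q * l) = 1 / w"
    using q_pos by (simp add: w_def)
  also have "2 / (1 - 1 / w) = 2 + 2 / (w - 1)"
    using w y by (simp add: field_simps)
  also have "\<dots> \<le> 2 / y + 2 / (y / 2)"
    using w y by (intro add_mono frac_le) (auto simp: le_divide_eq)
  also have "\<dots> = 6 * real R / c"
    using R(1) c by (simp add: y_def field_simps)
  finally show ?thesis unfolding c_def .
qed

end

text \<open>The bound \<open>e \<le> e\<^sub>0\<close> makes the fugacity at most
  \<open>\<theta>\<^sub>0 < 1\<close> and \<open>\<kappa>\<close> at most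
  \<open>\<kappa>\<^sub>0\<close>, so all constants depend on \<open>e\<^sub>0\<close> and
  \<open>\<epsilon>\<close> only. The gap cutoff \<open>R\<close> is of order exp ((1 + 3 \<eta>)
  D).\<close>

lemma speed_inv_le_exp:
  fixes e\<^sub>0 \<epsilon> :: real
  assumes e\<^sub>0: "0 < e\<^sub>0" "e\<^sub>0 < 1" and \<epsilon>: "0 < \<epsilon>"
  obtains D\<^sub>0 where "\<And>q e i j. trap_model q e \<Longrightarrow> e \<le> e\<^sub>0 \<Longrightarrow> D\<^sub>0 \<le> trap_model.D q e \<Longrightarrow> 0 < j \<Longrightarrow>
    trap_model.speed_inv q e i j \<le> exp ((1 + \<epsilon>) * trap_model.D q e)"
proof -
  define \<theta>\<^sub>0 where "\<theta>\<^sub>0 = e\<^sub>0 / (2 - e\<^sub>0)"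
  define \<kappa>\<^sub>0 where "\<kappa>\<^sub>0 = e\<^sub>0 / (2 - 2 * e\<^sub>0)"
  have \<theta>\<^sub>0: "0 < \<theta>\<^sub>0" "\<theta>\<^sub>0 < 1" and \<kappa>\<^sub>0: "0 < \<kappa>\<^sub>0" using e\<^sub>0 by (auto simp: \<theta>\<^sub>0_def \<kappa>\<^sub>0_def)
  \<comment> \<open>\<open>\<epsilon> / 6\<close> gives
    \<open>3 * \<eta> \<le> \<epsilon> / 2\<close>, and the last entry gives
    \<open>1 + 3 * \<eta> < 1 / \<theta>\<^sub>0\<close>, so that exp (-D / \<theta>) stays far
    below \<open>1 / R\<close>.\<close>
  define \<eta> where "\<eta> = min 1 (min (\<epsilon> / 6) ((1 / \<theta>\<^sub>0 - 1) / 6))"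
  have "0 < (1 / \<theta>\<^sub>0 - 1) / 6" using \<theta>\<^sub>0 by simp
  then have \<eta>: "0 < \<eta>" "\<eta> \<le> 1" "\<eta> \<le> \<epsilon> / 6" "\<eta> \<le> (1 / \<theta>\<^sub>0 - 1) / 6"
    unfolding \<eta>_def using \<epsilon> by linarith+
  have "\<eta> * \<eta> \<le> \<eta>" using \<eta> by (simp add: mult_left_le)
  then have \<eta>2: "(1 + \<eta>)\<^sup>2 \<le> 1 + 3 * \<eta>" by (simp add: power2_eq_square algebra_simps)
  \<comment> \<open>Makes \<open>1 - \<delta>\<close> the midpoint between
    \<open>\<theta>\<^sub>0 * (1 + 3 * \<eta>)\<close> and 1, so that \<open>gap\<close> is
    positive.\<close>
  define \<delta> where "\<delta> = (1 - \<theta>\<^sub>0 * (1 + 3 * \<eta>)) / 2"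
  have "1 + 3 * \<eta> < 1 / \<theta>\<^sub>0" using \<eta>(4) \<theta>\<^sub>0 by (simp add: field_simps)
  then have lt1: "\<theta>\<^sub>0 * (1 + 3 * \<eta>) < 1" using \<theta>\<^sub>0 by (simp add: field_simps)
  moreover have "0 < \<theta>\<^sub>0 * (1 + 3 * \<eta>)" using \<theta>\<^sub>0 \<eta> by simp
  moreover have "0 < (1 - v) / 2 \<and> (1 - v) / 2 < 1" if "v < 1" "0 < v" for v :: real
    using that by simp
  ultimately have \<delta>: "0 < \<delta>" "\<delta> < 1" unfolding \<delta>_def by blast+
  define gap where "gap = (1 - \<delta>) / \<theta>\<^sub>0 - (1 + 3 * \<eta>)"
  have gap: "0 < gap" using lt1 \<theta>\<^sub>0 by (simp add: gap_def \<delta>_def field_simps)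
  obtain K :: nat where K: "\<kappa>\<^sub>0 / \<eta> \<le> real K" using real_arch_simple by blast
  then have K: "\<kappa>\<^sub>0 \<le> \<eta> * (real K + 1)" using \<eta>(1) by (simp add: field_simps)
  define C where "C = real K + 1 + \<kappa>\<^sub>0"
  define c where "c = ln (1 + \<eta>)"
  have C: "1 \<le> C" "real K \<le> C" and c: "0 < c" using \<kappa>\<^sub>0 \<eta> by (auto simp: C_def c_def)
  \<comment> \<open>The former entry secures the hypothesis \<open>small\<close> of
    \<open>speed_inv_upper\<close>; the latter lets \<open>exp (\<epsilon> / 2 * D)\<close> absorb
    the constant \<open>12 * C / c\<close>.\<close>
  define D\<^sub>0 where "D\<^sub>0 = max (ln (8 * C / c) / gap) (2 * ln (12 * C / c) / \<epsilon>)"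
  show ?thesis
  proof (rule that[of D\<^sub>0])
    fix q e :: real and i j :: nat
    assume "trap_model q e" and e: "e \<le> e\<^sub>0" and D\<^sub>0: "D\<^sub>0 \<le> trap_model.D q e" and j: "0 < j"
    then interpret trap_model q e by simp
    define X where "X = exp ((1 + 3 * \<eta>) * D)"
    have X: "1 \<le> X" using D_pos \<eta> by (simp add: X_def)
    define R where "R = nat \<lceil>C * X\<rceil>"
    have CX: "1 \<le> C * X" "C \<le> C * X" using C X mult_mono[of 1 C 1 X] by auto
    have R: "C * X \<le> real R" "real R \<le> 2 * C * X"
    proof -
      have "real R = of_int \<lceil>C * X\<rceil>"
        unfolding R_def using CX by simp
      then show "C * X \<le> real R" "real R \<le> 2 * C * X"
        using CX(1) of_int_ceiling_le_add_one[of "C * X"] le_of_int_ceiling[of "C * X"]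
        unfolding mult.assoc by linarith+
    qed
    have "speed_inv i j \<le> 6 * real R / ln (1 + \<eta>)"
    proof (rule speed_inv_upper[OF \<eta>(1,2) _ K _ \<delta>])
      show "\<kappa> \<le> \<kappa>\<^sub>0" unfolding \<kappa>_def \<kappa>\<^sub>0_def using e e_pos e\<^sub>0 by (intro frac_le) auto
      show "e / (2 - e) \<le> \<theta>\<^sub>0" unfolding \<theta>\<^sub>0_def using e e_pos e\<^sub>0 by (intro frac_le) auto
      have "1 \<le> real R" using R CX by linarith
      then show "1 \<le> R" by simp
      have "real K \<le> real R" using R CX C by linarith
      then show "K \<le> R" by simp
      have "(1 + \<eta>)\<^sup>2 * D \<le> (1 + 3 * \<eta>) * D" using \<eta>2 D_pos by (intro mult_right_mono) auto
      also have "\<dots> = ln X" by (simp add: X_def)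
      also have "\<dots> \<le> ln ((real R + 1) / C)"
        using R C X by (intro ln_mono) (auto simp: le_divide_eq mult.commute)
      finally show "(1 + \<eta>)\<^sup>2 * D \<le> ln ((real R + 1) / (real K + 1 + \<kappa>\<^sub>0))" by (simp add: C_def)
      have "ln (8 * C / c) \<le> gap * D"
        using D\<^sub>0 gap by (simp add: D\<^sub>0_def divide_le_eq mult.commute)
      then have "8 * C / c \<le> exp (gap * D)"
        using C c by (subst ln_le_cancel_iff[symmetric]) auto
      also have "gap * D = (1 - \<delta>) * D / \<theta>\<^sub>0 - (1 + 3 * \<eta>) * D"
        by (simp add: gap_def algebra_simps)
      finally have "8 * C / c \<le> exp ((1 - \<delta>) * D / \<theta>\<^sub>0) / X"
        unfolding exp_diff X_def .
      then have "8 * C * X \<le> c * exp ((1 - \<delta>) * D / \<theta>\<^sub>0)"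
        using X c by (simp add: field_simps)
      then have "4 * real R \<le> c * exp ((1 - \<delta>) * D / \<theta>\<^sub>0)" using R by simp
      then show "exp (- ((1 - \<delta>) * D / \<theta>\<^sub>0)) \<le> ln (1 + \<eta>) / (4 * real R)"
        using \<open>1 \<le> real R\<close> unfolding c_def[symmetric] exp_minus by (simp add: field_simps)
    qed (fact j)
    also have "\<dots> \<le> (12 * C / c) * X"
      using R c unfolding c_def[symmetric] by (simp add: divide_right_mono)
    also have "\<dots> \<le> exp (\<epsilon> / 2 * D) * exp ((1 + \<epsilon> / 2) * D)"
    proof (intro mult_mono)
      have "ln (12 * C / c) \<le> \<epsilon> / 2 * D"
        using D\<^sub>0 \<epsilon> by (simp add: D\<^sub>0_def divide_le_eq mult_ac)
      then show "12 * C / c \<le> exp (\<epsilon> / 2 * D)"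
        using C c by (subst ln_le_cancel_iff[symmetric]) auto
      show "X \<le> exp ((1 + \<epsilon> / 2) * D)"
        unfolding X_def using \<eta> D_pos by (simp add: mult_right_mono)
    qed (use X in auto)
    also have "\<dots> = exp ((1 + \<epsilon>) * D)"
      by (simp add: exp_add[symmetric] algebra_simps)
    finally show "speed_inv i j \<le> exp ((1 + \<epsilon>) * D)" .
  qed
qed

text \<open>The bound is uniform over all models because the fugacity \<open>exp s\<close> is chosen
  in terms of \<open>\<epsilon>\<close> alone, unlike the fugacity \<open>e / (2 - e)\<close> of the
  upper bound.\<close>

lemma exp_le_speed_inv_bound:
  fixes \<epsilon> :: real
  assumes \<epsilon>: "0 < \<epsilon>" "\<epsilon> \<le> 1"
  obtains D\<^sub>0 where "\<And>q e L. trap_model q e \<Longrightarrow> D\<^sub>0 \<le> trap_model.D q e \<Longrightarrow>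
    (\<And>i j. 0 < j \<Longrightarrow> trap_model.speed_inv q e i j \<le> L) \<Longrightarrow> exp ((1 - \<epsilon>) * trap_model.D q e) \<le> L"
proof -
  \<comment> \<open>Used both as the exponent \<open>s\<close> and as \<open>\<delta>\<close> in
    \<open>speed_inv_ge\<close>; then \<open>(1 - s) * exp (- s)\<close> is at least
    \<open>(1 - s) * (1 - s)\<close>, hence at least \<open>1 - \<epsilon> / 2\<close>.\<close>
  define s where "s = \<epsilon> / 4"
  have s: "0 < s" "s \<le> 1 / 4" using \<epsilon> by (auto simp: s_def)
  define D\<^sub>0 where "D\<^sub>0 = max 2 (2 * ln (24 / s) / \<epsilon>)"
  show ?thesis
  proof (rule that[of D\<^sub>0])
    fix q e L :: real
    assume "trap_model q e" and D\<^sub>0: "D\<^sub>0 \<le> trap_model.D q e"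
      and L: "\<And>i j. 0 < j \<Longrightarrow> trap_model.speed_inv q e i j \<le> L"
    then interpret trap_model q e by simp
    define x where "x = exp (- ((1 - s) * D / exp s))"
    have "(1 - s) * (1 - s) \<le> (1 - s) * exp (- s)"
      using s exp_ge_add_one_self[of "- s"] by (intro mult_left_mono) auto
    moreover have "(1 - s) * (1 - s) = 1 - \<epsilon> / 2 + s * s" unfolding s_def by (simp add: algebra_simps)
    moreover have "0 \<le> s * s" by simp
    ultimately have "1 - \<epsilon> / 2 \<le> (1 - s) * exp (- s)" by linarith
    then have "(1 - \<epsilon> / 2) * D \<le> (1 - s) * exp (- s) * D"
      using D_pos by (intro mult_right_mono) auto
    also have "\<dots> = (1 - s) * D / exp s" by (simp add: exp_minus field_simps)
    finally have "exp ((1 - \<epsilon> / 2) * D) \<le> exp ((1 - s) * D / exp s)" by simp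
    then have x: "0 < x" "exp ((1 - \<epsilon> / 2) * D) \<le> 1 / x"
      by (simp_all add: x_def exp_minus inverse_eq_divide)
    have big: "24 / s \<le> exp (\<epsilon> / 2 * D)"
    proof -
      have "ln (24 / s) \<le> \<epsilon> / 2 * D"
        using D\<^sub>0 \<epsilon> by (simp add: D\<^sub>0_def divide_le_eq mult_ac)
      then show ?thesis
        using s by (subst ln_le_cancel_iff[symmetric]) auto
    qed
    also have "\<dots> \<le> exp ((1 - \<epsilon> / 2) * D)"
      using \<epsilon> D_pos by (simp add: mult_right_mono)
    also note x(2)
    finally have sx: "24 \<le> s / x" using s x by (simp add: field_simps)
    then have "24 * x \<le> 1 / 4" using s x by (simp add: field_simps)
    then have x2: "x \<le> 1 / 2" by simp
    have ln: "ln (1 / (1 - x)) \<le> 2 * x"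
    proof -
      have "ln (1 / (1 - x)) \<le> 1 / (1 - x) - 1"
        using x2 by (intro ln_le_minus_one) auto
      also have "\<dots> = x / (1 - x)" using x2 by (simp add: field_simps)
      also have "\<dots> \<le> x / (1 / 2)" using x2 x by (intro divide_left_mono) auto
      finally show ?thesis by simp
    qed
    \<comment> \<open>Up to rounding this maximises \<open>K * (1 - K * (2 * x / s))\<close>, where
      \<open>2 * x / s\<close> bounds the trap density; the bracket is then at least one
      half.\<close>
    define K where "K = nat \<lfloor>s / (4 * x)\<rfloor>"
    have "6 \<le> s / (4 * x)" using sx by simp
    then have K: "real K \<le> s / (4 * x)" "s / (4 * x) - 1 \<le> real K" "0 < K"
    proof -
      have "real K = of_int \<lfloor>s / (4 * x)\<rfloor>"
        unfolding K_def using \<open>6 \<le> s / (4 * x)\<close> by simp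
      then show "real K \<le> s / (4 * x)" "s / (4 * x) - 1 \<le> real K" by linarith+
      then have "0 < real K" using \<open>6 \<le> s / (4 * x)\<close> by linarith
      then show "0 < K" by simp
    qed
    have "real K * (ln (1 / (1 - x)) / s) \<le> (s / (4 * x)) * (2 * x / s)"
      using K ln s x x2 by (intro mult_mono divide_right_mono) auto
    also have "\<dots> = 1 / 2" using s x by simp
    finally have half: "1 / 2 \<le> 1 - real K * (ln (1 / (1 - x)) / s)" by simp
    have "exp ((1 - \<epsilon>) * D) * (24 / s) \<le> exp ((1 - \<epsilon>) * D) * exp (\<epsilon> / 2 * D)"
      using big by (intro mult_left_mono) auto
    also have "\<dots> = exp ((1 - \<epsilon> / 2) * D)"
      by (simp add: exp_add[symmetric] algebra_simps)
    also note x(2)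
    finally have "exp ((1 - \<epsilon>) * D) \<le> s / (24 * x)"
      using s x by (simp add: field_simps)
    also have "\<dots> \<le> (s / (4 * x) - 1) / 3"
      using sx x by (simp add: field_simps)
    also have "\<dots> \<le> real K / 3" using K by simp
    also have "\<dots> = 2 / 3 * real K * (1 / 2)" by simp
    also have "\<dots> \<le> 2 / 3 * real K * (1 - real K * (ln (1 / (1 - x)) / s))"
      by (intro mult_left_mono half) auto
    also have "\<dots> \<le> L"
      unfolding x_def by (rule speed_inv_ge[OF s(1) s(1) _ K(3) L]) (use s in simp_all)
    finally show "exp ((1 - \<epsilon>) * D) \<le> L" .
  qed
qed

subsection \<open>Path measures and hitting times\<close>

definition cylinder :: "'a list \<Rightarrow> (nat \<Rightarrow> 'a) set" where
  "cylinder xs = {s. \<forall>i<length xs. s i = xs ! i}"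

lemma space_paths: "space paths = UNIV"
  by (simp add: space_PiM)

lemma coordinate_in_paths: "{s. s i \<in> A} \<in> sets (paths :: (nat \<Rightarrow> 'a) measure)"
proof -
  have "(\<lambda>s. s i) -` A \<inter> space paths \<in> sets (paths :: (nat \<Rightarrow> 'a) measure)"
    by (rule measurable_sets[OF measurable_component_singleton]) auto
  then show ?thesis by (simp add: space_paths vimage_def)
qed

lemma coordinate_eq_in_paths: "{s. s i = a} \<in> sets (paths :: (nat \<Rightarrow> 'a) measure)"
  using coordinate_in_paths[of i "{a}"] by simp

lemma cylinder_in_paths: "cylinder xs \<in> sets (paths :: (nat \<Rightarrow> 'a) measure)"
proof -
  have "cylinder xs = space paths \<inter> (\<Inter>i\<in>{..<length xs}. {s. s i = xs ! i})"
    by (auto simp: cylinder_def space_paths)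
  also have "\<dots> \<in> sets paths"
    by (cases xs) (auto simp: space_paths intro!: sets.finite_INT coordinate_eq_in_paths sets.Int
      simp flip: space_paths)
  finally show ?thesis .
qed

text \<open>Over a countable state space each coordinate event is a countable union of cylinders.
  The empty set is added because incompatible cylinders intersect in it, so that the generator is
  closed under intersection.\<close>

lemma sets_paths_eq_cylinders:
  "sets (paths :: (nat \<Rightarrow> 'a::countable) measure) = sigma_sets UNIV (insert {} (range cylinder))"
proof
  show "sigma_sets UNIV (insert {} (range cylinder)) \<subseteq> sets (paths :: (nat \<Rightarrow> 'a) measure)"
  proof -
    have "insert {} (range cylinder) \<subseteq> sets (paths :: (nat \<Rightarrow> 'a) measure)"
      by (auto intro: cylinder_in_paths)
    from sets.sigma_sets_subset[OF this] show ?thesis by (simp only: space_paths)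
  qed
  interpret S: sigma_algebra UNIV "sigma_sets UNIV (insert {} (range cylinder) :: (nat \<Rightarrow> 'a) set set)"
    by (rule sigma_algebra_sigma_sets) auto
  have "{s. s i \<in> A} \<in> sigma_sets UNIV (insert {} (range cylinder))" for i and A :: "'a set"
  proof -
    have "{s. s i \<in> A} = (\<Union>xs\<in>{xs. length xs = Suc i \<and> xs ! i \<in> A}. cylinder xs)"
    proof safe
      fix s :: "nat \<Rightarrow> 'a" assume "s i \<in> A"
      then show "s \<in> (\<Union>xs\<in>{xs. length xs = Suc i \<and> xs ! i \<in> A}. cylinder xs)"
        by (intro UN_I[of "map s [0..<Suc i]"]) (auto simp: cylinder_def simp del: upt_Suc)
    qed (auto simp: cylinder_def)
    also have "\<dots> \<in> sigma_sets UNIV (insert {} (range cylinder))"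
      by (intro S.countable_UN') auto
    finally show ?thesis .
  qed
  then show "sets (paths :: (nat \<Rightarrow> 'a) measure) \<subseteq> sigma_sets UNIV (insert {} (range cylinder))"
  proof -
    assume *: "\<And>i (A :: 'a set). {s. s i \<in> A} \<in> sigma_sets UNIV (insert {} (range cylinder))"
    have eq: "(UNIV \<rightarrow>\<^sub>E space (count_space UNIV)) = (UNIV :: (nat \<Rightarrow> 'a) set)" by auto
    show ?thesis
      unfolding sets_PiM_single eq by (intro sigma_sets_mono) (auto intro: *)
  qed
qed

lemma Int_stable_cylinders: "Int_stable (insert {} (range cylinder))"
proof (rule Int_stableI)
  have *: "cylinder xs \<inter> cylinder ys \<in> insert {} (range cylinder)" if "length xs \<le> length ys" for xs ys :: "'a list"
  proof (cases "\<forall>i<length xs. xs ! i = ys ! i")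
    case True
    then have "cylinder xs \<inter> cylinder ys = cylinder ys" using that by (auto simp: cylinder_def)
    then show ?thesis by simp
  next
    case False
    then have "cylinder xs \<inter> cylinder ys = {}" using that by (fastforce simp: cylinder_def)
    then show ?thesis by simp
  qed
  fix A B :: "(nat \<Rightarrow> 'a) set"
  assume AB: "A \<in> insert {} (range cylinder)" "B \<in> insert {} (range cylinder)"
  show "A \<inter> B \<in> insert {} (range cylinder)"
  proof (cases "A = {} \<or> B = {}")
    case False
    then obtain xs ys where "A = cylinder xs" "B = cylinder ys" using AB by auto
    then show ?thesis
      using *[of xs ys] *[of ys xs] by (metis Int_commute linorder_le_cases)
  qed auto
qed

lemma emeasure_cylinder:
  fixes K :: "'a::countable \<Rightarrow> 'a pmf"
  shows "emeasure (markov_chain K a) (cylinder xs) =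
    (if xs = [] then 1 else if xs ! 0 = a then \<Prod>i<length xs - 1. ennreal (pmf (K (xs ! i)) (xs ! Suc i)) else 0)"
proof (cases "xs = []")
  case True
  then have "cylinder xs = space (markov_chain K a)"
    using sets_eq_imp_space_eq[OF sets_markov_chain[of K a]] by (simp add: cylinder_def space_paths)
  then show ?thesis
    using True prob_space.emeasure_space_1[OF prob_space_markov_chain] by simp
next
  case False
  have "cylinder xs = {s. \<forall>i\<le>length xs - 1. s i = xs ! i}"
    using False by (cases xs) (auto simp: cylinder_def less_Suc_eq_le)
  then show ?thesis
    using False by (simp add: emeasure_markov_chain)
qed

text \<open>Cylinder probabilities are finite products of transition probabilities, hence measurable
  in the parameter, and cylinders form an intersection-stable generator.\<close>

lemma measurable_markov_chain:
  fixes K :: "'w \<Rightarrow> 'a::countable \<Rightarrow> 'a pmf"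
  assumes "\<And>x z. (\<lambda>\<omega>. pmf (K \<omega> x) z) \<in> borel_measurable M"
  shows "(\<lambda>\<omega>. markov_chain (K \<omega>) a) \<in> M \<rightarrow>\<^sub>M subprob_algebra paths"
proof (rule measurable_subprob_algebra_generated[OF sets_paths_eq_cylinders Int_stable_cylinders])
  have "(\<lambda>\<omega>. emeasure (markov_chain (K \<omega>) a) (cylinder xs)) \<in> borel_measurable M" for xs
    unfolding emeasure_cylinder using assms by measurable
  then show "(\<lambda>\<omega>. emeasure (markov_chain (K \<omega>) a) A) \<in> borel_measurable M"
    if "A \<in> insert {} (range cylinder)" for A
    using that by auto
  have "emeasure (markov_chain (K \<omega>) a) UNIV = 1" for \<omega>
    using emeasure_cylinder[of "K \<omega>" a "[]"] by (simp add: cylinder_def)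
  then show "(\<lambda>\<omega>. emeasure (markov_chain (K \<omega>) a) UNIV) \<in> borel_measurable M"
    by simp
qed (auto simp: sets_markov_chain prob_space_imp_subprob_space prob_space_markov_chain)

section \<open>First entrance times of a Markov chain\<close>

primrec entrance :: "('a \<Rightarrow> 'a pmf) \<Rightarrow> 'a \<Rightarrow> nat \<Rightarrow> 'a \<Rightarrow> ennreal" where
  "entrance K b 0 a = (if a = b then 1 else 0)"
| "entrance K b (Suc n) a = (if a = b then 0 else \<integral>\<^sup>+z. entrance K b n z \<partial>K a)"

text \<open>The Markov property without shifting paths: an arbitrary prefix \<open>c\<close> is
  carried along, and each induction step extends it by one state \<open>z\<close> and sums over
  \<open>z\<close>.\<close>

lemma emeasure_prefix_entrance:
  fixes K :: "'a::countable \<Rightarrow> 'a pmf"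
  shows "emeasure (markov_chain K a) {s. (\<forall>i\<le>k. s i = c i) \<and> s (k + n) = b \<and> (\<forall>i. k \<le> i \<and> i < k + n \<longrightarrow> s i \<noteq> b)}
    = emeasure (markov_chain K a) {s. \<forall>i\<le>k. s i = c i} * entrance K b n (c k)"
proof (induction n arbitrary: k c)
  case 0
  have "{s. (\<forall>i\<le>k. s i = c i) \<and> s (k + 0) = b \<and> (\<forall>i. k \<le> i \<and> i < k + 0 \<longrightarrow> s i \<noteq> b)}
      = (if c k = b then {s. \<forall>i\<le>k. s i = c i} else {})"
    by auto
  then show ?case by simp
next
  case (Suc n)
  define E where "E = {s. (\<forall>i\<le>k. s i = c i) \<and> s (k + Suc n) = b \<and> (\<forall>i. k \<le> i \<and> i < k + Suc n \<longrightarrow> s i \<noteq> b)}"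
  show ?case
  proof (cases "c k = b")
    case True
    then have "E = {}" by (auto simp: E_def)
    then show ?thesis using True unfolding E_def[symmetric] by simp
  next
    case False
    define c' where "c' z = c(Suc k := z)" for z
    define X where "X z = {s. (\<forall>i\<le>Suc k. s i = c' z i) \<and> s (Suc k + n) = b \<and> (\<forall>i. Suc k \<le> i \<and> i < Suc k + n \<longrightarrow> s i \<noteq> b)}" for z
    have prefix: "(\<forall>i\<le>Suc k. s i = c' z i) \<longleftrightarrow> (\<forall>i\<le>k. s i = c i) \<and> s (Suc k) = z" for s z
      by (auto simp: c'_def le_Suc_eq)
    have "E = (\<Union>z\<in>UNIV. X z)"
    proof -
      have "(\<forall>i. k \<le> i \<and> i < k + Suc n \<longrightarrow> s i \<noteq> b) \<longleftrightarrow> s k \<noteq> b \<and> (\<forall>i. Suc k \<le> i \<and> i < Suc k + n \<longrightarrow> s i \<noteq> b)" for s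
      proof -
        have "k \<le> i \<and> i < k + Suc n \<longleftrightarrow> i = k \<or> Suc k \<le> i \<and> i < Suc k + n" for i by auto
        then show ?thesis by auto
      qed
      then show ?thesis
        using False by (auto simp: E_def X_def prefix)
    qed
    moreover have "emeasure (markov_chain K a) (\<Union>z\<in>UNIV. X z) = (\<integral>\<^sup>+z. emeasure (markov_chain K a) (X z) \<partial>count_space UNIV)"
    proof (rule emeasure_UN_countable)
      have "X z = {s. \<forall>i\<le>Suc k. s i = c' z i} \<inter> {s. s (Suc k + n) = b} \<inter> (\<Inter>i\<in>{Suc k..<Suc k + n}. - {s. s i = b})" for z
        by (auto simp: X_def)
      moreover have "{s. \<forall>i\<le>Suc k. s i = c' z i} = (\<Inter>i\<in>{..Suc k}. {s. s i = c' z i})" for z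
        by auto
      moreover have "(\<Inter>i\<in>{Suc k..<Suc k + n}. - {s. s i = b}) = space paths - (\<Union>i\<in>{Suc k..<Suc k + n}. {s. s i = b})"
        by (auto simp: space_paths)
      ultimately show "X z \<in> sets (markov_chain K a)" for z
        unfolding sets_markov_chain
        by (auto intro!: sets.Int sets.finite_INT sets.Diff sets.finite_UN sets.top coordinate_eq_in_paths)
      show "disjoint_family_on X UNIV"
        by (auto simp: disjoint_family_on_def X_def prefix)
    qed auto
    moreover have "emeasure (markov_chain K a) (X z)
        = emeasure (markov_chain K a) {s. \<forall>i\<le>k. s i = c i} * (ennreal (pmf (K (c k)) z) * entrance K b n z)" for z
    proof -
      have "emeasure (markov_chain K a) {s. \<forall>i\<le>Suc k. s i = c' z i}
          = emeasure (markov_chain K a) {s. \<forall>i\<le>k. s i = c i} * ennreal (pmf (K (c k)) z)"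
        unfolding emeasure_markov_chain by (auto simp: c'_def intro!: prod.cong)
      then show ?thesis
        unfolding X_def Suc.IH by (simp add: c'_def mult.assoc)
    qed
    ultimately have "emeasure (markov_chain K a) E
        = emeasure (markov_chain K a) {s. \<forall>i\<le>k. s i = c i} * (\<integral>\<^sup>+z. entrance K b n z \<partial>K (c k))"
      by (simp add: nn_integral_cmult nn_integral_measure_pmf)
    then show ?thesis using False unfolding E_def[symmetric] by simp
  qed
qed

lemma hitting_time_eq_enat_iff:
  "hitting_time x s = enat n \<longleftrightarrow> 0 < n \<and> s n = Some x \<and> (\<forall>i. 0 < i \<and> i < n \<longrightarrow> s i \<noteq> Some x)"
proof -
  define A where "A = {n. 0 < n \<and> s n = Some x}"
  have hit: "hitting_time x s = (if A = {} then \<infinity> else enat (LEAST n. n \<in> A))"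
  proof (cases "A = {}")
    case True
    then show ?thesis by (simp add: hitting_time_def A_def[symmetric] top_enat_def)
  next
    case False
    then have least: "(LEAST n. n \<in> A) \<in> A" by (auto intro: LeastI)
    have "(INF n\<in>A. enat n) = enat (LEAST n. n \<in> A)"
    proof (rule antisym)
      show "(INF n\<in>A. enat n) \<le> enat (LEAST n. n \<in> A)" by (rule INF_lower[OF least])
      show "enat (LEAST n. n \<in> A) \<le> (INF n\<in>A. enat n)" by (rule INF_greatest) (simp add: Least_le)
    qed
    then show ?thesis using False by (simp add: hitting_time_def A_def[symmetric])
  qed
  have "n \<in> A \<and> (\<forall>i. 0 < i \<and> i < n \<longrightarrow> s i \<noteq> Some x) \<longleftrightarrow> A \<noteq> {} \<and> (LEAST n. n \<in> A) = n"
    (is "?l \<longleftrightarrow> ?r")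
  proof
    assume ?l
    then have "n \<in> A" "\<And>i. i \<in> A \<Longrightarrow> n \<le> i" by (auto simp: A_def not_less[symmetric])
    then show ?r using Least_equality[of "\<lambda>n. n \<in> A" n] by blast
  next
    assume ?r
    then have n: "n \<in> A" using LeastI_ex[of "\<lambda>n. n \<in> A"] by blast
    moreover have "i \<notin> A" if "i < n" for i
      using not_less_Least[of i "\<lambda>n. n \<in> A"] that \<open>?r\<close> by blast
    ultimately show ?l unfolding A_def by blast
  qed
  moreover have "hitting_time x s = enat n \<longleftrightarrow> A \<noteq> {} \<and> (LEAST n. n \<in> A) = n"
    unfolding hit by simp
  ultimately show ?thesis by (simp add: A_def conj_assoc)
qed

text \<open>\<open>hitting_time\<close> ignores time 0 while \<open>entrance\<close> counts it; the
  two agree when the walk does not start at its target.\<close>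

lemma emeasure_hitting_time_eq:
  assumes "a \<noteq> Some y"
  shows "emeasure (markov_chain K a) {s. hitting_time y s = enat n} = entrance K (Some y) n a"
proof -
  interpret prob_space "markov_chain K a" by (rule prob_space_markov_chain)
  have start: "emeasure (markov_chain K a) {s. \<forall>i\<le>0. s i = a} = 1"
    by (subst emeasure_markov_chain) simp
  have "AE s in markov_chain K a. s 0 = a"
  proof (rule AE_I')
    have eq: "{s. s 0 \<noteq> a} = space (markov_chain K a) - {s. \<forall>i\<le>0. s i = a}"
      using sets_eq_imp_space_eq[OF sets_markov_chain[of K a]] by (auto simp: space_paths)
    have "{s. \<forall>i\<le>0. s i = a} \<in> sets (markov_chain K a)"
      using coordinate_eq_in_paths[of 0 a] by (simp add: sets_markov_chain)
    then show "{s. s 0 \<noteq> a} \<in> null_sets (markov_chain K a)"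
      unfolding eq null_sets_def using start by (auto simp: emeasure_compl emeasure_space_1)
  qed auto
  then have "emeasure (markov_chain K a) {s. hitting_time y s = enat n}
      = emeasure (markov_chain K a) {s. (\<forall>i\<le>0. s i = a) \<and> s (0 + n) = Some y \<and> (\<forall>i. 0 \<le> i \<and> i < 0 + n \<longrightarrow> s i \<noteq> Some y)}"
  proof (intro emeasure_eq_AE)
    show "AE s in markov_chain K a. s \<in> {s. hitting_time y s = enat n} \<longleftrightarrow>
        s \<in> {s. (\<forall>i\<le>0. s i = a) \<and> s (0 + n) = Some y \<and> (\<forall>i. 0 \<le> i \<and> i < 0 + n \<longrightarrow> s i \<noteq> Some y)}"
      using \<open>AE s in markov_chain K a. s 0 = a\<close>
    proof eventually_elim
      case (elim s)
      have "(\<forall>i<n. s i \<noteq> Some y) \<longleftrightarrow> (\<forall>i. 0 < i \<and> i < n \<longrightarrow> s i \<noteq> Some y)"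
        using elim assms by (metis gr0I)
      moreover have "s n = Some y \<Longrightarrow> 0 < n" using elim assms by (metis gr0I)
      ultimately show ?case using elim by (auto simp: hitting_time_eq_enat_iff)
    qed
    have *: "{s. (\<forall>i\<le>0. s i = a) \<and> s (0 + n) = Some y \<and> (\<forall>i. 0 \<le> i \<and> i < 0 + n \<longrightarrow> s i \<noteq> Some y)}
        = {s. s 0 = a} \<inter> {s. s n = Some y} \<inter> (space paths - (\<Union>i\<in>{..<n}. {s. s i = Some y}))"
      by (auto simp: space_paths)
    show "{s. (\<forall>i\<le>0. s i = a) \<and> s (0 + n) = Some y \<and> (\<forall>i. 0 \<le> i \<and> i < 0 + n \<longrightarrow> s i \<noteq> Some y)} \<in> sets (markov_chain K a)"
      unfolding sets_markov_chain *
      by (intro sets.Int sets.Diff sets.finite_UN sets.top coordinate_eq_in_paths) auto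
    have "{s. hitting_time y s = enat n} = (if n = 0 then {} else
        {s. s n = Some y} \<inter> (space paths - (\<Union>i\<in>{0<..<n}. {s. s i = Some y})))"
      by (auto simp: hitting_time_eq_enat_iff space_paths)
    also have "\<dots> \<in> sets paths"
      by (auto intro!: sets.Int sets.Diff sets.finite_UN sets.top coordinate_eq_in_paths)
    finally show "{s. hitting_time y s = enat n} \<in> sets (markov_chain K a)"
      unfolding sets_markov_chain .
  qed
  also have "\<dots> = entrance K (Some y) n a"
    using emeasure_prefix_entrance[of K a 0 "\<lambda>_. a" n "Some y"] start by simp
  finally show ?thesis .
qed

lemma measurable_hitting_time: "hitting_time y \<in> paths \<rightarrow>\<^sub>M count_space UNIV"
proof (subst measurable_count_space_eq_countable, safe)
  have fin: "{s. hitting_time y s = enat n} \<in> sets paths" for n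
  proof -
    have "{s. hitting_time y s = enat n} = (if n = 0 then {} else
        {s. s n = Some y} \<inter> (space paths - (\<Union>i\<in>{0<..<n}. {s. s i = Some y})))"
      by (auto simp: hitting_time_eq_enat_iff space_paths)
    also have "\<dots> \<in> sets paths"
      by (auto intro!: sets.Int sets.Diff sets.finite_UN sets.top coordinate_eq_in_paths)
    finally show ?thesis .
  qed
  fix t :: enat
  show "hitting_time y -` {t} \<inter> space paths \<in> sets paths"
  proof (cases t)
    case (enat n)
    then show ?thesis using fin[of n] by (simp add: space_paths vimage_def)
  next
    case infinity
    have "hitting_time y -` {\<infinity>} \<inter> space paths = space paths - (\<Union>n. {s. hitting_time y s = enat n})"
      by (auto simp: not_infinity_eq)
    also have "\<dots> \<in> sets paths" using fin by (intro sets.Diff sets.countable_UN) auto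
    finally show ?thesis using infinity by simp
  qed
qed auto

subsection \<open>First passage times of the killed walk\<close>

text \<open>The missing left neighbour at 0 fixes the ratio of consecutive values, site by site from
  the left. So the value at \<open>m\<close> determines the solution; in particular a solution
  vanishing at \<open>m\<close> is zero.\<close>

lemma harmonic_eq_prod_rho:
  assumes u: "admissible u"
    and harm: "\<And>k. k < m \<Longrightarrow> E k = u k * (E (Suc k) + (if k = 0 then 0 else E (k - 1)))"
    and k: "k \<le> m"
  shows "E k = (\<Prod>j\<in>{k..<m}. rho u (Suc j)) * E m"
proof -
  have one: "E k = rho u (Suc k) * E (Suc k)" if "k < m" for k
    using that
  proof (induction k)
    case 0
    then show ?case using harm[of 0] by simp
  next
    case (Suc k)
    have "E (Suc k) = u (Suc k) * (E (Suc (Suc k)) + E k)" using harm[OF Suc.prems] by simp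
    also have "E k = rho u (Suc k) * E (Suc k)" using Suc by simp
    finally have "E (Suc k) * (1 - u (Suc k) * rho u (Suc k)) = u (Suc k) * E (Suc (Suc k))"
      by (simp add: algebra_simps del: rho.simps)
    moreover have "1 - u (Suc k) * rho u (Suc k) \<noteq> 0"
      using rho_mult_le[OF u, of "Suc k"] by linarith
    ultimately show ?case by (subst rho.simps) (simp add: field_simps del: rho.simps)
  qed
  show ?thesis using k
  proof (induction k rule: inc_induct)
    case (step k)
    then show ?case using one[of k]
      by (simp add: prod.atLeast_Suc_lessThan del: rho.simps)
  qed simp
qed

text \<open>The claimed values solve the first-step equations and therefore dominate all partial
  sums, which gives summability. The limits satisfy the same equations, and uniqueness identifies
  them.\<close>

lemma first_passage_sums:
  assumes u: "admissible u"
    and h0: "\<And>k. k \<le> m \<Longrightarrow> h 0 k = (if k = m then 1 else (0::real))" and hm: "\<And>n. h (Suc n) m = 0"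
    and hS: "\<And>n k. k < m \<Longrightarrow> h (Suc n) k = u k * (h n (Suc k) + (if k = 0 then 0 else h n (k - 1)))"
    and k: "k \<le> m"
  defines "H \<equiv> \<lambda>k. \<Prod>j\<in>{k..<m}. rho u (Suc j)"
  shows "(\<lambda>n. h n k) sums H k"
    and "(\<lambda>n. real n * h n k) sums (H k * (\<Sum>j\<in>{k..<m}. mu u (Suc j)))"
proof -
  define T where "T k = H k * (\<Sum>j\<in>{k..<m}. mu u (Suc j))" for k
  have nonneg: "0 \<le> h n k" if "k \<le> m" for n k
    using that
  proof (induction n arbitrary: k)
    case (Suc n)
    then show ?case
      using admissibleD(1)[OF u, of k] by (cases "k = m") (auto simp: hm hS)
  qed (simp add: h0)
  have H_nonneg: "0 \<le> H k" for k
    unfolding H_def by (intro prod_nonneg rho_nonneg[OF u] ballI)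
  have T_nonneg: "0 \<le> T k" for k
    unfolding T_def by (intro mult_nonneg_nonneg H_nonneg sum_nonneg mu_nonneg[OF u])
  have Hm: "H m = 1" and Tm: "T m = 0" by (simp_all add: H_def T_def)
  have H_rec: "H k = rho u (Suc k) * H (Suc k)" if "k < m" for k
    using that by (simp add: H_def prod.atLeast_Suc_lessThan del: rho.simps)
  have den: "1 - u k * rho u k \<noteq> 0" for k
    using rho_mult_le[OF u, of k] by linarith
  have H: "H k = u k * (H (Suc k) + (if k = 0 then 0 else H (k - 1)))" if km: "k < m" for k
  proof -
    have "(if k = 0 then 0 else H (k - 1)) = rho u k * H k"
      using H_rec[of "k - 1"] km by (cases k) auto
    moreover have "H k * (1 - u k * rho u k) = u k * H (Suc k)"
      using den[of k] H_rec[OF km] by simp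
    ultimately show ?thesis by (simp add: algebra_simps)
  qed
  \<comment> \<open>The inhomogeneous term \<open>H k\<close> is the unit of time spent on the step
    from \<open>k\<close>, weighted by the probability of reaching \<open>m\<close>.\<close>
  have T: "T k = u k * (T (Suc k) + (if k = 0 then 0 else T (k - 1))) + H k" if km: "k < m" for k
  proof -
    define M where "M k = (\<Sum>j\<in>{k..<m}. mu u (Suc j))" for k
    have M: "M k = mu u (Suc k) + M (Suc k)" if "k < m" for k
      using that by (simp add: M_def sum.atLeast_Suc_lessThan del: mu.simps)
    have prev: "(if k = 0 then 0 else T (k - 1)) = rho u k * H k * (mu u k + M k)"
      using H_rec[of "k - 1"] M[of "k - 1"] km by (cases k) (auto simp: T_def M_def[symmetric] simp del: mu.simps)
    define Q where "Q = u k * rho u k"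
    have mu: "mu u (Suc k) * (1 - Q) = 1 + Q * mu u k"
      using den[of k] by (simp add: Q_def)
    have uH: "u k * H (Suc k) = H k * (1 - Q)"
      using den[of k] H_rec[OF km] by (simp add: Q_def)
    have "u k * (T (Suc k) + (if k = 0 then 0 else T (k - 1))) + H k
        = (u k * H (Suc k)) * M (Suc k) + Q * H k * (mu u k + M k) + H k"
      unfolding prev by (simp add: T_def M_def[symmetric] Q_def algebra_simps del: mu.simps)
    also have "\<dots> = H k * ((1 - Q) * M (Suc k) + Q * M k + (1 + Q * mu u k))"
      unfolding uH by (simp add: algebra_simps)
    also have "\<dots> = H k * M k"
      unfolding M[OF km] mu[symmetric] by (simp add: algebra_simps del: mu.simps)
    finally show ?thesis by (simp add: T_def M_def)
  qed
  have S_Suc: "(\<Sum>n<Suc N. h n k) = u k * ((\<Sum>n<N. h n (Suc k)) + (if k = 0 then 0 else (\<Sum>n<N. h n (k - 1))))"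
    if "k < m" for N k
    using that unfolding sum.lessThan_Suc_shift
    by (simp add: h0 hS sum_distrib_left[symmetric] sum.distrib)
  have S_m: "(\<Sum>n<Suc N. h n m) = 1" for N
    unfolding sum.lessThan_Suc_shift by (simp add: h0 hm)
  have S_le: "(\<Sum>n<N. h n k) \<le> H k" if "k \<le> m" for N k
    using that
  proof (induction N arbitrary: k)
    case (Suc N)
    show ?case
    proof (cases "k = m")
      case True
      then show ?thesis using S_m Hm by simp
    next
      case False
      then have km: "k < m" using Suc by simp
      show ?thesis
        unfolding S_Suc[OF km] H[OF km]
        using km by (intro mult_left_mono add_mono admissibleD[OF u]) (auto intro: Suc.IH)
    qed
  qed (simp add: H_nonneg)
  have sumh: "summable (\<lambda>n. h n k)" if "k \<le> m" for k
    using S_le[OF that] nonneg[OF that] by (intro summableI_nonneg_bounded) auto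
  have TS_Suc: "(\<Sum>n<Suc N. real n * h n k)
      = u k * ((\<Sum>n<N. real n * h n (Suc k)) + (if k = 0 then 0 else (\<Sum>n<N. real n * h n (k - 1))))
        + (\<Sum>n<Suc N. h n k)" if "k < m" for N k
  proof -
    have "(\<Sum>n<Suc N. real n * h n k) = (\<Sum>n<N. real n * h (Suc n) k) + (\<Sum>n<Suc N. h n k)"
      unfolding sum.lessThan_Suc_shift using that by (simp add: h0 algebra_simps sum.distrib)
    also have "(\<Sum>n<N. real n * h (Suc n) k)
        = (\<Sum>n<N. u k * (real n * h n (Suc k) + (if k = 0 then 0 else real n * h n (k - 1))))"
      using that by (intro sum.cong refl) (auto simp: hS algebra_simps)
    finally show ?thesis by (simp add: sum_distrib_left[symmetric] sum.distrib)
  qed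
  have TS_m: "(\<Sum>n<Suc N. real n * h n m) = 0" for N
    unfolding sum.lessThan_Suc_shift by (simp add: hm)
  have TS_le: "(\<Sum>n<N. real n * h n k) \<le> T k" if "k \<le> m" for N k
    using that
  proof (induction N arbitrary: k)
    case (Suc N)
    show ?case
    proof (cases "k = m")
      case True
      then show ?thesis using TS_m Tm by simp
    next
      case False
      then have km: "k < m" using Suc by simp
      show ?thesis
        unfolding TS_Suc[OF km] T[OF km]
        using km by (intro mult_left_mono add_mono admissibleD[OF u] S_le) (auto intro: Suc.IH)
    qed
  qed (simp add: T_nonneg)
  have sumT: "summable (\<lambda>n. real n * h n k)" if "k \<le> m" for k
    using TS_le[OF that] nonneg[OF that] by (intro summableI_nonneg_bounded) auto
  define sH where "sH k = (\<Sum>n. h n k)" for k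
  define sT where "sT k = (\<Sum>n. real n * h n k)" for k
  have limH: "(\<lambda>N. \<Sum>n<N. h n k) \<longlonglongrightarrow> sH k" "(\<lambda>N. \<Sum>n<Suc N. h n k) \<longlonglongrightarrow> sH k" if "k \<le> m" for k
    using summable_LIMSEQ[OF sumh[OF that]] LIMSEQ_Suc[OF summable_LIMSEQ[OF sumh[OF that]]]
    by (simp_all only: sH_def)
  have limT: "(\<lambda>N. \<Sum>n<N. real n * h n k) \<longlonglongrightarrow> sT k" "(\<lambda>N. \<Sum>n<Suc N. real n * h n k) \<longlonglongrightarrow> sT k"
    if "k \<le> m" for k
    using summable_LIMSEQ[OF sumT[OF that]] LIMSEQ_Suc[OF summable_LIMSEQ[OF sumT[OF that]]]
    by (simp_all only: sT_def)
  have sH: "sH k = u k * (sH (Suc k) + (if k = 0 then 0 else sH (k - 1)))" if km: "k < m" for k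
  proof (rule LIMSEQ_unique[OF limH(2)])
    have "(\<lambda>N. u k * ((\<Sum>n<N. h n (Suc k)) + (if k = 0 then 0 else (\<Sum>n<N. h n (k - 1)))))
        \<longlonglongrightarrow> u k * (sH (Suc k) + (if k = 0 then 0 else sH (k - 1)))"
      using km limH(1)[of "k - 1"] by (intro tendsto_intros limH) auto
    then show "(\<lambda>N. \<Sum>n<Suc N. h n k) \<longlonglongrightarrow> u k * (sH (Suc k) + (if k = 0 then 0 else sH (k - 1)))"
      unfolding S_Suc[OF km] .
  qed (use km in simp)
  have sHm: "sH m = 1"
    by (rule LIMSEQ_unique[OF limH(2)]) (simp_all only: S_m order.refl tendsto_const)
  have sH_eq: "sH k = H k" if "k \<le> m" for k
    using harmonic_eq_prod_rho[of u m sH, OF u sH that] sHm by (simp add: H_def)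
  have sT: "sT k = u k * (sT (Suc k) + (if k = 0 then 0 else sT (k - 1))) + sH k" if km: "k < m" for k
  proof (rule LIMSEQ_unique[OF limT(2)])
    have "(\<lambda>N. u k * ((\<Sum>n<N. real n * h n (Suc k)) + (if k = 0 then 0 else (\<Sum>n<N. real n * h n (k - 1)))) + (\<Sum>n<Suc N. h n k))
        \<longlonglongrightarrow> u k * (sT (Suc k) + (if k = 0 then 0 else sT (k - 1))) + sH k"
      using km limT(1)[of "k - 1"] by (intro tendsto_intros limH limT) auto
    then show "(\<lambda>N. \<Sum>n<Suc N. real n * h n k) \<longlonglongrightarrow> u k * (sT (Suc k) + (if k = 0 then 0 else sT (k - 1))) + sH k"
      unfolding TS_Suc[OF km] .
  qed (use km in simp)
  have sTm: "sT m = 0"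
    by (rule LIMSEQ_unique[OF limT(2)]) (simp_all only: TS_m order.refl tendsto_const)
  \<comment> \<open>The difference solves the homogeneous equation and vanishes at
    \<open>m\<close>.\<close>
  have sT_eq: "sT k = T k" if "k \<le> m" for k
  proof -
    have "T k - sT k = u k * (T (Suc k) - sT (Suc k) + (if k = 0 then 0 else T (k - 1) - sT (k - 1)))"
      if "k < m" for k
      using T[OF that] sT[OF that] sH_eq[of k] that by (simp add: algebra_simps split: if_splits)
    from harmonic_eq_prod_rho[of u m "\<lambda>k. T k - sT k", OF u this that] show ?thesis
      by (simp add: Tm sTm)
  qed
  show "(\<lambda>n. h n k) sums H k"
    using summable_sums[OF sumh[OF k]] sH_eq[OF k] by (simp add: sH_def)
  show "(\<lambda>n. real n * h n k) sums (H k * (\<Sum>j\<in>{k..<m}. mu u (Suc j)))"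
    using summable_sums[OF sumT[OF k]] sT_eq[OF k] by (simp add: sT_def T_def)
qed

section \<open>First passage probabilities on the integers\<close>

primrec first_passage :: "(int \<Rightarrow> real) \<Rightarrow> int \<Rightarrow> nat \<Rightarrow> int \<Rightarrow> real" where
  "first_passage u y 0 x = (if x = y then 1 else 0)"
| "first_passage u y (Suc n) x =
    (if x = y then 0 else u x * (first_passage u y n (x + 1) + first_passage u y n (x - 1)))"

text \<open>Killing below \<open>l\<close> makes the half-line recursions for \<open>rho\<close> and
  \<open>mu\<close> applicable; the full walk is recovered as the increasing limit when
  \<open>l\<close> tends to minus infinity.\<close>

definition absorbed_below :: "int \<Rightarrow> (int \<Rightarrow> real) \<Rightarrow> int \<Rightarrow> real" where
  "absorbed_below l u x = (if x < l then 0 else u x)"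

lemma first_passage_nonneg: "(\<And>x. 0 \<le> u x) \<Longrightarrow> 0 \<le> first_passage u y n x"
  by (induction n arbitrary: x) auto

lemma first_passage_mono:
  "(\<And>x. 0 \<le> u x) \<Longrightarrow> (\<And>x. u x \<le> v x) \<Longrightarrow> first_passage u y n x \<le> first_passage v y n x"
  by (induction n arbitrary: x)
    (auto intro!: mult_mono add_mono add_nonneg_nonneg first_passage_nonneg intro: order_trans)

lemma first_passage_cong:
  "(\<And>z. \<bar>z - x\<bar> \<le> int n \<Longrightarrow> u z = v z) \<Longrightarrow> first_passage u y n x = first_passage v y n x"
proof (induction n arbitrary: x)
  case (Suc n)
  have "first_passage u y n (x + 1) = first_passage v y n (x + 1)"
    "first_passage u y n (x - 1) = first_passage v y n (x - 1)"
    by (rule Suc.IH, rule Suc.prems, simp)+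
  then show ?case using Suc.prems[of x] by simp
qed simp

lemma first_passage_absorbed_sums:
  fixes l :: int
  assumes u: "\<And>x. 0 \<le> u x" "\<And>x. u x \<le> 1 / 2" and k: "k \<le> m"
  defines "a \<equiv> \<lambda>k. u (l + int k)"
  shows "(\<lambda>n. first_passage (absorbed_below l u) (l + int m) n (l + int k)) sums (\<Prod>j\<in>{k..<m}. rho a (Suc j))"
    and "(\<lambda>n. real n * first_passage (absorbed_below l u) (l + int m) n (l + int k))
      sums ((\<Prod>j\<in>{k..<m}. rho a (Suc j)) * (\<Sum>j\<in>{k..<m}. mu a (Suc j)))"
proof -
  define h where "h n k = first_passage (absorbed_below l u) (l + int m) n (l + int k)" for n k
  have a: "admissible a" using u by (simp add: admissible_def a_def)
  have below: "first_passage (absorbed_below l u) (l + int m) n (l - 1) = 0" for n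
    by (cases n) (auto simp: absorbed_below_def)
  have h: "h 0 k = (if k = m then 1 else 0)" "h (Suc n) m = 0"
    "k < m \<Longrightarrow> h (Suc n) k = a k * (h n (Suc k) + (if k = 0 then 0 else h n (k - 1)))" for n k
  proof -
    assume "k < m"
    then show "h (Suc n) k = a k * (h n (Suc k) + (if k = 0 then 0 else h n (k - 1)))"
      using below[of n] by (cases k) (auto simp: h_def absorbed_below_def a_def add_ac)
  qed (auto simp: h_def)
  show "(\<lambda>n. first_passage (absorbed_below l u) (l + int m) n (l + int k)) sums (\<Prod>j\<in>{k..<m}. rho a (Suc j))"
    and "(\<lambda>n. real n * first_passage (absorbed_below l u) (l + int m) n (l + int k))
      sums ((\<Prod>j\<in>{k..<m}. rho a (Suc j)) * (\<Sum>j\<in>{k..<m}. mu a (Suc j)))"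
    using first_passage_sums[of a m h, OF a h k] unfolding h_def by blast+
qed

subsection \<open>The annealed mean hitting time\<close>

lemma entrance_killed_None: "entrance (killed_step v) (Some y) n None = 0"
  by (induction n) (auto simp: killed_step_def nn_integral_return)

lemma entrance_killed_Some:
  assumes "\<And>x. 0 \<le> v x"
  shows "entrance (killed_step v) (Some y) n (Some x) = ennreal (first_passage (\<lambda>x. exp (- v x) / 2) y n x)"
proof (induction n arbitrary: x)
  case (Suc n)
  let ?F = "first_passage (\<lambda>x. exp (- v x) / 2) y n"
  have nn: "0 \<le> ?F z" for z by (intro first_passage_nonneg) simp
  have "(\<integral>\<^sup>+z. entrance (killed_step v) (Some y) n z \<partial>killed_step v (Some x))
      = (entrance (killed_step v) (Some y) n (Some (x + 1)) + entrance (killed_step v) (Some y) n (Some (x - 1))) / 2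
        * ennreal (exp (- v x))"
    using assms[of x]
    by (simp add: killed_step_def nn_integral_pmf_of_set nn_integral_return entrance_killed_None numeral_2_eq_2)
  also have "\<dots> = ennreal (exp (- v x) / 2 * (?F (x + 1) + ?F (x - 1)))"
  proof -
    have "(ennreal a + ennreal b) / 2 * ennreal c = ennreal (c / 2 * (a + b))" if "0 \<le> a" "0 \<le> b" "0 \<le> c" for a b c
    proof -
      have "(ennreal a + ennreal b) / 2 = ennreal ((a + b) / 2)"
        using that by (simp add: ennreal_divide_numeral[symmetric])
      then have "(ennreal a + ennreal b) / 2 * ennreal c = ennreal ((a + b) / 2 * c)"
        by (simp only:) (rule ennreal_mult[symmetric], use that in auto)
      then show ?thesis by (simp add: mult.commute)
    qed
    then show ?thesis unfolding Suc.IH using nn by simp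
  qed
  finally show ?case by simp
qed simp

text \<open>\<open>bernoulli_pmf\<close> clamps its parameter to the unit interval, so this formula
  holds for every real potential. It gives measurability on the whole space, including the null set
  where \<open>V\<close> is outside \<open>{0, M}\<close>.\<close>

lemma pmf_killed_step_eq:
  "pmf (killed_step v (Some x)) z = min 1 (max 0 (exp (- v x))) * pmf (pmf_of_set {Some (x + 1), Some (x - 1)}) z
    + (1 - min 1 (max 0 (exp (- v x)))) * pmf (return_pmf None) z"
proof -
  have "pmf (bernoulli_pmf r) b = (if b then min 1 (max 0 r) else 1 - min 1 (max 0 r))" for r b
    by (simp add: bernoulli_pmf.rep_eq)
  then show ?thesis
    by (simp add: killed_step_def pmf_bind integral_measure_pmf_real[of UNIV] UNIV_bool mult.commute)
qed

lemma suminf_ennreal_commute: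
  fixes f :: "nat \<Rightarrow> nat \<Rightarrow> ennreal"
  shows "(\<Sum>i. \<Sum>j. f i j) = (\<Sum>j. \<Sum>i. f i j)"
  using nn_integral_suminf[of "\<lambda>j i. f i j" "count_space UNIV"] by (simp add: nn_integral_count_space_nat)

context bernoulli_potential
begin

lemma measurable_V [measurable]: "V x \<in> borel_measurable \<Omega>"
  using indep by (auto simp: indep_vars_def2)

lemma AE_V: "AE \<omega> in \<Omega>. \<forall>x. V x \<omega> \<in> {0, M}"
  unfolding AE_all_countable
proof
  fix x
  let ?A = "{\<omega> \<in> space \<Omega>. V x \<omega> = M}" and ?B = "{\<omega> \<in> space \<Omega>. V x \<omega> = 0}"
  have "prob (?A \<union> ?B) = prob ?A + prob ?B"
    using M_pos by (intro finite_measure_Union) auto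
  then have "AE \<omega> in \<Omega>. \<omega> \<in> ?A \<union> ?B"
    by (intro AE_prob_1) (simp add: prob_M prob_0)
  then show "AE \<omega> in \<Omega>. V x \<omega> \<in> {0, M}" by eventually_elim auto
qed

abbreviation quenched_law :: "'w \<Rightarrow> (nat \<Rightarrow> int option) measure" where
  "quenched_law \<omega> \<equiv> quenched (\<lambda>x. V x \<omega>)"

lemma measurable_quenched [measurable]: "quenched_law \<in> \<Omega> \<rightarrow>\<^sub>M subprob_algebra paths"
  unfolding quenched_def
proof (rule measurable_markov_chain)
  fix x z :: "int option"
  show "(\<lambda>\<omega>. pmf (killed_step (\<lambda>x. V x \<omega>) x) z) \<in> borel_measurable \<Omega>"
  proof (cases x)
    case None
    then show ?thesis by (simp add: killed_step_def)
  next
    case (Some x')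
    then show ?thesis unfolding Some pmf_killed_step_eq by measurable
  qed
qed

lemma sets_quenched: "sets (quenched v) = sets paths"
  by (simp add: quenched_def sets_markov_chain)

definition U :: "'w \<Rightarrow> int \<Rightarrow> real" where
  "U \<omega> x = exp (- V x \<omega>) / 2"

text \<open>Almost surely, for \<open>0 < y\<close>, weights 1 give the quenched probability of
  hitting \<open>y\<close>, and weights \<open>real\<close> the quenched mean of the hitting time
  restricted to its being finite.\<close>

definition passage_sum :: "(nat \<Rightarrow> real) \<Rightarrow> nat \<Rightarrow> 'w \<Rightarrow> ennreal" where
  "passage_sum c y \<omega> = (\<Sum>n. ennreal (c n * first_passage (U \<omega>) (int y) n 0))"

lemma emeasure_quenched_hitting_time:
  assumes "0 < y" "\<forall>x. V x \<omega> \<in> {0, M}"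
  shows "emeasure (quenched_law \<omega>) {s. hitting_time (int y) s = enat n} = ennreal (first_passage (U \<omega>) (int y) n 0)"
proof -
  have "0 \<le> V x \<omega>" for x using assms(2)[rule_format, of x] M_pos by auto
  then show ?thesis
    unfolding quenched_def U_def
    using assms(1) by (subst emeasure_hitting_time_eq) (auto intro!: entrance_killed_Some)
qed

lemma hitting_time_sets: "{s. P (hitting_time y s)} \<in> sets (quenched v)"
proof -
  have "hitting_time y -` {t. P t} \<inter> space paths \<in> sets paths"
    by (rule measurable_sets[OF measurable_hitting_time]) auto
  then show ?thesis by (simp add: sets_quenched space_paths vimage_def)
qed

lemma emeasure_quenched_finite:
  assumes "0 < y" "\<forall>x. V x \<omega> \<in> {0, M}"
  shows "emeasure (quenched_law \<omega>) {s. P (hitting_time (int y) s) \<and> hitting_time (int y) s < \<infinity>}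
    = (\<Sum>n. if P (enat n) then ennreal (first_passage (U \<omega>) (int y) n 0) else 0)"
proof -
  define X where "X n = {s. P (hitting_time (int y) s) \<and> hitting_time (int y) s = enat n}" for n
  have "{s. P (hitting_time (int y) s) \<and> hitting_time (int y) s < \<infinity>} = (\<Union>n. X n)"
    by (auto simp: X_def)
  also have "emeasure (quenched_law \<omega>) (\<Union>n. X n) = (\<Sum>n. emeasure (quenched_law \<omega>) (X n))"
  proof (rule suminf_emeasure[symmetric])
    show "range X \<subseteq> sets (quenched_law \<omega>)"
      using hitting_time_sets[of "\<lambda>t. P t \<and> t = enat _"] by (auto simp: X_def)
    show "disjoint_family X" by (auto simp: disjoint_family_on_def X_def)
  qed
  also have "(\<lambda>n. emeasure (quenched_law \<omega>) (X n))
      = (\<lambda>n. if P (enat n) then ennreal (first_passage (U \<omega>) (int y) n 0) else 0)"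
  proof
    fix n
    show "emeasure (quenched_law \<omega>) (X n) = (if P (enat n) then ennreal (first_passage (U \<omega>) (int y) n 0) else 0)"
  proof -
    have "X n = (if P (enat n) then {s. hitting_time (int y) s = enat n} else {})"
      by (auto simp: X_def)
    then show ?thesis using emeasure_quenched_hitting_time[OF assms, of n] by simp
    qed
  qed
  finally show ?thesis .
qed

text \<open>The tail-sum formula, by interchanging two nonnegative sums. Tails are the form in which
  the annealed mean of the \<open>enat\<close>-valued hitting time is computed.\<close>

lemma sum_tails_quenched:
  assumes "0 < y" "\<forall>x. V x \<omega> \<in> {0, M}"
  shows "(\<Sum>t. emeasure (quenched_law \<omega>) {s. enat t < hitting_time (int y) s \<and> hitting_time (int y) s < \<infinity>})
    = passage_sum real y \<omega>"
proof -
  let ?F = "\<lambda>n. first_passage (U \<omega>) (int y) n 0"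
  have F: "0 \<le> ?F n" for n by (intro first_passage_nonneg) (simp add: U_def)
  have "(\<Sum>t. emeasure (quenched_law \<omega>) {s. enat t < hitting_time (int y) s \<and> hitting_time (int y) s < \<infinity>})
      = (\<Sum>t. \<Sum>n. if t < n then ennreal (?F n) else 0)"
    unfolding emeasure_quenched_finite[OF assms, of "\<lambda>h. enat t < h" for t] by simp
  also have "\<dots> = (\<Sum>n. \<Sum>t. if t < n then ennreal (?F n) else 0)"
    by (rule suminf_ennreal_commute)
  also have "(\<lambda>n. \<Sum>t. if t < n then ennreal (?F n) else 0) = (\<lambda>n. ennreal (real n * ?F n))"
  proof
    fix n
    have "(\<Sum>t. if t < n then ennreal (?F n) else 0) = (\<Sum>t<n. ennreal (?F n))"
      by (subst suminf_finite[of "{..<n}"]) auto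
    then show "(\<Sum>t. if t < n then ennreal (?F n) else 0) = ennreal (real n * ?F n)"
      using F by (simp add: ennreal_mult ennreal_of_nat_eq_real_of_nat)
  qed
  finally show ?thesis by (simp add: passage_sum_def)
qed

lemma annealed_slice_sets:
  assumes "B \<in> sets (\<Omega> \<Otimes>\<^sub>M paths)" "\<omega> \<in> space \<Omega>"
  shows "{s. (\<omega>, s) \<in> B \<and> hitting_time y s < \<infinity>} \<in> sets (quenched v)"
proof -
  have "{s. (\<omega>, s) \<in> B \<and> hitting_time y s < \<infinity>} = Pair \<omega> -` B \<inter> {s. hitting_time y s < \<infinity>}" by auto
  moreover have "Pair \<omega> -` B \<in> sets (quenched v)"
    unfolding sets_quenched by (rule sets_Pair1[OF assms(1)])
  ultimately show ?thesis using hitting_time_sets[of "\<lambda>t. t < \<infinity>" y v] by simp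
qed

lemma measurable_annealed_slice:
  assumes B: "B \<in> sets (\<Omega> \<Otimes>\<^sub>M paths)"
  shows "(\<lambda>\<omega>. emeasure (quenched_law \<omega>) {s. (\<omega>, s) \<in> B \<and> hitting_time y s < \<infinity>}) \<in> borel_measurable \<Omega>"
proof (rule emeasure_measurable_subprob_algebra2[OF _ measurable_quenched])
  have "(\<lambda>z. hitting_time y (snd z)) \<in> \<Omega> \<Otimes>\<^sub>M paths \<rightarrow>\<^sub>M count_space UNIV"
    by (rule measurable_compose[OF measurable_snd measurable_hitting_time])
  then have "(\<lambda>z. hitting_time y (snd z)) -` {t. t < \<infinity>} \<inter> space (\<Omega> \<Otimes>\<^sub>M paths) \<in> sets (\<Omega> \<Otimes>\<^sub>M paths)"
    by (rule measurable_sets) auto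
  moreover have "(SIGMA \<omega>:space \<Omega>. {s. (\<omega>, s) \<in> B \<and> hitting_time y s < \<infinity>})
      = B \<inter> ((\<lambda>z. hitting_time y (snd z)) -` {t. t < \<infinity>} \<inter> space (\<Omega> \<Otimes>\<^sub>M paths))"
    using sets.sets_into_space[OF B] by (auto simp: space_pair_measure)
  ultimately show "(SIGMA \<omega>:space \<Omega>. {s. (\<omega>, s) \<in> B \<and> hitting_time y s < \<infinity>}) \<in> sets (\<Omega> \<Otimes>\<^sub>M paths)"
    using B by simp
qed

lemma sets_annealed: "sets (annealed \<Omega> V y) = sets (\<Omega> \<Otimes>\<^sub>M paths)"
  and space_annealed: "space (annealed \<Omega> V y) = space (\<Omega> \<Otimes>\<^sub>M paths)"
  unfolding annealed_def by (simp_all add: sets.space_closed sets.sigma_sets_eq)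

lemma emeasure_annealed:
  assumes "B \<in> sets (\<Omega> \<Otimes>\<^sub>M paths)"
  shows "emeasure (annealed \<Omega> V y) B =
    (\<integral>\<^sup>+\<omega>. emeasure (quenched_law \<omega>) {s. (\<omega>, s) \<in> B \<and> hitting_time (int y) s < \<infinity>} \<partial>\<Omega>)
      / (\<integral>\<^sup>+\<omega>. emeasure (quenched_law \<omega>) {s. hitting_time (int y) s < \<infinity>} \<partial>\<Omega>)"
proof (rule emeasure_measure_of[OF annealed_def])
  show "countably_additive (sets (annealed \<Omega> V y)) (\<lambda>B.
    (\<integral>\<^sup>+\<omega>. emeasure (quenched_law \<omega>) {s. (\<omega>, s) \<in> B \<and> hitting_time (int y) s < \<infinity>} \<partial>\<Omega>)
      / (\<integral>\<^sup>+\<omega>. emeasure (quenched_law \<omega>) {s. hitting_time (int y) s < \<infinity>} \<partial>\<Omega>))"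
  proof (rule countably_additiveI)
    fix A :: "nat \<Rightarrow> ('w \<times> (nat \<Rightarrow> int option)) set"
    assume "range A \<subseteq> sets (annealed \<Omega> V y)" and disj: "disjoint_family A"
    then have A: "A i \<in> sets (\<Omega> \<Otimes>\<^sub>M paths)" for i by (auto simp: sets_annealed)
    let ?f = "\<lambda>B \<omega>. emeasure (quenched_law \<omega>) {s. (\<omega>, s) \<in> B \<and> hitting_time (int y) s < \<infinity>}"
    have "(\<Sum>i. \<integral>\<^sup>+\<omega>. ?f (A i) \<omega> \<partial>\<Omega>) = (\<integral>\<^sup>+\<omega>. (\<Sum>i. ?f (A i) \<omega>) \<partial>\<Omega>)"
      by (intro nn_integral_suminf[symmetric] measurable_annealed_slice A)
    also have "\<dots> = (\<integral>\<^sup>+\<omega>. ?f (\<Union>i. A i) \<omega> \<partial>\<Omega>)"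
    proof (rule nn_integral_cong)
      fix \<omega> assume \<omega>: "\<omega> \<in> space \<Omega>"
      have "(\<Sum>i. ?f (A i) \<omega>) = emeasure (quenched_law \<omega>) (\<Union>i. {s. (\<omega>, s) \<in> A i \<and> hitting_time (int y) s < \<infinity>})"
      proof (rule suminf_emeasure)
        show "range (\<lambda>i. {s. (\<omega>, s) \<in> A i \<and> hitting_time (int y) s < \<infinity>}) \<subseteq> sets (quenched_law \<omega>)"
          using annealed_slice_sets[OF A \<omega>] by blast
        show "disjoint_family (\<lambda>i. {s. (\<omega>, s) \<in> A i \<and> hitting_time (int y) s < \<infinity>})"
          using disj unfolding disjoint_family_on_def by blast
      qed
      also have "(\<Union>i. {s. (\<omega>, s) \<in> A i \<and> hitting_time (int y) s < \<infinity>}) = {s. (\<omega>, s) \<in> (\<Union>i. A i) \<and> hitting_time (int y) s < \<infinity>}"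
        by auto
      finally show "(\<Sum>i. ?f (A i) \<omega>) = ?f (\<Union>i. A i) \<omega>" .
    qed
    finally show "(\<Sum>i. (\<integral>\<^sup>+\<omega>. ?f (A i) \<omega> \<partial>\<Omega>) / (\<integral>\<^sup>+\<omega>. emeasure (quenched_law \<omega>) {s. hitting_time (int y) s < \<infinity>} \<partial>\<Omega>))
        = (\<integral>\<^sup>+\<omega>. ?f (\<Union>i. A i) \<omega> \<partial>\<Omega>) / (\<integral>\<^sup>+\<omega>. emeasure (quenched_law \<omega>) {s. hitting_time (int y) s < \<infinity>} \<partial>\<Omega>)"
      by simp
  qed
  show "positive (sets (annealed \<Omega> V y)) (\<lambda>B.
    (\<integral>\<^sup>+\<omega>. emeasure (quenched_law \<omega>) {s. (\<omega>, s) \<in> B \<and> hitting_time (int y) s < \<infinity>} \<partial>\<Omega>)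
      / (\<integral>\<^sup>+\<omega>. emeasure (quenched_law \<omega>) {s. hitting_time (int y) s < \<infinity>} \<partial>\<Omega>))"
    by (simp add: positive_def)
qed (use assms in \<open>auto simp: sets_annealed sets.space_closed\<close>)

lemma annealed_mean_hitting_time_eq:
  assumes y: "0 < y"
  shows "annealed_mean_hitting_time \<Omega> V y
    = (\<integral>\<^sup>+\<omega>. passage_sum real y \<omega> \<partial>\<Omega>) / (\<integral>\<^sup>+\<omega>. passage_sum (\<lambda>_. 1) y \<omega> \<partial>\<Omega>)"
proof -
  let ?Z = "\<integral>\<^sup>+\<omega>. emeasure (quenched_law \<omega>) {s. hitting_time (int y) s < \<infinity>} \<partial>\<Omega>"
  define f where "f t \<omega> = emeasure (quenched_law \<omega>) {s. enat t < hitting_time (int y) s \<and> hitting_time (int y) s < \<infinity>}" for t \<omega>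
  have meas: "(\<lambda>z. hitting_time (int y) (snd z)) \<in> \<Omega> \<Otimes>\<^sub>M paths \<rightarrow>\<^sub>M count_space UNIV"
    by (rule measurable_compose[OF measurable_snd measurable_hitting_time])
  define B where "B t = {z \<in> space (\<Omega> \<Otimes>\<^sub>M paths). enat t < hitting_time (int y) (snd z)}" for t
  have B: "B t \<in> sets (\<Omega> \<Otimes>\<^sub>M paths)" for t
  proof -
    have "B t = (\<lambda>z. hitting_time (int y) (snd z)) -` {u. enat t < u} \<inter> space (\<Omega> \<Otimes>\<^sub>M paths)"
      by (auto simp: B_def)
    then show ?thesis using measurable_sets[OF meas, of "{u. enat t < u}"] by simp
  qed
  have slice: "emeasure (quenched_law \<omega>) {s. (\<omega>, s) \<in> B t \<and> hitting_time (int y) s < \<infinity>} = f t \<omega>"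
    if "\<omega> \<in> space \<Omega>" for t \<omega>
    using that by (simp add: B_def f_def space_pair_measure space_paths)
  have f: "f t \<in> borel_measurable \<Omega>" for t
    using measurable_annealed_slice[OF B, of t "int y"]
    by (subst measurable_cong[OF slice, symmetric]) auto
  have "annealed_mean_hitting_time \<Omega> V y = (\<Sum>t. emeasure (annealed \<Omega> V y) (B t))"
    unfolding annealed_mean_hitting_time_def B_def
    using meas by (subst nn_integral_enat_function) (auto simp: space_annealed measurable_cong_sets[OF sets_annealed refl])
  also have "\<dots> = (\<Sum>t. (\<integral>\<^sup>+\<omega>. f t \<omega> \<partial>\<Omega>) / ?Z)"
  proof -
    have "(\<integral>\<^sup>+\<omega>. emeasure (quenched_law \<omega>) {s. (\<omega>, s) \<in> B t \<and> hitting_time (int y) s < \<infinity>} \<partial>\<Omega>)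
        = (\<integral>\<^sup>+\<omega>. f t \<omega> \<partial>\<Omega>)" for t
      by (intro nn_integral_cong slice)
    then show ?thesis unfolding emeasure_annealed[OF B] by (simp only:)
  qed
  also have "\<dots> = (\<integral>\<^sup>+\<omega>. (\<Sum>t. f t \<omega>) \<partial>\<Omega>) / ?Z"
    using f by (simp add: nn_integral_suminf)
  also have "(\<integral>\<^sup>+\<omega>. (\<Sum>t. f t \<omega>) \<partial>\<Omega>) = (\<integral>\<^sup>+\<omega>. passage_sum real y \<omega> \<partial>\<Omega>)"
  proof (rule nn_integral_cong_AE)
    show "AE \<omega> in \<Omega>. (\<Sum>t. f t \<omega>) = passage_sum real y \<omega>"
      using AE_V
    proof eventually_elim
      case (elim \<omega>)
      then show ?case unfolding f_def by (rule sum_tails_quenched[OF y])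
    qed
  qed
  also have "?Z = (\<integral>\<^sup>+\<omega>. passage_sum (\<lambda>_. 1) y \<omega> \<partial>\<Omega>)"
  proof (rule nn_integral_cong_AE)
    show "AE \<omega> in \<Omega>. emeasure (quenched_law \<omega>) {s. hitting_time (int y) s < \<infinity>} = passage_sum (\<lambda>_. 1) y \<omega>"
      using AE_V
    proof eventually_elim
      case (elim \<omega>)
      then show ?case
        using emeasure_quenched_finite[OF y, of \<omega> "\<lambda>_. True"] by (simp add: passage_sum_def)
    qed
  qed
  finally show ?thesis .
qed

end

subsection \<open>The annealed speed\<close>

locale proper_bernoulli_potential = bernoulli_potential +
  assumes p_less_1: "p < 1"
begin

sublocale trap_model "1 - p" "exp (- M)"
  using p_pos p_less_1 M_pos by unfold_locales auto

text \<open>The window with left end \<open>- N\<close> is renumbered from 0, so that the start 0 of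
  the walk becomes index \<open>N\<close> and the target \<open>y\<close> becomes index
  \<open>N + y\<close>.\<close>

definition free_sites :: "nat \<Rightarrow> nat \<Rightarrow> 'a \<Rightarrow> nat set" where
  "free_sites N n \<omega> = {k. k < n \<and> V (int k - int N) \<omega> = 0}"

lemma free_sites_set: "{\<omega> \<in> space \<Omega>. free_sites N n \<omega> = B} \<in> sets \<Omega>"
proof -
  have "{\<omega> \<in> space \<Omega>. free_sites N n \<omega> = B}
      = {\<omega> \<in> space \<Omega>. \<forall>k. (k < n \<and> V (int k - int N) \<omega> = 0) \<longleftrightarrow> k \<in> B}"
    by (auto simp: free_sites_def)
  also have "\<dots> \<in> sets \<Omega>" by measurable
  finally show ?thesis .
qed

lemma prob_free_sites:
  assumes B: "B \<subseteq> {..<n}"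
  shows "prob {\<omega> \<in> space \<Omega>. free_sites N n \<omega> = B} = wt n B"
proof (cases "n = 0")
  case True
  then show ?thesis using B by (simp add: free_sites_def wt_def prob_space)
next
  case False
  define A where "A i = (if nat (i + int N) \<in> B then {0} else {M})" for i
  define J where "J = (\<lambda>k. int k - int N) ` {..<n}"
  have "prob {\<omega> \<in> space \<Omega>. free_sites N n \<omega> = B} = prob (\<Inter>i\<in>J. V i -` A i \<inter> space \<Omega>)"
  proof (rule measure_eq_AE)
    show "AE \<omega> in \<Omega>. \<omega> \<in> {\<omega> \<in> space \<Omega>. free_sites N n \<omega> = B} \<longleftrightarrow> \<omega> \<in> (\<Inter>i\<in>J. V i -` A i \<inter> space \<Omega>)"
      using AE_V AE_space
    proof eventually_elim
      case (elim \<omega>)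
      have "free_sites N n \<omega> = B \<longleftrightarrow> (\<forall>k<n. V (int k - int N) \<omega> = 0 \<longleftrightarrow> k \<in> B)"
        using B by (auto simp: free_sites_def)
      also have "\<dots> \<longleftrightarrow> (\<forall>k<n. V (int k - int N) \<omega> \<in> A (int k - int N))"
        using elim(1) M_pos by (auto simp: A_def)
      finally show ?case using elim(2) False by (auto simp: J_def)
    qed
    show "(\<Inter>i\<in>J. V i -` A i \<inter> space \<Omega>) \<in> sets \<Omega>"
      using False by (intro sets.finite_INT measurable_sets[OF measurable_V]) (auto simp: J_def A_def)
  qed (rule free_sites_set)
  also have "\<dots> = (\<Prod>i\<in>J. prob (V i -` A i \<inter> space \<Omega>))"
    by (rule indep_varsD[OF indep]) (use False in \<open>auto simp: J_def A_def\<close>)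
  also have "\<dots> = (\<Prod>k<n. prob (V (int k - int N) -` A (int k - int N) \<inter> space \<Omega>))"
    unfolding J_def by (subst prod.reindex) (auto simp: inj_on_def)
  also have "\<dots> = wt n B"
    unfolding wt_def
  proof (intro prod.cong refl)
    fix k
    have "V x -` {a} \<inter> space \<Omega> = {\<omega> \<in> space \<Omega>. V x \<omega> = a}" for x a by auto
    then show "prob (V (int k - int N) -` A (int k - int N) \<inter> space \<Omega>) = (if k \<in> B then 1 - p else 1 - (1 - p))"
      by (simp add: A_def prob_M prob_0)
  qed
  finally show ?thesis .
qed

lemma nn_integral_free_sites:
  assumes "\<And>B. 0 \<le> G B"
  shows "(\<integral>\<^sup>+\<omega>. ennreal (G (free_sites N n \<omega>)) \<partial>\<Omega>) = ennreal (expect n G)"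
proof -
  let ?E = "\<lambda>B. {\<omega> \<in> space \<Omega>. free_sites N n \<omega> = B}"
  have "(\<integral>\<^sup>+\<omega>. ennreal (G (free_sites N n \<omega>)) \<partial>\<Omega>)
      = (\<integral>\<^sup>+\<omega>. (\<Sum>B\<in>Pow {..<n}. ennreal (G B) * indicator (?E B) \<omega>) \<partial>\<Omega>)"
  proof (rule nn_integral_cong)
    fix \<omega> assume \<omega>: "\<omega> \<in> space \<Omega>"
    have "(\<Sum>B\<in>Pow {..<n}. ennreal (G B) * indicator (?E B) \<omega>)
        = (\<Sum>B\<in>Pow {..<n}. if B = free_sites N n \<omega> then ennreal (G B) else 0)"
      using \<omega> by (intro sum.cong) (auto simp: indicator_def)
    also have "\<dots> = ennreal (G (free_sites N n \<omega>))"
      by (subst sum.delta) (auto simp: free_sites_def)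
    finally show "ennreal (G (free_sites N n \<omega>)) = (\<Sum>B\<in>Pow {..<n}. ennreal (G B) * indicator (?E B) \<omega>)" ..
  qed
  also have "\<dots> = (\<Sum>B\<in>Pow {..<n}. \<integral>\<^sup>+\<omega>. ennreal (G B) * indicator (?E B) \<omega> \<partial>\<Omega>)"
    using free_sites_set[measurable] by (intro nn_integral_sum) measurable
  also have "\<dots> = (\<Sum>B\<in>Pow {..<n}. ennreal (G B) * emeasure \<Omega> (?E B))"
    by (intro sum.cong refl nn_integral_cmult_indicator free_sites_set)
  also have "\<dots> = (\<Sum>B\<in>Pow {..<n}. ennreal (wt n B * G B))"
    using assms less_imp_le[OF wt_pos]
    by (intro sum.cong refl) (auto simp: emeasure_eq_measure prob_free_sites ennreal_mult mult.commute)
  also have "\<dots> = ennreal (expect n G)"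
    unfolding expect_def using assms less_imp_le[OF wt_pos] by (intro sum_ennreal) auto
  finally show ?thesis .
qed

definition absorbed_sum :: "(nat \<Rightarrow> real) \<Rightarrow> nat \<Rightarrow> nat \<Rightarrow> 'a \<Rightarrow> ennreal" where
  "absorbed_sum c y N \<omega> = (\<Sum>n. ennreal (c n * first_passage (absorbed_below (- int N) (U \<omega>)) (int y) n 0))"

lemma U_nonneg: "0 \<le> U \<omega> x"
  by (simp add: U_def)

lemma absorbed_below_U_nonneg: "0 \<le> absorbed_below l (U \<omega>) x"
  by (simp add: absorbed_below_def U_nonneg)

lemma measurable_absorbed_sum: "absorbed_sum c y N \<in> borel_measurable \<Omega>"
proof -
  have [measurable]: "(\<lambda>\<omega>. absorbed_below l (U \<omega>) x) \<in> borel_measurable \<Omega>" for l x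
    unfolding absorbed_below_def U_def by measurable
  have [measurable]: "(\<lambda>\<omega>. first_passage (absorbed_below l (U \<omega>)) z n x) \<in> borel_measurable \<Omega>" for l z n x
    by (induction n arbitrary: x) simp_all
  show ?thesis unfolding absorbed_sum_def by measurable
qed

text \<open>Lowering the barrier only adds paths, so the sums increase in \<open>N\<close>. Monotone
  convergence passes through the series because every single term converges increasingly.\<close>

lemma
  assumes "\<And>n. 0 \<le> c n"
  shows incseq_absorbed_sum: "incseq (absorbed_sum c y)"
    and passage_sum_eq_SUP: "passage_sum c y \<omega> = (SUP N. absorbed_sum c y N \<omega>)"
proof -
  let ?t = "\<lambda>N n \<omega>. ennreal (c n * first_passage (absorbed_below (- int N) (U \<omega>)) (int y) n 0)"
  have mono: "?t N n \<omega> \<le> ?t N' n \<omega>" if "N \<le> N'" for N N' n \<omega>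
    using that assms
    by (intro ennreal_leI mult_left_mono first_passage_mono absorbed_below_U_nonneg)
      (auto simp: absorbed_below_def U_nonneg)
  then show "incseq (absorbed_sum c y)"
    unfolding absorbed_sum_def by (intro incseq_SucI le_funI suminf_le mono) auto
  have "ennreal (c n * first_passage (U \<omega>) (int y) n 0) = (SUP N. ?t N n \<omega>)" for n
  proof (rule antisym)
    \<comment> \<open>In \<open>n\<close> steps the walk cannot go below \<open>- n\<close>, so the
      barrier at \<open>- n\<close> is not felt and the supremum is attained.\<close>
    have "first_passage (U \<omega>) (int y) n 0 = first_passage (absorbed_below (- int n) (U \<omega>)) (int y) n 0"
      by (rule first_passage_cong) (auto simp: absorbed_below_def)
    then show "ennreal (c n * first_passage (U \<omega>) (int y) n 0) \<le> (SUP N. ?t N n \<omega>)"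
      using SUP_upper[of n UNIV "\<lambda>N. ?t N n \<omega>"] by simp
    show "(SUP N. ?t N n \<omega>) \<le> ennreal (c n * first_passage (U \<omega>) (int y) n 0)"
      using assms
      by (intro SUP_least ennreal_leI mult_left_mono first_passage_mono absorbed_below_U_nonneg)
        (auto simp: absorbed_below_def U_nonneg)
  qed
  moreover have "incseq (\<lambda>N. ?t N n \<omega>)" for n
    using mono by (auto simp: incseq_def)
  ultimately show "passage_sum c y \<omega> = (SUP N. absorbed_sum c y N \<omega>)"
    unfolding passage_sum_def absorbed_sum_def by (simp add: ennreal_suminf_SUP_eq)
qed

lemma nn_integral_passage_sum:
  assumes c: "\<And>n. 0 \<le> c n" and G: "\<And>N B. 0 \<le> G N B"
    and eq: "\<And>N \<omega>. \<forall>x. V x \<omega> \<in> {0, M} \<Longrightarrow> absorbed_sum c y N \<omega> = ennreal (G N (free_sites N (N + y) \<omega>))"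
  shows "(\<integral>\<^sup>+\<omega>. passage_sum c y \<omega> \<partial>\<Omega>) = (SUP N. ennreal (expect (N + y) (G N)))"
proof -
  have "(\<integral>\<^sup>+\<omega>. passage_sum c y \<omega> \<partial>\<Omega>) = (SUP N. \<integral>\<^sup>+\<omega>. absorbed_sum c y N \<omega> \<partial>\<Omega>)"
    unfolding passage_sum_eq_SUP[OF c]
    by (rule nn_integral_monotone_convergence_SUP[OF incseq_absorbed_sum[OF c] measurable_absorbed_sum])
  moreover have "(\<integral>\<^sup>+\<omega>. absorbed_sum c y N \<omega> \<partial>\<Omega>) = ennreal (expect (N + y) (G N))" for N
  proof -
    have "(\<integral>\<^sup>+\<omega>. absorbed_sum c y N \<omega> \<partial>\<Omega>) = (\<integral>\<^sup>+\<omega>. ennreal (G N (free_sites N (N + y) \<omega>)) \<partial>\<Omega>)"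
      using AE_V by (intro nn_integral_cong_AE) (auto elim!: eventually_mono intro!: eq)
    also have "\<dots> = ennreal (expect (N + y) (G N))"
      by (rule nn_integral_free_sites[OF G])
    finally show ?thesis .
  qed
  ultimately show ?thesis by simp
qed

lemma absorbed_sum_eq:
  assumes "\<forall>x. V x \<omega> \<in> {0, M}"
  defines "B N y \<equiv> free_sites N (N + y) \<omega>"
  shows "absorbed_sum (\<lambda>_. 1) y N \<omega> = ennreal (W N (N + y) (B N y))"
    and "absorbed_sum real y N \<omega> = ennreal (W N (N + y) (B N y) * (\<Sum>k\<in>{N..<N + y}. mu (env (B N y)) (Suc k)))"
proof -
  define a where "a k = U \<omega> (- int N + int k)" for k
  have U: "0 \<le> U \<omega> x" "U \<omega> x \<le> 1 / 2" for x
    using assms(1)[rule_format, of x] M_pos by (auto simp: U_def)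
  have a: "a k = env (B N y) k" if "k < N + y" for k
  proof -
    have "- int N + int k = int k - int N" by simp
    then show ?thesis
      using that assms(1)[rule_format, of "int k - int N"] M_pos
      by (auto simp: a_def env_def B_def free_sites_def U_def)
  qed
  have W: "(\<Prod>j\<in>{N..<N + y}. rho a (Suc j)) = W N (N + y) (B N y)"
    unfolding W_def by (intro prod.cong refl rho_cong a) auto
  have mu: "(\<Sum>j\<in>{N..<N + y}. mu a (Suc j)) = (\<Sum>j\<in>{N..<N + y}. mu (env (B N y)) (Suc j))"
    by (intro sum.cong refl mu_cong a) auto
  have l: "- int N + int (N + y) = int y" "- int N + int N = 0" "(\<lambda>k. U \<omega> (- int N + int k)) = a"
    by (auto simp: a_def)
  note sums = first_passage_absorbed_sums[of "U \<omega>" N "N + y" "- int N", OF U le_add1, unfolded l W mu]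
  have nn: "0 \<le> first_passage (absorbed_below (- int N) (U \<omega>)) (int y) n 0" for n
    by (intro first_passage_nonneg absorbed_below_U_nonneg)
  show "absorbed_sum (\<lambda>_. 1) y N \<omega> = ennreal (W N (N + y) (B N y))"
    using suminf_ennreal_eq[OF nn sums(1)] by (simp add: absorbed_sum_def)
  show "absorbed_sum real y N \<omega> = ennreal (W N (N + y) (B N y) * (\<Sum>k\<in>{N..<N + y}. mu (env (B N y)) (Suc k)))"
    unfolding absorbed_sum_def by (rule suminf_ennreal_eq[OF _ sums(2)]) (use nn in simp)
qed

text \<open>For each barrier \<open>- N\<close> the numerator is \<open>z N\<close> times a sum of
  tilted delays, which is squeezed between bounds independent of \<open>N\<close>. The inequalities
  between \<open>a N\<close> and \<open>z N\<close> therefore survive taking suprema in numerator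
  and denominator separately.\<close>

lemma annealed_mean_hitting_time_bounds:
  assumes y: "0 < y" and L: "\<And>i j. 0 < j \<Longrightarrow> speed_inv i j \<le> L"
  shows "ennreal (\<Sum>k<y. speed_inv k (y - k)) \<le> annealed_mean_hitting_time \<Omega> V y"
    and "annealed_mean_hitting_time \<Omega> V y \<le> ennreal (real y * L)"
proof -
  define z where "z N = expect (N + y) (W N (N + y))" for N
  define a where "a N = expect (N + y) (\<lambda>B. W N (N + y) B * (\<Sum>k\<in>{N..<N + y}. mu (env B) (Suc k)))" for N
  let ?s = "\<Sum>k<y. speed_inv k (y - k)"
  have z_pos: "0 < z N" for N unfolding z_def by (rule expect_W_pos)
  have a: "a N = (\<Sum>k<y. tilted N (N + (k + (y - k))) (\<lambda>B. mu (env B) (Suc (N + k)))) * z N" for N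
  proof -
    have "(\<Sum>k<y. tilted N (N + (k + (y - k))) (\<lambda>B. mu (env B) (Suc (N + k))))
        = (\<Sum>k<y. tilted N (N + y) (\<lambda>B. mu (env B) (Suc (N + k))))"
      by (intro sum.cong) auto
    also have "\<dots> = tilted N (N + y) (\<lambda>B. \<Sum>k<y. mu (env B) (Suc (N + k)))"
      by (rule tilted_sum[symmetric])
    also have "(\<lambda>B. \<Sum>k<y. mu (env B) (Suc (N + k))) = (\<lambda>B. \<Sum>k\<in>{N..<N + y}. mu (env B) (Suc k))"
      by (intro ext sum.reindex_bij_witness[of _ "\<lambda>k. k - N" "\<lambda>k. N + k"]) auto
    finally show ?thesis
      using z_pos[of N] unfolding tilted_def z_def[symmetric] a_def[symmetric] by simp
  qed
  have lower: "?s * z N \<le> a N" for N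
    unfolding a using z_pos[of N] by (intro mult_right_mono sum_mono speed_inv_le_tilted) auto
  have upper: "a N \<le> real y * L * z N" for N
  proof -
    have "(\<Sum>k<y. tilted N (N + (k + (y - k))) (\<lambda>B. mu (env B) (Suc (N + k)))) \<le> (\<Sum>k<y. L)"
      by (intro sum_mono order_trans[OF tilted_le_speed_inv L]) auto
    then show ?thesis
      unfolding a using z_pos[of N] by (intro mult_right_mono) auto
  qed
  have z_le: "z N \<le> 1" for N
    using expect_mono[of "N + y" "W N (N + y)" "\<lambda>_. 1"] W_le_1 by (simp add: z_def)
  have s_nonneg: "0 \<le> ?s"
    unfolding speed_inv_def tilted_def
    by (intro sum_nonneg divide_nonneg_pos expect_W_pos expect_nonneg mult_nonneg_nonneg mu_nonneg admissible_env less_imp_le[OF W_pos])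
  have "0 \<le> speed_inv 0 y"
    unfolding speed_inv_def tilted_def
    by (intro divide_nonneg_pos expect_W_pos expect_nonneg mult_nonneg_nonneg mu_nonneg admissible_env less_imp_le[OF W_pos])
  then have L_nonneg: "0 \<le> L" using L[OF y, of 0] by simp
  have Z: "(\<integral>\<^sup>+\<omega>. passage_sum (\<lambda>_. 1) y \<omega> \<partial>\<Omega>) = (SUP N. ennreal (z N))"
    unfolding z_def
    by (rule nn_integral_passage_sum) (auto simp: absorbed_sum_eq intro: less_imp_le[OF W_pos])
  have A: "(\<integral>\<^sup>+\<omega>. passage_sum real y \<omega> \<partial>\<Omega>) = (SUP N. ennreal (a N))"
    unfolding a_def
    by (rule nn_integral_passage_sum)
      (auto simp: absorbed_sum_eq simp del: mu.simps
        intro!: mult_nonneg_nonneg sum_nonneg mu_nonneg less_imp_le[OF W_pos])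
  have mean: "annealed_mean_hitting_time \<Omega> V y = (SUP N. ennreal (a N)) / (SUP N. ennreal (z N))"
    unfolding annealed_mean_hitting_time_eq[OF y] Z A ..
  have Z_pos: "0 < (SUP N. ennreal (z N))"
    using z_pos[of 0] by (intro less_SUP_iff[THEN iffD2] bexI[of _ 0]) auto
  have "(SUP N. ennreal (z N)) \<le> 1"
    by (intro SUP_least) (use z_le in \<open>simp add: ennreal_le_1\<close>)
  then have Z_fin: "(SUP N. ennreal (z N)) < top"
    by (rule order.strict_trans1) simp
  have "ennreal ?s * (SUP N. ennreal (z N)) = (SUP N. ennreal ?s * ennreal (z N))"
    by (simp add: SUP_mult_left_ennreal)
  also have "\<dots> \<le> (SUP N. ennreal (a N))"
    using lower s_nonneg z_pos by (intro SUP_mono) (auto simp: ennreal_mult[symmetric] less_imp_le intro!: ennreal_leI)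
  finally have "ennreal ?s * (SUP N. ennreal (z N)) / (SUP N. ennreal (z N)) \<le> annealed_mean_hitting_time \<Omega> V y"
    unfolding mean by (rule divide_right_mono_ennreal)
  then show "ennreal ?s \<le> annealed_mean_hitting_time \<Omega> V y"
    unfolding mult_divide_eq_ennreal[OF Z_pos[unfolded zero_less_iff_neq_zero] less_imp_neq[OF Z_fin]] .
  have "(SUP N. ennreal (a N)) \<le> (SUP N. ennreal (real y * L) * ennreal (z N))"
    using upper L_nonneg z_pos by (intro SUP_mono) (auto simp: ennreal_mult[symmetric] less_imp_le intro!: ennreal_leI)
  also have "\<dots> = ennreal (real y * L) * (SUP N. ennreal (z N))"
    by (simp add: SUP_mult_left_ennreal)
  finally show "annealed_mean_hitting_time \<Omega> V y \<le> ennreal (real y * L)"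
    unfolding mean using Z_pos by (intro divide_le_posI_ennreal) (auto simp: mult.commute)
qed

end

context proper_bernoulli_potential
begin

text \<open>By monotonicity of \<open>speed_inv\<close> in both margins, the Cesaro averages converge to its supremum.\<close>

lemma annealed_speed_lub:
  assumes C: "\<And>i j. 0 < j \<Longrightarrow> speed_inv i j \<le> C"
  obtains L where "annealed_speed \<Omega> V = 1 / L" "\<forall>i j. 0 < j \<longrightarrow> speed_inv i j \<le> L"
    "\<forall>L'. (\<forall>i j. 0 < j \<longrightarrow> speed_inv i j \<le> L') \<longrightarrow> L \<le> L'"
proof -
  define S where "S = {speed_inv i j |i j. 0 < j}"
  have S: "S \<noteq> {}" "bdd_above S"
    using C by (auto simp: S_def bdd_above_def)
  define L where "L = Sup S"
  have L: "speed_inv i j \<le> L" if "0 < j" for i j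
    unfolding L_def using that S by (intro cSup_upper) (auto simp: S_def)
  have nonneg: "0 \<le> speed_inv i j" for i j
    unfolding speed_inv_def tilted_def
    by (intro divide_nonneg_pos expect_W_pos expect_nonneg mult_nonneg_nonneg mu_nonneg admissible_env less_imp_le[OF W_pos])
  define s where "s y = (\<Sum>k<y. speed_inv k (y - k)) / real y" for y
  have s_le: "s y \<le> L" if "0 < y" for y
  proof -
    have "(\<Sum>k<y. speed_inv k (y - k)) \<le> (\<Sum>k<y. L)"
      by (intro sum_mono L) auto
    then show ?thesis using that by (simp add: s_def divide_le_eq mult.commute)
  qed
  \<comment> \<open>All but \<open>i + j\<close> of the sites have at least \<open>i\<close> sites
    to their left and at least \<open>j\<close> from themselves onwards; for these, monotonicity in
    both margins applies.\<close>
  have s_ge: "(1 - real (i + j) / real y) * speed_inv i j \<le> s y" if "0 < j" "0 < y" for i j y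
  proof -
    have "(real y - real (i + j)) * speed_inv i j \<le> real (card {i..<y - j}) * speed_inv i j"
      by (intro mult_right_mono nonneg) (simp add: of_nat_diff_real)
    also have "\<dots> = (\<Sum>k\<in>{i..<y - j}. speed_inv i j)"
      by simp
    also have "\<dots> \<le> (\<Sum>k\<in>{i..<y - j}. speed_inv k (y - k))"
      using that by (intro sum_mono speed_inv_mono) auto
    also have "\<dots> \<le> (\<Sum>k<y. speed_inv k (y - k))"
      by (intro sum_mono2 nonneg) auto
    finally have "(real y - real (i + j)) * speed_inv i j / real y \<le> s y"
      unfolding s_def by (rule divide_right_mono) simp
    moreover have "1 - real (i + j) / real y = (real y - real (i + j)) / real y"
      using that by (simp add: field_simps)
    ultimately show ?thesis by simp
  qed
  have lim: "s \<longlonglongrightarrow> L"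
  proof (rule order_tendstoI)
    fix a assume "a < L"
    then obtain i j where ij: "0 < j" "a < speed_inv i j"
      unfolding L_def using less_cSup_iff[OF S] by (auto simp: S_def)
    have "(\<lambda>y. (1 - real (i + j) / real y) * speed_inv i j) \<longlonglongrightarrow> (1 - 0) * speed_inv i j"
      by (intro tendsto_intros lim_const_over_n)
    then have "eventually (\<lambda>y. a < (1 - real (i + j) / real y) * speed_inv i j) sequentially"
      using ij(2) by (intro order_tendstoD(1)) auto
    with eventually_gt_at_top[of 0] show "eventually (\<lambda>y. a < s y) sequentially"
      by eventually_elim (use s_ge[OF ij(1)] in \<open>blast intro: less_le_trans\<close>)
  next
    fix a assume "L < a"
    show "eventually (\<lambda>y. s y < a) sequentially"
      using eventually_gt_at_top[of 0]
    proof eventually_elim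
      case (elim y)
      then show ?case using s_le[of y] \<open>L < a\<close> by simp
    qed
  qed
  have "(\<lambda>y. annealed_mean_hitting_time \<Omega> V y / of_nat y) \<longlonglongrightarrow> ennreal L"
  proof (rule tendsto_sandwich)
    show "(\<lambda>y. ennreal (s y)) \<longlonglongrightarrow> ennreal L"
      using lim by (rule tendsto_ennrealI)
    have div: "ennreal x / of_nat y = ennreal (x / real y)" if "0 < y" "0 \<le> x" for x y
      using that by (simp add: divide_ennreal ennreal_of_nat_eq_real_of_nat)
    have L0: "0 \<le> L" using L[of 1 0] nonneg[of 0 1] by simp
    show "eventually (\<lambda>y. ennreal (s y) \<le> annealed_mean_hitting_time \<Omega> V y / of_nat y) sequentially"
      using eventually_gt_at_top[of 0]
    proof eventually_elim
      case (elim y)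
      have "ennreal (s y) = ennreal (\<Sum>k<y. speed_inv k (y - k)) / of_nat y"
        unfolding s_def using elim by (intro div[symmetric] sum_nonneg nonneg)
      then show ?case
        using annealed_mean_hitting_time_bounds(1)[OF elim L] by (simp add: divide_right_mono_ennreal)
    qed
    show "eventually (\<lambda>y. annealed_mean_hitting_time \<Omega> V y / of_nat y \<le> ennreal L) sequentially"
      using eventually_gt_at_top[of 0]
    proof eventually_elim
      case (elim y)
      have "annealed_mean_hitting_time \<Omega> V y / of_nat y \<le> ennreal (real y * L) / of_nat y"
        by (rule divide_right_mono_ennreal[OF annealed_mean_hitting_time_bounds(2)[OF elim L]])
      also have "\<dots> = ennreal L" using elim L0 by (subst div) auto
      finally show ?case .
    qed
  qed simp
  then have "lim (\<lambda>y. annealed_mean_hitting_time \<Omega> V y / of_nat y) = ennreal L"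
    by (rule limI)
  moreover have "0 \<le> L" using L[of 1 0] nonneg[of 0 1] by simp
  ultimately have "annealed_speed \<Omega> V = 1 / L"
    by (simp add: annealed_speed_def)
  moreover have "\<forall>L'. (\<forall>i j. 0 < j \<longrightarrow> speed_inv i j \<le> L') \<longrightarrow> L \<le> L'"
    unfolding L_def using S(1) by (auto intro!: cSup_least simp: S_def)
  ultimately show ?thesis using L by (intro that[of L]) auto
qed

lemma D_eq: "D = 2 * (1 - p) * (exp M - 1) / p"
proof -
  have "exp (- M) \<noteq> 1" using M_pos by simp
  then show ?thesis
    unfolding D_def \<kappa>_def using p_pos by (simp add: exp_minus field_simps)
qed

end

text \<open>The inverse speed is the least upper bound of \<open>speed_inv\<close>, so both
  exponential bounds transfer to it. The constant \<open>M\<^sub>0\<close> enters through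
  \<open>e \<le> exp (- M\<^sub>0)\<close> in the upper bound for \<open>speed_inv\<close>.\<close>

lemma log_speed_asymptotics:
  fixes M\<^sub>0 \<epsilon> :: real
  assumes M\<^sub>0: "0 < M\<^sub>0" and \<epsilon>: "0 < \<epsilon>" "\<epsilon> \<le> 1"
  obtains D\<^sub>0 where "0 < D\<^sub>0" "\<And>(\<Omega> :: 'w measure) V p M. bernoulli_potential \<Omega> V p M \<Longrightarrow> p < 1 \<Longrightarrow> M\<^sub>0 \<le> M \<Longrightarrow>
    D\<^sub>0 \<le> 2 * (1 - p) * (exp M - 1) / p \<Longrightarrow>
    \<bar>- ln (annealed_speed \<Omega> V) / (2 * (1 - p) * (exp M - 1) / p) - 1\<bar> \<le> \<epsilon>"
proof -
  have e\<^sub>0: "exp (- M\<^sub>0) < 1" using M\<^sub>0 by simp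
  obtain D1 where D1: "\<And>q e i j. trap_model q e \<Longrightarrow> e \<le> exp (- M\<^sub>0) \<Longrightarrow> D1 \<le> trap_model.D q e \<Longrightarrow> 0 < j \<Longrightarrow>
      trap_model.speed_inv q e i j \<le> exp ((1 + \<epsilon>) * trap_model.D q e)"
    by (rule speed_inv_le_exp[OF exp_gt_zero e\<^sub>0 \<epsilon>(1)]) (erule that)
  obtain D2 where D2: "\<And>q e L. trap_model q e \<Longrightarrow> D2 \<le> trap_model.D q e \<Longrightarrow>
      (\<And>i j. 0 < j \<Longrightarrow> trap_model.speed_inv q e i j \<le> L) \<Longrightarrow> exp ((1 - \<epsilon>) * trap_model.D q e) \<le> L"
    by (rule exp_le_speed_inv_bound[OF \<epsilon>]) (erule that)
  show ?thesis
  proof (rule that[of "max 1 (max D1 D2)"])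
    fix \<Omega> :: "'w measure" and V p M
    assume "bernoulli_potential \<Omega> V p M" and p: "p < 1" and M: "M\<^sub>0 \<le> M"
      and large: "max 1 (max D1 D2) \<le> 2 * (1 - p) * (exp M - 1) / p"
    then interpret proper_bernoulli_potential \<Omega> V p M
      by (intro proper_bernoulli_potential.intro) (auto intro: proper_bernoulli_potential_axioms.intro)
    note model = trap_model_axioms
    have D: "D1 \<le> D" "D2 \<le> D" "0 < D" using large unfolding D_eq by auto
    have upper: "speed_inv i j \<le> exp ((1 + \<epsilon>) * D)" if "0 < j" for i j
      by (rule D1[OF model _ D(1) that]) (use M in simp)
    obtain L where L: "annealed_speed \<Omega> V = 1 / L" "\<forall>i j. 0 < j \<longrightarrow> speed_inv i j \<le> L"
      and least: "\<forall>L'. (\<forall>i j. 0 < j \<longrightarrow> speed_inv i j \<le> L') \<longrightarrow> L \<le> L'"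
      by (rule annealed_speed_lub[OF upper]) (assumption, rule that)
    have L_le: "L \<le> exp ((1 + \<epsilon>) * D)" using least upper by blast
    have lower: "exp ((1 - \<epsilon>) * D) \<le> L" by (rule D2[OF model D(2)]) (use L(2) in blast)
    then have L_pos: "0 < L" by (rule less_le_trans[OF exp_gt_zero])
    have "ln L \<le> ln (exp ((1 + \<epsilon>) * D))" using L_le L_pos by (intro ln_mono) auto
    then have "ln L / D \<le> 1 + \<epsilon>" using D(3) by (simp add: divide_le_eq)
    moreover have "(1 - \<epsilon>) * D \<le> ln L" using lower L_pos by (simp add: ln_ge_iff)
    then have "1 - \<epsilon> \<le> ln L / D" using D(3) by (simp add: le_divide_eq)
    ultimately have "\<bar>ln L / D - 1\<bar> \<le> \<epsilon>" by (simp add: abs_le_iff)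
    then show "\<bar>- ln (annealed_speed \<Omega> V) / (2 * (1 - p) * (exp M - 1) / p) - 1\<bar> \<le> \<epsilon>"
      unfolding D_eq[symmetric] L(1) using L_pos by (simp add: ln_div)
  qed simp
qed

text \<open>Changes the normalisation from \<open>D\<close> to the simpler denominators of the two
  regimes, with \<open>c = 1 - p\<close> as p tends to 0 and \<open>c = 1 - exp (- M)\<close> as M
  tends to infinity.\<close>

lemma abs_mult_diff_less:
  fixes r c \<epsilon> :: real
  assumes "\<bar>r - 1\<bar> \<le> \<epsilon> / 3" "0 \<le> c" "c \<le> 1" "1 - c < \<epsilon> / 3" "0 < \<epsilon>"
  shows "\<bar>r * c - 1\<bar> < \<epsilon>"
proof -
  have "\<bar>r * c - 1\<bar> = \<bar>(r - 1) * c + (c - 1)\<bar>" by (simp add: algebra_simps)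
  also have "\<dots> \<le> \<bar>r - 1\<bar> * c + \<bar>c - 1\<bar>"
    using assms(2) by (intro order_trans[OF abs_triangle_ineq]) (simp add: abs_mult)
  also have "\<dots> \<le> \<epsilon> / 3 * 1 + \<bar>c - 1\<bar>"
    using assms by (intro add_right_mono mult_mono) auto
  also have "\<dots> < \<epsilon>" using assms by simp
  finally show ?thesis .
qed

theorem theorem1p2:
  fixes \<Omega> :: "real \<Rightarrow> real \<Rightarrow> 'w measure"
    and V :: "real \<Rightarrow> real \<Rightarrow> int \<Rightarrow> 'w \<Rightarrow> real"
  assumes "\<And>p M. 0 < p \<Longrightarrow> p < 1 \<Longrightarrow> 0 < M \<Longrightarrow> bernoulli_potential (\<Omega> p M) (V p M) p M"
  shows "(\<forall>M\<^sub>0>0. uniform_limit {M\<^sub>0..}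
             (\<lambda>p M. - ln (annealed_speed (\<Omega> p M) (V p M)) / (2 * (exp M - 1) / p))
             (\<lambda>_. 1) (at_right 0))
       \<and> (\<forall>K. compact K \<and> K \<subseteq> {0<..<1} \<longrightarrow> uniform_limit K
             (\<lambda>M p. - ln (annealed_speed (\<Omega> p M) (V p M)) / (2 * (1 - p) * exp M / p))
             (\<lambda>_. 1) at_top)"
proof (intro conjI allI impI)
  fix M\<^sub>0 :: real assume M\<^sub>0: "0 < M\<^sub>0"
  show "uniform_limit {M\<^sub>0..} (\<lambda>p M. - ln (annealed_speed (\<Omega> p M) (V p M)) / (2 * (exp M - 1) / p))
      (\<lambda>_. 1) (at_right 0)"
  proof (rule uniform_limitI)
    fix \<epsilon>' :: real assume \<epsilon>': "0 < \<epsilon>'"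
    define \<epsilon> where "\<epsilon> = min 1 \<epsilon>'"
    have \<epsilon>: "0 < \<epsilon>" "\<epsilon> / 3 \<le> 1" "\<epsilon> \<le> \<epsilon>'" using \<epsilon>' by (auto simp: \<epsilon>_def)
    then have \<epsilon>3: "0 < \<epsilon> / 3" by simp
    obtain D\<^sub>0 where D\<^sub>0: "0 < D\<^sub>0"
      "\<And>(\<Omega> :: 'w measure) V p M. bernoulli_potential \<Omega> V p M \<Longrightarrow> p < 1 \<Longrightarrow> M\<^sub>0 \<le> M \<Longrightarrow>
        D\<^sub>0 \<le> 2 * (1 - p) * (exp M - 1) / p \<Longrightarrow>
        \<bar>- ln (annealed_speed \<Omega> V) / (2 * (1 - p) * (exp M - 1) / p) - 1\<bar> \<le> \<epsilon> / 3"
      by (rule log_speed_asymptotics[OF M\<^sub>0 \<epsilon>3 \<epsilon>(2), where 'w = 'w]) (erule that)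
    \<comment> \<open>\<open>\<epsilon> / 3\<close> controls the factor \<open>1 - p\<close>,
      \<open>1 / 2\<close> gives \<open>2 * (1 - p) \<ge> 1\<close>, and the last entry forces
      \<open>D\<^sub>0 \<le> D\<close> simultaneously for all \<open>M \<ge> M\<^sub>0\<close>,
      since \<open>exp M - 1\<close> is smallest at \<open>M\<^sub>0\<close>.\<close>
    define b where "b = min (\<epsilon> / 3) (min (1 / 2) ((exp M\<^sub>0 - 1) / D\<^sub>0))"
    have "0 < (exp M\<^sub>0 - 1) / D\<^sub>0" using M\<^sub>0 D\<^sub>0(1) by simp
    then have b: "0 < b" "b \<le> \<epsilon> / 3" "b \<le> 1 / 2" "b \<le> (exp M\<^sub>0 - 1) / D\<^sub>0"
      unfolding b_def using \<epsilon>3 by linarith+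
    have "\<forall>M\<in>{M\<^sub>0..}. dist (- ln (annealed_speed (\<Omega> p M) (V p M)) / (2 * (exp M - 1) / p)) 1 < \<epsilon>'"
      if p: "0 < p" "p < b" for p
    proof
      fix M assume "M \<in> {M\<^sub>0..}"
      then have M: "M\<^sub>0 \<le> M" "0 < M" using M\<^sub>0 by auto
      have p1: "p < 1" using p b by linarith
      have "D\<^sub>0 * p \<le> exp M\<^sub>0 - 1"
        using p b(4) D\<^sub>0(1) by (simp add: le_divide_eq mult.commute) (smt (verit) mult_left_mono)
      also have "\<dots> \<le> 1 * (exp M - 1)" using M by simp
      also have "\<dots> \<le> 2 * (1 - p) * (exp M - 1)"
        using p b(3) M by (intro mult_right_mono) auto
      finally have "D\<^sub>0 \<le> 2 * (1 - p) * (exp M - 1) / p"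
        using p by (simp add: le_divide_eq)
      from D\<^sub>0(2)[OF assms[OF p(1) p1 M(2)] p1 M(1) this]
      have "\<bar>- ln (annealed_speed (\<Omega> p M) (V p M)) / (2 * (1 - p) * (exp M - 1) / p) * (1 - p) - 1\<bar> < \<epsilon>"
        by (rule abs_mult_diff_less) (use p b p1 \<epsilon> in auto)
      also have "- ln (annealed_speed (\<Omega> p M) (V p M)) / (2 * (1 - p) * (exp M - 1) / p) * (1 - p)
          = - ln (annealed_speed (\<Omega> p M) (V p M)) / (2 * (exp M - 1) / p)"
      proof -
        have *: "x / (2 * c * E / d) * c = x / (2 * E / d)" if "c \<noteq> 0" for x c d E :: real
          using that by (simp add: divide_simps)
        show ?thesis by (rule *) (use p1 in simp)
      qed
      finally show "dist (- ln (annealed_speed (\<Omega> p M) (V p M)) / (2 * (exp M - 1) / p)) 1 < \<epsilon>'"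
        using \<epsilon>(3) by (simp add: dist_real_def)
    qed
    then show "\<forall>\<^sub>F p in at_right 0. \<forall>M\<in>{M\<^sub>0..}.
        dist (- ln (annealed_speed (\<Omega> p M) (V p M)) / (2 * (exp M - 1) / p)) 1 < \<epsilon>'"
      unfolding eventually_at_right_field using b(1) by blast
  qed
next
  fix K :: "real set" assume K: "compact K \<and> K \<subseteq> {0<..<1}"
  \<comment> \<open>\<open>D\<close> decreases in \<open>p\<close>, so a bound at the right end of
    \<open>K\<close> makes it large on all of \<open>K\<close>.\<close>
  obtain b where b: "b < 1" "\<And>p. p \<in> K \<Longrightarrow> p \<le> b"
  proof (cases "K = {}")
    case True
    then show ?thesis using that[of 0] by simp
  next
    case False
    then show ?thesis using compact_attains_sup[of K] K that by (metis greaterThanLessThan_iff subsetD)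
  qed
  show "uniform_limit K (\<lambda>M p. - ln (annealed_speed (\<Omega> p M) (V p M)) / (2 * (1 - p) * exp M / p))
      (\<lambda>_. 1) at_top"
  proof (rule uniform_limitI)
    fix \<epsilon>' :: real assume \<epsilon>': "0 < \<epsilon>'"
    define \<epsilon> where "\<epsilon> = min 1 \<epsilon>'"
    have \<epsilon>: "0 < \<epsilon>" "\<epsilon> / 3 \<le> 1" "\<epsilon> \<le> \<epsilon>'" using \<epsilon>' by (auto simp: \<epsilon>_def)
    then have \<epsilon>3: "0 < \<epsilon> / 3" by simp
    obtain D\<^sub>0 where D\<^sub>0: "0 < D\<^sub>0"
      "\<And>(\<Omega> :: 'w measure) V p M. bernoulli_potential \<Omega> V p M \<Longrightarrow> p < 1 \<Longrightarrow> 1 \<le> M \<Longrightarrow>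
        D\<^sub>0 \<le> 2 * (1 - p) * (exp M - 1) / p \<Longrightarrow>
        \<bar>- ln (annealed_speed \<Omega> V) / (2 * (1 - p) * (exp M - 1) / p) - 1\<bar> \<le> \<epsilon> / 3"
      by (rule log_speed_asymptotics[OF zero_less_one \<epsilon>3 \<epsilon>(2), where 'w = 'w]) (erule that)
    \<comment> \<open>The thresholds on \<open>M\<close> are the lower bound 1 used in place of
      \<open>M\<^sub>0\<close>, the condition \<open>exp (- M) < \<epsilon> / 3\<close>, and
      \<open>D\<^sub>0 \<le> D\<close> by way of \<open>M \<le> exp M - 1\<close>.\<close>
    have "\<forall>p\<in>K. dist (- ln (annealed_speed (\<Omega> p M) (V p M)) / (2 * (1 - p) * exp M / p)) 1 < \<epsilon>'"
      if M: "1 \<le> M" "ln (3 / \<epsilon>) < M" "D\<^sub>0 / (2 * (1 - b)) \<le> M" for M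
    proof
      fix p assume "p \<in> K"
      then have p: "0 < p" "p < 1" "p \<le> b" using K b by auto
      have M0: "0 < M" using M by simp
      have M_le: "M \<le> exp M - 1" using exp_ge_add_one_self[of M] by linarith
      have "D\<^sub>0 \<le> 2 * (1 - b) * M" using M(3) b(1) by (simp add: divide_le_eq mult_ac)
      also have "\<dots> \<le> 2 * (1 - p) * (exp M - 1)"
        using p b(1) M0 M_le by (intro mult_mono) auto
      also have "\<dots> \<le> 2 * (1 - p) * (exp M - 1) / p"
        using p M0 by (simp add: le_divide_eq mult_left_le)
      finally have large: "D\<^sub>0 \<le> 2 * (1 - p) * (exp M - 1) / p" .
      have "3 / \<epsilon> < exp M" using M(2) \<epsilon>(1) by (subst (asm) exp_less_cancel_iff[symmetric]) simp
      then have small: "exp (- M) < \<epsilon> / 3" using \<epsilon>(1) by (simp add: exp_minus field_simps)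
      from D\<^sub>0(2)[OF assms[OF p(1,2) M0] p(2) M(1) large]
      have "\<bar>- ln (annealed_speed (\<Omega> p M) (V p M)) / (2 * (1 - p) * (exp M - 1) / p) * (1 - exp (- M)) - 1\<bar> < \<epsilon>"
        by (rule abs_mult_diff_less) (use small M0 \<epsilon> in auto)
      also have "- ln (annealed_speed (\<Omega> p M) (V p M)) / (2 * (1 - p) * (exp M - 1) / p) * (1 - exp (- M))
          = - ln (annealed_speed (\<Omega> p M) (V p M)) / (2 * (1 - p) * exp M / p)"
      proof -
        have *: "x / (2 * c * (E - 1) / d) * (1 - inverse E) = x / (2 * c * E / d)"
          if "1 < E" "c \<noteq> 0" "d \<noteq> 0" for x c d E :: real
          using that by (simp add: field_simps)
        show ?thesis unfolding exp_minus by (rule *) (use M0 p in auto)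
      qed
      finally show "dist (- ln (annealed_speed (\<Omega> p M) (V p M)) / (2 * (1 - p) * exp M / p)) 1 < \<epsilon>'"
        using \<epsilon>(3) by (simp add: dist_real_def)
    qed
    then have "\<forall>\<^sub>F M in at_top. 1 \<le> M \<and> ln (3 / \<epsilon>) < M \<and> D\<^sub>0 / (2 * (1 - b)) \<le> M \<longrightarrow>
        (\<forall>p\<in>K. dist (- ln (annealed_speed (\<Omega> p M) (V p M)) / (2 * (1 - p) * exp M / p)) 1 < \<epsilon>')"
      by simp
    with eventually_ge_at_top[of 1] eventually_gt_at_top[of "ln (3 / \<epsilon>)"] eventually_ge_at_top[of "D\<^sub>0 / (2 * (1 - b))"]
    show "\<forall>\<^sub>F M in at_top. \<forall>p\<in>K.
        dist (- ln (annealed_speed (\<Omega> p M) (V p M)) / (2 * (1 - p) * exp M / p)) 1 < \<epsilon>'"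
      by eventually_elim blast
  qed
qed

end
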